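(* Let $\beta=\frac{1}{100\sqrt n\log n}$, $\gamma=\log^4 n$, and $\rho<\log^{-20}n$, and set $\alpha_1=\frac{\rho}{n^{1/2}},\ \alpha_2=\frac{\gamma\rho^2}{n},\ \alpha_3=\frac{\gamma^3\rho^3}{n^{3/2}},\ \alpha_4=\frac{\gamma^6\rho^4}{n^2}$. Then with probability at least $1-O(n^{-4})$ over $G\sim\mathbb G(n,\tfrac12)$, \[ H'_{22}\succeq \frac18\,\mathbb E[H_{22}]+\frac{\beta\lambda_0}{16}\,\Pi_W . \]
   Context: $G\sim\mathbb G(n,\tfrac12)$ on vertex set $[n]$. For $i\neq j$ let $A_{ij}=1$ if $\{i,j\}\in E(G)$ and $A_{ij}=-1$ otherwise; $A_{ii}=0$; $\mathcal G_{ij}\in\{0,1\}$ is the edge indicator. Set $\alpha_0=1$. $N=N(G,\underline\alpha)$ has rows and columns indexed by subsets of $[n]$ of size at most $2$, $N_{A,B}=\alpha_{|A\cup B|}\prod_{i\in A\setminus B,\ j\in B\setminus A}\mathcal G_{ij}$; $\mathcal A_{A,B}=\alpha_{|A|}\alpha_{|B|}$. $H_{22}$ is the submatrix of $N-\mathcal A$ with rows and columns indexed by $2$-element subsets; $\mathbb E$ is expectation over $G$. $Q(A,B)=H_{22}(A,B)-\mathbb E[H_{22}](A,B)$ if $A\cap B=\emptyset$ and $0$ otherwise; $K=H_{22}-\mathbb E[H_{22}]-Q$. For $i\in[n]$, $a_i\in\mathbb R^{\binom n2}$ is $a_i(\{k,\ell\})=A_{ik}A_{i\ell}$, $D_i=\mathrm{diag}(a_i)$,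 $W=\mathrm{span}\{a_1,\dots,a_n\}$, $\Pi_W$ the orthogonal projection onto $W$. $J$ is the all-ones $\binom n2\times\binom n2$ matrix. Define \[ H'_{22}=H_{22}+\beta\sum_{i\in[n]}D_i\Big(H_{22}+\tfrac1{16}\alpha_2^2J-K\Big)D_i . \] $\lambda_0=\alpha_2+(n-2)\alpha_3+\frac{(n-2)(n-3)}{32}\alpha_4-\frac{n(n-1)}2\alpha_2^2$ (the eigenvalue of $\mathbb E[H_{22}]$ on the all-ones vector).
   Formalization: The formal theorem assumes ρ ≥ 0 in addition to ρ < log^{-20} n (for ρ tending to −∞ the diagonal of the difference becomes negative, so the literal claim fails), and n ≥ 2 so that log n is nonzero. *)

theory Defs
  imports "HOL-Probability.Probability" "HOL-Probability.Product_PMF"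
begin

section \<open>Matrices over a finite index set\<close>

text \<open>A real matrix with rows and columns indexed by a finite set \<open>I\<close> is a function of two
  arguments, of which only the entries in \<open>I \<times> I\<close> are relevant.\<close>

definition mat_mult_on :: "'a set \<Rightarrow> ('a \<Rightarrow> 'a \<Rightarrow> real) \<Rightarrow> ('a \<Rightarrow> 'a \<Rightarrow> real) \<Rightarrow> 'a \<Rightarrow> 'a \<Rightarrow> real" where
  "mat_mult_on I M L A B = (\<Sum>C\<in>I. M A C * L C B)"

definition diag_mat :: "('a \<Rightarrow> real) \<Rightarrow> 'a \<Rightarrow> 'a \<Rightarrow> real" where
  "diag_mat v A B = (if A = B then v A else 0)"

definition psd_on :: "'a set \<Rightarrow> ('a \<Rightarrow> 'a \<Rightarrow> real) \<Rightarrow> bool" where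
  "psd_on I M \<longleftrightarrow>
     (\<forall>A\<in>I. \<forall>B\<in>I. M A B = M B A) \<and>
     (\<forall>x. 0 \<le> (\<Sum>A\<in>I. \<Sum>B\<in>I. x A * M A B * x B))"

definition loewner_le_on :: "'a set \<Rightarrow> ('a \<Rightarrow> 'a \<Rightarrow> real) \<Rightarrow> ('a \<Rightarrow> 'a \<Rightarrow> real) \<Rightarrow> bool" where
  "loewner_le_on I L M \<longleftrightarrow> psd_on I (\<lambda>A B. M A B - L A B)"

definition inner_on :: "'a set \<Rightarrow> ('a \<Rightarrow> real) \<Rightarrow> ('a \<Rightarrow> real) \<Rightarrow> real" where
  "inner_on I u v = (\<Sum>A\<in>I. u A * v A)"

definition span_family :: "'i set \<Rightarrow> ('i \<Rightarrow> 'a \<Rightarrow> real) \<Rightarrow> ('a \<Rightarrow> real) set" where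
  "span_family F a = {(\<lambda>A. \<Sum>i\<in>F. c i * a i A) | c. True}"

text \<open>The orthogonal projection onto \<open>W\<close> is characterised by \<open>w \<in> W\<close> and \<open>x - w \<bottom> W\<close>. The vectors
  in \<open>W\<close> have to vanish outside of \<open>I\<close>, otherwise it would not be unique as a function; see
  \<open>orth_proj_on_ex1\<close> below for existence and uniqueness.\<close>

definition orth_proj_on :: "'a set \<Rightarrow> ('a \<Rightarrow> real) set \<Rightarrow> ('a \<Rightarrow> real) \<Rightarrow> 'a \<Rightarrow> real" where
  "orth_proj_on I W x = (THE w. w \<in> W \<and> (\<forall>v\<in>W. inner_on I (\<lambda>A. x A - w A) v = 0))"

definition proj_mat_on :: "'a set \<Rightarrow> ('a \<Rightarrow> real) set \<Rightarrow> 'a \<Rightarrow> 'a \<Rightarrow> real" where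
  "proj_mat_on I W A B = orth_proj_on I W (\<lambda>C. if C = B then 1 else 0) A"

lemma span_familyI: "(\<lambda>A. \<Sum>i\<in>F. c i * a i A) \<in> span_family F a"
  unfolding span_family_def by blast

lemma span_family_lincomb:
  assumes "u \<in> span_family F a" "v \<in> span_family F a"
  shows "(\<lambda>A. s * u A + t * v A) \<in> span_family F a"
proof -
  obtain c d where cd: "u = (\<lambda>A. \<Sum>i\<in>F. c i * a i A)" "v = (\<lambda>A. \<Sum>i\<in>F. d i * a i A)"
    using assms unfolding span_family_def by blast
  have "(\<lambda>A. s * u A + t * v A) = (\<lambda>A. \<Sum>i\<in>F. (s * c i + t * d i) * a i A)"
    unfolding cd by (simp add: sum_distrib_left sum.distrib algebra_simps)
  then show ?thesis by (simp add: span_familyI)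
qed

lemma span_family_base:
  assumes "finite F" "j \<in> F"
  shows "a j \<in> span_family F a"
proof -
  have "(\<lambda>A. \<Sum>i\<in>F. (if i = j then 1 else 0) * a i A) = a j"
    using assms by (simp add: if_distribR if_distrib[of "\<lambda>x. x * _"] cong: if_cong)
  then show ?thesis using span_familyI[where F = F and c = "\<lambda>i. if i = j then 1 else 0" and a = a] by simp
qed

lemma span_family_mono:
  assumes "finite F" "j \<notin> F" "u \<in> span_family F a"
  shows "u \<in> span_family (insert j F) a"
proof -
  obtain c where c: "u = (\<lambda>A. \<Sum>i\<in>F. c i * a i A)"
    using assms unfolding span_family_def by blast
  have "(\<Sum>i\<in>insert j F. (c(j := 0)) i * a i A) = (\<Sum>i\<in>F. c i * a i A)" for A
  proof -
    have "(\<Sum>i\<in>F. (c(j := 0)) i * a i A) = (\<Sum>i\<in>F. c i * a i A)"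
      using assms(2) by (intro sum.cong) auto
    then show ?thesis using assms(1,2) by simp
  qed
  then show ?thesis using span_familyI[where F = "insert j F" and c = "c(j := 0)" and a = a] unfolding c by simp
qed

lemma inner_on_lincomb:
  "inner_on I (\<lambda>A. s * u A + t * v A) w = s * inner_on I u w + t * inner_on I v w"
  unfolding inner_on_def by (simp add: sum_distrib_left sum.distrib algebra_simps)

lemma inner_on_diff:
  "inner_on I (\<lambda>A. u A - v A) w = inner_on I u w - inner_on I v w"
  unfolding inner_on_def by (simp add: sum_subtractf algebra_simps)

lemma inner_on_sum_right:
  "inner_on I u (\<lambda>A. \<Sum>i\<in>F. c i * a i A) = (\<Sum>i\<in>F. c i * inner_on I u (a i))"
  unfolding inner_on_def sum_distrib_left by (subst sum.swap) (simp add: mult.left_commute)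

lemma span_family_orth:
  assumes "\<And>i. i \<in> F \<Longrightarrow> inner_on I u (a i) = 0" "v \<in> span_family F a"
  shows "inner_on I u v = 0"
  using assms unfolding span_family_def by (auto simp: inner_on_sum_right)

lemma span_family_zero_off:
  assumes "\<And>i A. i \<in> F \<Longrightarrow> A \<notin> I \<Longrightarrow> a i A = 0" "v \<in> span_family F a" "A \<notin> I"
  shows "v A = 0"
  using assms unfolding span_family_def by auto

lemma inner_on_self_eq_0:
  assumes "finite I" "inner_on I u u = 0" "A \<in> I"
  shows "u A = 0"
proof -
  have "(\<Sum>A\<in>I. u A * u A) = 0 \<longleftrightarrow> (\<forall>A\<in>I. u A * u A = 0)"
    using assms(1) by (intro sum_nonneg_eq_0_iff) auto
  then show ?thesis using assms(2,3) unfolding inner_on_def by auto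
qed

lemma orth_proj_on_exists:
  assumes "finite I" "finite F" "\<And>i A. i \<in> F \<Longrightarrow> A \<notin> I \<Longrightarrow> a i A = 0"
  shows "\<exists>w \<in> span_family F a. \<forall>v\<in>span_family F a. inner_on I (\<lambda>A. x A - w A) v = 0"
  using assms(2,3)
proof (induction F arbitrary: x rule: finite_induct)
  case empty
  then show ?case by (auto simp: span_family_def inner_on_def)
next
  case (insert j F)
  let ?W = "span_family F a" and ?W' = "span_family (insert j F) a"
  have ex: "\<exists>w \<in> ?W. \<forall>v\<in>?W. inner_on I (\<lambda>A. y A - w A) v = 0" for y
    using insert.IH[of y] insert.prems by blast
  obtain p where p: "p \<in> ?W" "\<forall>v\<in>?W. inner_on I (\<lambda>A. x A - p A) v = 0"
    using ex[of x] by blast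
  obtain q where q: "q \<in> ?W" "\<forall>v\<in>?W. inner_on I (\<lambda>A. a j A - q A) v = 0"
    using ex[of "a j"] by blast
  define u where "u = (\<lambda>A. a j A - q A)"
  have uW: "inner_on I u v = 0" if "v \<in> ?W" for v using q that unfolding u_def by blast
  have gen: "a i \<in> ?W" if "i \<in> F" for i
    by (rule span_family_base[OF insert.hyps(1) that])
  have aj: "a j \<in> ?W'" using span_family_base[of "insert j F" j a] insert.hyps by simp
  have q': "q \<in> ?W'" and p': "p \<in> ?W'" using span_family_mono[OF insert.hyps] p(1) q(1) by auto
  have u': "u \<in> ?W'"
    using span_family_lincomb[OF aj q', of 1 "-1"] unfolding u_def by simp
  define t where "t = inner_on I (\<lambda>A. x A - p A) u / inner_on I u u"
  define w where "w = (\<lambda>A. 1 * p A + t * u A)"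
  have w': "w \<in> ?W'" unfolding w_def by (rule span_family_lincomb[OF p' u'])
  have split: "inner_on I (\<lambda>A. x A - w A) v = inner_on I (\<lambda>A. x A - p A) v - t * inner_on I u v"
    for v
    unfolding w_def inner_on_diff inner_on_lincomb by simp
  have "inner_on I (\<lambda>A. x A - w A) u = 0"
  proof (cases "inner_on I u u = 0")
    case True
    then have "u A = 0" if "A \<in> I" for A using inner_on_self_eq_0[OF assms(1) _ that] by blast
    then show ?thesis unfolding inner_on_def by (intro sum.neutral) simp
  next
    case False
    then show ?thesis unfolding split t_def by simp
  qed
  moreover have orthW: "inner_on I (\<lambda>A. x A - w A) v = 0" if "v \<in> ?W" for v
    unfolding split using p uW that by simp
  moreover have "inner_on I y (a j) = inner_on I y u + inner_on I y q" for y
    unfolding u_def inner_on_def by (simp add: right_diff_distrib sum_subtractf)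
  ultimately have "inner_on I (\<lambda>A. x A - w A) (a j) = 0" using q(1) by simp
  then have gen0: "inner_on I (\<lambda>A. x A - w A) (a i) = 0" if "i \<in> insert j F" for i
    using that orthW[OF gen, of i] by blast
  have "\<forall>v\<in>?W'. inner_on I (\<lambda>A. x A - w A) v = 0"
    using span_family_orth[where F = "insert j F" and a = a, OF gen0] by simp
  then show ?case using w' by blast
qed

lemma orth_proj_on_ex1:
  assumes "finite I" "finite F" "\<And>i A. i \<in> F \<Longrightarrow> A \<notin> I \<Longrightarrow> a i A = 0"
  defines "W \<equiv> span_family F a"
  shows "\<exists>!w. w \<in> W \<and> (\<forall>v\<in>W. inner_on I (\<lambda>A. x A - w A) v = 0)"
proof -
  have uniq: "w = z"
    if w: "w \<in> W" "\<forall>v\<in>W. inner_on I (\<lambda>A. x A - w A) v = 0"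
    and z: "z \<in> W" "\<forall>v\<in>W. inner_on I (\<lambda>A. x A - z A) v = 0" for w z
  proof
    fix A
    define d where "d = (\<lambda>A. w A - z A)"
    have dW: "d \<in> W"
      using span_family_lincomb[of w F a z 1 "-1"] w z unfolding d_def W_def by simp
    have "inner_on I d d = inner_on I (\<lambda>A. x A - z A) d - inner_on I (\<lambda>A. x A - w A) d"
      unfolding d_def inner_on_diff by simp
    then have 0: "inner_on I d d = 0" using w z dW by simp
    show "w A = z A"
    proof (cases "A \<in> I")
      case True
      then show ?thesis using inner_on_self_eq_0[OF assms(1) 0] unfolding d_def by simp
    next
      case False
      then have "w A = 0" "z A = 0"
        using span_family_zero_off[of F I a] assms(3) w z unfolding W_def by blast+
      then show ?thesis by simp
    qed
  qed
  have "\<exists>w \<in> W. \<forall>v\<in>W. inner_on I (\<lambda>A. x A - w A) v = 0"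
    unfolding W_def by (rule orth_proj_on_exists) (use assms in auto)
  then show ?thesis using uniq by blast
qed

lemma orth_proj_on:
  assumes "finite I" "finite F" "\<And>i A. i \<in> F \<Longrightarrow> A \<notin> I \<Longrightarrow> a i A = 0"
  defines "W \<equiv> span_family F a"
  shows "orth_proj_on I W x \<in> W"
    and "v \<in> W \<Longrightarrow> inner_on I (\<lambda>A. x A - orth_proj_on I W x A) v = 0"
proof -
  have "\<exists>!w. w \<in> W \<and> (\<forall>v\<in>W. inner_on I (\<lambda>A. x A - w A) v = 0)"
    unfolding W_def by (rule orth_proj_on_ex1) (use assms in auto)
  from theI'[OF this] show "orth_proj_on I W x \<in> W"
    and "v \<in> W \<Longrightarrow> inner_on I (\<lambda>A. x A - orth_proj_on I W x A) v = 0"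
    unfolding orth_proj_on_def by blast+
qed


section \<open>The random graph\<close>

definition pairs :: "nat \<Rightarrow> nat set set" where
  "pairs n = {S. S \<subseteq> {1..n} \<and> card S = 2}"

text \<open>A graph on \<open>{1..n}\<close> is given by its set of edges, a subset of \<open>pairs n\<close>.\<close>

definition gnp :: "nat \<Rightarrow> real \<Rightarrow> nat set set pmf" where
  "gnp n p = map_pmf (\<lambda>f. {e \<in> pairs n. f e}) (Pi_pmf (pairs n) False (\<lambda>_. bernoulli_pmf p))"

definition adj_sign :: "nat set set \<Rightarrow> nat \<Rightarrow> nat \<Rightarrow> real" where
  "adj_sign G i j = (if i = j then 0 else if {i, j} \<in> G then 1 else -1)"

definition edge_ind :: "nat set set \<Rightarrow> nat \<Rightarrow> nat \<Rightarrow> real" where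
  "edge_ind G i j = (if {i, j} \<in> G then 1 else 0)"


section \<open>The moment matrix and its degree-2 block\<close>

definition N_mat :: "(nat \<Rightarrow> real) \<Rightarrow> nat set set \<Rightarrow> nat set \<Rightarrow> nat set \<Rightarrow> real" where
  "N_mat \<alpha> G A B = \<alpha> (card (A \<union> B)) * (\<Prod>i\<in>A - B. \<Prod>j\<in>B - A. edge_ind G i j)"

definition rank1_mat :: "(nat \<Rightarrow> real) \<Rightarrow> nat set \<Rightarrow> nat set \<Rightarrow> real" where
  "rank1_mat \<alpha> A B = \<alpha> (card A) * \<alpha> (card B)"

text \<open>The block \<open>H\<^sub>2\<^sub>2\<close> and all matrices below are indexed by \<open>pairs n\<close>.\<close>

definition H22 :: "(nat \<Rightarrow> real) \<Rightarrow> nat set set \<Rightarrow> nat set \<Rightarrow> nat set \<Rightarrow> real" where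
  "H22 \<alpha> G A B = N_mat \<alpha> G A B - rank1_mat \<alpha> A B"

definition EH22 :: "nat \<Rightarrow> (nat \<Rightarrow> real) \<Rightarrow> nat set \<Rightarrow> nat set \<Rightarrow> real" where
  "EH22 n \<alpha> A B = measure_pmf.expectation (gnp n (1/2)) (\<lambda>G. H22 \<alpha> G A B)"

definition Q_mat :: "nat \<Rightarrow> (nat \<Rightarrow> real) \<Rightarrow> nat set set \<Rightarrow> nat set \<Rightarrow> nat set \<Rightarrow> real" where
  "Q_mat n \<alpha> G A B = (if A \<inter> B = {} then H22 \<alpha> G A B - EH22 n \<alpha> A B else 0)"

definition K_mat :: "nat \<Rightarrow> (nat \<Rightarrow> real) \<Rightarrow> nat set set \<Rightarrow> nat set \<Rightarrow> nat set \<Rightarrow> real" where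
  "K_mat n \<alpha> G A B = H22 \<alpha> G A B - EH22 n \<alpha> A B - Q_mat n \<alpha> G A B"

definition a_vec :: "nat \<Rightarrow> nat set set \<Rightarrow> nat \<Rightarrow> nat set \<Rightarrow> real" where
  "a_vec n G i S = (if S \<in> pairs n then \<Prod>k\<in>S. adj_sign G i k else 0)"

definition W_space :: "nat \<Rightarrow> nat set set \<Rightarrow> (nat set \<Rightarrow> real) set" where
  "W_space n G = span_family {1..n} (a_vec n G)"

definition Pi_W :: "nat \<Rightarrow> nat set set \<Rightarrow> nat set \<Rightarrow> nat set \<Rightarrow> real" where
  "Pi_W n G = proj_mat_on (pairs n) (W_space n G)"

definition H22' :: "nat \<Rightarrow> (nat \<Rightarrow> real) \<Rightarrow> real \<Rightarrow> nat set set \<Rightarrow> nat set \<Rightarrow> nat set \<Rightarrow> real" where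
  "H22' n \<alpha> \<beta> G A B = H22 \<alpha> G A B +
     \<beta> * (\<Sum>i\<in>{1..n}.
       mat_mult_on (pairs n)
         (mat_mult_on (pairs n)
           (diag_mat (a_vec n G i))
           (\<lambda>A B. H22 \<alpha> G A B + 1/16 * (\<alpha> 2)\<^sup>2 - K_mat n \<alpha> G A B))
         (diag_mat (a_vec n G i)) A B)"

definition lambda0 :: "nat \<Rightarrow> (nat \<Rightarrow> real) \<Rightarrow> real" where
  "lambda0 n \<alpha> = \<alpha> 2 + (real n - 2) * \<alpha> 3 + (real n - 2) * (real n - 3) / 32 * \<alpha> 4
     - real n * (real n - 1) / 2 * (\<alpha> 2)\<^sup>2"

end

theory Submission
  imports Defs "HOL-Real_Asymp.Real_Asymp"
begin

text \<open>Expanding every edge indicator as \<open>(1 + A\<^sub>i\<^sub>j) / 2\<close> turns \<open>Q\<close>, \<open>\<Sum>D\<^sub>i Q D\<^sub>i\<close> and the Gram matrix of the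
  \<open>a\<^sub>i\<close> into sums of graph matrices: their entries are sums, over injective labellings of a fixed
  template graph, of products of signs. The norm of such a matrix is, up to powers of \<open>ln n\<close>, at most
  \<open>n\<close> to the power \<open>(|V| - s) / 2\<close>, where \<open>s\<close> is the size of a smallest vertex separator between row and
  column vertices. This follows by averaging over colourings of the vertices, which makes the signs of
  different template edges independent, and then applying a noncommutative Khintchine inequality to one
  template edge at a time.

  The quadratic form of \<open>\<bbbE>[H\<^sub>2\<^sub>2]\<close> is an explicit combination of \<open>(\<Sum>x)\<^sup>2\<close>, \<open>D\<^sup>2\<close> and \<open>|x|\<^sup>2\<close> with \<open>D\<close> the vector of
  degrees of \<open>x\<close>. The templates with \<open>s = 2\<close> are absorbed by \<open>|x|\<^sup>2\<close>, the single edge by \<open>D\<^sup>2\<close>, and the path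
  of length two gives the form \<open>\<Sum>\<^sub>k d\<^sub>k \<langle>a\<^sub>k, x\<rangle>\<close>, which is split between \<open>D\<^sup>2\<close> and the contribution
  \<open>\<langle>a\<^sub>k, x\<rangle>\<^sup>2\<close> of \<open>\<Sum>D\<^sub>i \<bbbE>[H\<^sub>2\<^sub>2] D\<^sub>i\<close>. The latter also dominates \<open>\<Pi>\<^sub>W\<close>, because the \<open>a\<^sub>i\<close> are nearly
  orthogonal.\<close>

section \<open>Moments of random signed sums of matrices\<close>

text \<open>What forces the correction is a single template: the path with edges \<open>kp\<close>,
  \<open>kq\<close> between the row \<open>{k,l}\<close> and the column \<open>{p,q}\<close>. The
  vertex \<open>k\<close> alone separates it, so its norm has order n^(3/2). Since
  \<open>\<alpha> 4 / \<alpha> 2\<close> is (ln n)^20 \<rho>^2 / n, the contribution exceeds the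
  coefficient of |x|^2 by sqrt n, up to logarithms and \<rho>. It has to be split as D b, and the
  arithmetic-geometric mean then asks for \<beta> at least a multiple of
  \<open>\<alpha> 4 / \<alpha> 3\<close>, which is (ln n)^12 \<rho> / sqrt n. In the other direction
  the norm of the sum of \<open>D\<^sub>i Q D\<^sub>i\<close>, of order \<open>\<alpha> 4\<close>
  n^(3/2), and the part n \<open>\<alpha> 3\<close> of \<open>lambda0\<close>, both multiplied by
  \<beta>, must stay below \<open>\<alpha> 2\<close>. So \<beta> has to be close to n^(-1/2). The
  powers of ln n lost in the norm bounds are paid for by the smallness of \<rho>.\<close>

definition frob :: "'a set \<Rightarrow> ('a \<Rightarrow> 'a \<Rightarrow> real) \<Rightarrow> ('a \<Rightarrow> 'a \<Rightarrow> real) \<Rightarrow> real" where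
  "frob J A B = (\<Sum>i\<in>J. \<Sum>j\<in>J. A i j * B i j)"

text \<open>Matrices are total functions on the index type. The support condition makes
  \<open>id_on J\<close> a two-sided unit, so that identities for powers hold as equalities of
  functions.\<close>

definition supported_on :: "'a set \<Rightarrow> ('a \<Rightarrow> 'a \<Rightarrow> real) \<Rightarrow> bool" where
  "supported_on J A \<longleftrightarrow> (\<forall>i j. A i j \<noteq> 0 \<longrightarrow> i \<in> J \<and> j \<in> J)"

definition sym_mat :: "('a \<Rightarrow> 'a \<Rightarrow> real) \<Rightarrow> bool" where
  "sym_mat A \<longleftrightarrow> (\<forall>i j. A i j = A j i)"

definition id_on :: "'a set \<Rightarrow> 'a \<Rightarrow> 'a \<Rightarrow> real" where
  "id_on J i j = (if i = j \<and> i \<in> J then 1 else 0)"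

definition mpow :: "'a set \<Rightarrow> ('a \<Rightarrow> 'a \<Rightarrow> real) \<Rightarrow> nat \<Rightarrow> 'a \<Rightarrow> 'a \<Rightarrow> real" where
  "mpow J X m = (mat_mult_on J X ^^ m) (id_on J)"

section \<open>Matrix algebra over a finite index set and the Frobenius inner product\<close>

lemma mat_mult_on_assoc:
  "mat_mult_on J (mat_mult_on J A B) C = mat_mult_on J A (mat_mult_on J B C)"
proof (intro ext)
  fix i j
  have "mat_mult_on J (mat_mult_on J A B) C i j = (\<Sum>k\<in>J. \<Sum>l\<in>J. A i l * B l k * C k j)"
    unfolding mat_mult_on_def by (simp add: sum_distrib_right)
  also have "\<dots> = (\<Sum>l\<in>J. \<Sum>k\<in>J. A i l * B l k * C k j)" by (rule sum.swap)
  also have "\<dots> = mat_mult_on J A (mat_mult_on J B C) i j"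
    unfolding mat_mult_on_def by (simp add: sum_distrib_left mult.assoc)
  finally show "mat_mult_on J (mat_mult_on J A B) C i j = mat_mult_on J A (mat_mult_on J B C) i j" .
qed

lemma mat_mult_on_id_right:
  assumes "finite J" "supported_on J A"
  shows "mat_mult_on J A (id_on J) = A"
proof (intro ext)
  fix i j
  have "mat_mult_on J A (id_on J) i j = (\<Sum>k\<in>J. if k = j then A i k else 0)"
    unfolding mat_mult_on_def id_on_def by (intro sum.cong) auto
  also have "\<dots> = A i j" using assms by (auto simp: supported_on_def)
  finally show "mat_mult_on J A (id_on J) i j = A i j" .
qed

lemma mat_mult_on_id_left:
  assumes "finite J" "supported_on J A"
  shows "mat_mult_on J (id_on J) A = A"
proof (intro ext)
  fix i j
  have "mat_mult_on J (id_on J) A i j = (\<Sum>k\<in>J. if k = i then A k j else 0)"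
    unfolding mat_mult_on_def id_on_def by (intro sum.cong) auto
  also have "\<dots> = A i j" using assms by (auto simp: supported_on_def)
  finally show "mat_mult_on J (id_on J) A i j = A i j" .
qed

lemma mat_mult_on_diff_left:
  "mat_mult_on J (\<lambda>i j. A i j - B i j) C = (\<lambda>i j. mat_mult_on J A C i j - mat_mult_on J B C i j)"
  unfolding mat_mult_on_def by (simp add: sum_subtractf left_diff_distrib)

lemma mat_mult_on_diff_right:
  "mat_mult_on J A (\<lambda>i j. B i j - C i j) = (\<lambda>i j. mat_mult_on J A B i j - mat_mult_on J A C i j)"
  unfolding mat_mult_on_def by (simp add: sum_subtractf right_diff_distrib)

lemma mat_mult_on_sum_left:
  "mat_mult_on J (\<lambda>i j. \<Sum>a\<in>I. s a * H a i j) C = (\<lambda>i j. \<Sum>a\<in>I. s a * mat_mult_on J (H a) C i j)"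
  unfolding mat_mult_on_def sum_distrib_right sum_distrib_left
  by (intro ext, subst sum.swap) (simp add: mult.assoc)

lemma mat_mult_on_sum_right:
  "mat_mult_on J A (\<lambda>i j. \<Sum>a\<in>I. s a * H a i j) = (\<lambda>i j. \<Sum>a\<in>I. s a * mat_mult_on J A (H a) i j)"
  unfolding mat_mult_on_def sum_distrib_right sum_distrib_left
  by (intro ext, subst sum.swap) (simp add: mult.left_commute)

lemma mat_mult_on_scale_left:
  "mat_mult_on J (\<lambda>i j. s * A i j) C = (\<lambda>i j. s * mat_mult_on J A C i j)"
  unfolding mat_mult_on_def sum_distrib_left by (simp add: mult.assoc)

lemma frob_sum_left:
  "frob J (\<lambda>i j. \<Sum>a\<in>I. s a * H a i j) B = (\<Sum>a\<in>I. s a * frob J (H a) B)"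
proof -
  have "frob J (\<lambda>i j. \<Sum>a\<in>I. s a * H a i j) B = (\<Sum>i\<in>J. \<Sum>j\<in>J. \<Sum>a\<in>I. s a * H a i j * B i j)"
    unfolding frob_def sum_distrib_right ..
  also have "\<dots> = (\<Sum>i\<in>J. \<Sum>a\<in>I. \<Sum>j\<in>J. s a * H a i j * B i j)"
    by (intro sum.cong refl sum.swap)
  also have "\<dots> = (\<Sum>a\<in>I. \<Sum>i\<in>J. \<Sum>j\<in>J. s a * H a i j * B i j)" by (rule sum.swap)
  finally show ?thesis by (simp add: frob_def sum_distrib_left mult.assoc)
qed

lemma frob_commute: "frob J A B = frob J B A"
  unfolding frob_def by (simp add: mult.commute)

lemma frob_sum_right:
  "frob J B (\<lambda>i j. \<Sum>a\<in>I. s a * H a i j) = (\<Sum>a\<in>I. s a * frob J B (H a))"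
  by (simp add: frob_commute[of J B] frob_sum_left)

lemma frob_diff_right: "frob J A (\<lambda>i j. B i j - C i j) = frob J A B - frob J A C"
  unfolding frob_def by (simp add: right_diff_distrib sum_subtractf)

lemma frob_self_nonneg: "0 \<le> frob J A A"
  unfolding frob_def by (intro sum_nonneg) simp

lemma frob_le_mean: "frob J A B \<le> (frob J A A + frob J B B) / 2"
proof -
  have "frob J A B \<le> (\<Sum>i\<in>J. \<Sum>j\<in>J. (A i j * A i j + B i j * B i j) / 2)"
    unfolding frob_def
  proof (intro sum_mono)
    fix i j
    have "0 \<le> (A i j - B i j)\<^sup>2" by simp
    then show "A i j * B i j \<le> (A i j * A i j + B i j * B i j) / 2"
      by (simp add: power2_eq_square algebra_simps)
  qed
  then show ?thesis
    unfolding frob_def by (simp add: sum.distrib sum_divide_distrib add_divide_distrib)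
qed

lemma frob_lmul:
  assumes "sym_mat X"
  shows "frob J (mat_mult_on J X A) B = frob J A (mat_mult_on J X B)"
proof -
  have "frob J (mat_mult_on J X A) B = (\<Sum>i\<in>J. \<Sum>j\<in>J. \<Sum>k\<in>J. X i k * A k j * B i j)"
    unfolding frob_def mat_mult_on_def sum_distrib_right ..
  also have "\<dots> = (\<Sum>i\<in>J. \<Sum>k\<in>J. \<Sum>j\<in>J. X i k * A k j * B i j)"
    by (intro sum.cong refl sum.swap)
  also have "\<dots> = (\<Sum>k\<in>J. \<Sum>i\<in>J. \<Sum>j\<in>J. X i k * A k j * B i j)" by (rule sum.swap)
  also have "\<dots> = (\<Sum>k\<in>J. \<Sum>j\<in>J. \<Sum>i\<in>J. X i k * A k j * B i j)"
    by (intro sum.cong refl sum.swap)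
  also have "\<dots> = (\<Sum>k\<in>J. \<Sum>j\<in>J. \<Sum>i\<in>J. A k j * (X k i * B i j))"
    using assms unfolding sym_mat_def by (simp add: mult_ac)
  finally show ?thesis unfolding frob_def mat_mult_on_def sum_distrib_left .
qed

lemma frob_transpose: "frob J (\<lambda>i j. A j i) (\<lambda>i j. B j i) = frob J A B"
  unfolding frob_def by (rule sum.swap)

lemma mat_mult_on_transpose:
  "mat_mult_on J A B j i = mat_mult_on J (\<lambda>i j. B j i) (\<lambda>i j. A j i) i j"
  unfolding mat_mult_on_def by (simp add: mult.commute)

lemma frob_rmul:
  assumes "sym_mat Y"
  shows "frob J (mat_mult_on J A Y) B = frob J A (mat_mult_on J B Y)"
proof -
  have Y: "(\<lambda>i j. Y j i) = Y" using assms by (auto simp: sym_mat_def)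
  have "frob J (mat_mult_on J A Y) B = frob J (mat_mult_on J Y (\<lambda>i j. A j i)) (\<lambda>i j. B j i)"
    by (subst frob_transpose[symmetric], subst mat_mult_on_transpose) (simp add: Y)
  also have "\<dots> = frob J (\<lambda>i j. A j i) (mat_mult_on J Y (\<lambda>i j. B j i))"
    by (rule frob_lmul[OF assms])
  also have "\<dots> = frob J A (mat_mult_on J B Y)"
  proof -
    have "mat_mult_on J Y (\<lambda>i j. B j i) = (\<lambda>i j. mat_mult_on J B Y j i)"
      by (intro ext, subst (2) mat_mult_on_transpose) (simp add: Y)
    then show ?thesis using frob_transpose[of J A "mat_mult_on J B Y"] by simp
  qed
  finally show ?thesis .
qed

section \<open>Powers of commuting one-sided multiplications\<close>

lemma funpow_commute_ops:
  assumes "\<And>A. f (g A) = g (f A)"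
  shows "(f ^^ p) ((g ^^ q) A) = (g ^^ q) ((f ^^ p) A)"
proof -
  have 1: "f ((g ^^ q) A) = (g ^^ q) (f A)" for A
    by (induction q) (simp_all add: assms)
  show ?thesis by (induction p) (simp_all add: 1)
qed

lemma frob_funpow:
  assumes "\<And>A B. frob J (f A) B = frob J A (f B)"
  shows "frob J ((f ^^ p) A) B = frob J A ((f ^^ p) B)"
  by (induction p arbitrary: A B) (simp_all add: assms funpow_swap1)

text \<open>\<open>mpow\<close> is built by left multiplication. Left and right multiplication by
  \<open>X\<close> commute and agree on \<open>id_on J\<close>, so the same power can be built from
  the right, the form that \<open>frob_rmul\<close> can move across the inner product.\<close>

lemma mpow_conv_right:
  assumes "finite J" "supported_on J X"
  shows "mpow J X m = ((\<lambda>A. mat_mult_on J A X) ^^ m) (id_on J)"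
proof (induction m)
  case 0
  show ?case by (simp add: mpow_def)
next
  case (Suc m)
  have "mpow J X (Suc m) = mat_mult_on J X (mpow J X m)" by (simp add: mpow_def)
  also have "\<dots> = mat_mult_on J X (((\<lambda>A. mat_mult_on J A X) ^^ m) (id_on J))" by (simp add: Suc)
  also have "\<dots> = ((\<lambda>A. mat_mult_on J A X) ^^ m) (mat_mult_on J X (id_on J))"
    using funpow_commute_ops[of "mat_mult_on J X" "\<lambda>A. mat_mult_on J A X" 1 m "id_on J"]
    by (simp add: mat_mult_on_assoc)
  also have "mat_mult_on J X (id_on J) = mat_mult_on J (id_on J) X"
    using assms by (simp add: mat_mult_on_id_left mat_mult_on_id_right)
  finally show ?case by (simp add: funpow_swap1[of "\<lambda>A. mat_mult_on J A X" m])
qed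

lemma mat_mult_on_mpow:
  assumes "finite J" "supported_on J X" "supported_on J H"
  shows "mat_mult_on J H (mpow J X m) = ((\<lambda>A. mat_mult_on J A X) ^^ m) H"
proof -
  have "mat_mult_on J H (mpow J X m) = ((\<lambda>A. mat_mult_on J A X) ^^ m) (mat_mult_on J H (id_on J))"
    unfolding mpow_conv_right[OF assms(1,2)]
    using funpow_commute_ops[of "mat_mult_on J H" "\<lambda>A. mat_mult_on J A X" 1 m "id_on J"]
    by (simp add: mat_mult_on_assoc)
  then show ?thesis using assms by (simp add: mat_mult_on_id_right)
qed

text \<open>Midpoint convexity makes the increments nondecreasing: once the sequence rises it keeps
  rising up to the right end point, and as long as it does not rise it is bounded by its
  predecessor.\<close>

lemma convex_seq_le_endpoints:
  fixes g :: "nat \<Rightarrow> real"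
  assumes "\<And>a. 0 < a \<Longrightarrow> a < m \<Longrightarrow> g a \<le> (g (a - 1) + g (a + 1)) / 2" "a \<le> m"
  shows "g a \<le> max (g 0) (g m)"
proof -
  \<comment> \<open>The increment over \<open>j\<close> steps is a sum of \<open>j\<close>
    increments, each at least the first one.\<close>
  have up: "g (b + j) - g b \<ge> real j * (g (Suc b) - g b)" if "b + j \<le> m" for b j
    using that
  proof (induction j)
    case 0
    then show ?case by simp
  next
    case (Suc j)
    have mono: "g (Suc (b + i)) - g (b + i) \<ge> g (Suc b) - g b" if "b + i < m" for i
      using that
    proof (induction i)
      case 0
      then show ?case by simp
    next
      case (Suc i)
      have "g (b + Suc i) \<le> (g (b + i) + g (Suc (b + Suc i))) / 2"
        using assms(1)[of "b + Suc i"] Suc.prems by simp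
      then show ?case using Suc by simp
    qed
    show ?case using Suc mono[of j] by (simp add: algebra_simps)
  qed
  show ?thesis
    using assms(2)
  proof (induction a)
    case 0
    then show ?case by simp
  next
    case (Suc a)
    show ?case
    proof (cases "g (Suc a) \<le> g a")
      case True
      then show ?thesis using Suc by simp
    next
      case False
      obtain j where j: "m = a + j" using Suc.prems le_Suc_ex[of a m] by auto
      then have "j \<ge> 1" using Suc.prems by simp
      then have "real j * (g (Suc a) - g a) \<ge> 1 * (g (Suc a) - g a)"
        using False by (intro mult_right_mono) auto
      then have "g m \<ge> g (Suc a)" using up[of a j] j by simp
      then show ?thesis by simp
    qed
  qed
qed

text \<open>Left multiplication by \<open>X\<close> and right multiplication by \<open>Y\<close> are commuting self-adjoint operators
  for the Frobenius inner product, so \<open>q \<mapsto> \<langle>H, X\<^sup>q H Y\<^sup>r\<^sup>-\<^sup>q\<rangle>\<close> is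
  dominated by its values at the end points. No spectral theorem is needed.\<close>

lemma frob_mixed_power_le:
  assumes X: "sym_mat X" and Y: "sym_mat Y" and q: "q \<le> 2 * m"
  shows "frob J H ((mat_mult_on J X ^^ q) (((\<lambda>A. mat_mult_on J A Y) ^^ (2 * m - q)) H))
    \<le> frob J ((mat_mult_on J X ^^ m) H) ((mat_mult_on J X ^^ m) H)
      + frob J (((\<lambda>A. mat_mult_on J A Y) ^^ m) H) (((\<lambda>A. mat_mult_on J A Y) ^^ m) H)"
proof -
  define L where "L = mat_mult_on J X"
  define R where "R = (\<lambda>A. mat_mult_on J A Y)"
  have comm: "(L ^^ p) ((R ^^ r) A) = (R ^^ r) ((L ^^ p) A)" for p r A
    by (rule funpow_commute_ops) (simp add: L_def R_def mat_mult_on_assoc)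
  have Lsa: "frob J ((L ^^ p) A) B = frob J A ((L ^^ p) B)" for p A B
    unfolding L_def by (rule frob_funpow) (rule frob_lmul[OF X])
  have Rsa: "frob J ((R ^^ p) A) B = frob J A ((R ^^ p) B)" for p A B
    unfolding R_def by (rule frob_funpow) (rule frob_rmul[OF Y])
  define v where "v a b = (L ^^ a) ((R ^^ b) H)" for a b
  \<comment> \<open>Only the total exponents survive, as in a Hankel matrix. Hence
    \<open>frob_le_mean\<close>, applied to two vectors with shifted exponents, becomes midpoint
    convexity of \<open>g\<close>.\<close>
  have vv: "frob J (v a b) (v c d) = frob J H (v (a + c) (b + d))" for a b c d
  proof -
    have "frob J (v a b) (v c d) = frob J H ((R ^^ b) ((L ^^ a) ((L ^^ c) ((R ^^ d) H))))"
      unfolding v_def by (simp add: Lsa Rsa)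
    also have "(R ^^ b) ((L ^^ a) ((L ^^ c) ((R ^^ d) H))) = v (a + c) (b + d)"
      unfolding v_def by (simp add: funpow_add comm)
    finally show ?thesis .
  qed
  define g where "g a = frob J (v a (m - a)) (v a (m - a))" for a
  have conv: "g a \<le> (g (a - 1) + g (a + 1)) / 2" if "0 < a" "a < m" for a
  proof -
    have "g a = frob J (v (a - 1) (m - (a - 1))) (v (a + 1) (m - (a + 1)))"
      using that by (simp add: g_def vv)
    then show ?thesis unfolding g_def using frob_le_mean by simp
  qed
  have g0: "0 \<le> g a" for a unfolding g_def by (rule frob_self_nonneg)
  have gle: "g a \<le> g 0 + g m" if "a \<le> m" for a
    using convex_seq_le_endpoints[of m g a] conv that g0[of 0] g0[of m] by (auto simp: max_def split: if_splits)
  have "frob J H (v q (2 * m - q)) \<le> g 0 + g m"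
  proof (cases "even q")
    case True
    then obtain a where a: "q = 2 * a" by blast
    have "frob J H (v q (2 * m - q)) = g a" using q unfolding g_def vv a
      by (intro arg_cong2[where f = "\<lambda>i j. frob J H (v i j)"]) auto
    then show ?thesis using gle[of a] q a by simp
  next
    \<comment> \<open>An odd \<open>q\<close> cannot be split evenly; its two halves are the
      neighbouring vectors \<open>a + 1\<close> and \<open>a\<close>, and the mean of their values
      is bounded in the same way.\<close>
    case False
    then obtain a where a: "q = 2 * a + 1" using oddE by blast
    have am: "a + 1 \<le> m" using q a by linarith
    have "frob J (v (a + 1) (m - (a + 1))) (v a (m - a)) = frob J H (v q (2 * m - q))"
      using am unfolding vv a by (intro arg_cong2[where f = "\<lambda>i j. frob J H (v i j)"]) auto
    moreover have "frob J (v (a + 1) (m - (a + 1))) (v a (m - a)) \<le> (g (a + 1) + g a) / 2"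
      unfolding g_def by (rule frob_le_mean)
    ultimately show ?thesis using gle[of a] gle[of "a + 1"] am by simp
  qed
  then show ?thesis unfolding g_def v_def L_def R_def by simp
qed

text \<open>Noncommutative telescoping: X^N - Y^N is the sum of X^q (X - Y) Y^(N-1-q), and here X -
  Y = 2 H.\<close>

lemma mpow_diff:
  assumes "finite J" "supported_on J Y" "supported_on J H"
    and XY: "X = (\<lambda>i j. Y i j + 2 * H i j)"
  shows "(\<lambda>i j. mpow J X N i j - mpow J Y N i j) =
    (\<lambda>i j. \<Sum>q<N. 2 * (mat_mult_on J X ^^ q) (((\<lambda>A. mat_mult_on J A Y) ^^ (N - 1 - q)) H) i j)"
proof (induction N)
  case 0
  show ?case by (simp add: mpow_def)
next
  case (Suc N)
  let ?L = "mat_mult_on J X" and ?R = "\<lambda>A. mat_mult_on J A Y"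
  have H2: "(\<lambda>i j. X i j - Y i j) = (\<lambda>i j. 2 * H i j)" unfolding XY by auto
  have 1: "mat_mult_on J X (mpow J Y N) i j - mat_mult_on J Y (mpow J Y N) i j
        = 2 * (?R ^^ N) H i j" for i j
    using fun_cong[OF fun_cong[OF mat_mult_on_diff_left[of J X Y "mpow J Y N"], of i], of j]
    unfolding H2 mat_mult_on_scale_left mat_mult_on_mpow[OF assms(1,2,3)] by simp
  have "mpow J X (Suc N) i j - mpow J Y (Suc N) i j
     = (\<Sum>q<Suc N. 2 * (?L ^^ q) ((?R ^^ (Suc N - 1 - q)) H) i j)" for i j
  proof -
    have "mpow J X (Suc N) i j - mpow J Y (Suc N) i j
      = mat_mult_on J X (\<lambda>i j. mpow J X N i j - mpow J Y N i j) i j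
        + (mat_mult_on J X (mpow J Y N) i j - mat_mult_on J Y (mpow J Y N) i j)"
      unfolding mat_mult_on_diff_right by (simp add: mpow_def)
    also have "\<dots> = (\<Sum>q<N. 2 * ?L ((?L ^^ q) ((?R ^^ (N - 1 - q)) H)) i j) + 2 * (?R ^^ N) H i j"
      unfolding Suc 1 mat_mult_on_sum_right[where s = "\<lambda>_. 2"] ..
    also have "\<dots> = (\<Sum>q<Suc N. 2 * (?L ^^ q) ((?R ^^ (Suc N - 1 - q)) H) i j)"
      by (subst sum.lessThan_Suc_shift) simp
    finally show ?thesis .
  qed
  then show ?case by blast
qed

text \<open>Signs are encoded by subsets because the randomness is a uniformly random edge set:
  inserting one edge flips exactly one sign.\<close>

definition sgn_in :: "'a set \<Rightarrow> 'a \<Rightarrow> real" where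
  "sgn_in S a = (if a \<in> S then 1 else -1)"

lemma sum_Pow_insert:
  fixes f :: "'a set \<Rightarrow> real"
  assumes "finite I" "a \<in> I"
  shows "(\<Sum>S\<in>Pow I. f S) = (\<Sum>S\<in>Pow (I - {a}). f (insert a S) + f S)"
proof -
  have I: "I = insert a (I - {a})" using assms by blast
  have "(\<Sum>S\<in>Pow I. f S) = (\<Sum>S\<in>Pow (I - {a}) \<union> insert a ` Pow (I - {a}). f S)"
    by (subst I) (simp only: Pow_insert)
  also have "\<dots> = (\<Sum>S\<in>Pow (I - {a}). f S) + (\<Sum>S\<in>insert a ` Pow (I - {a}). f S)"
    using assms by (intro sum.union_disjoint) auto
  also have "(\<Sum>S\<in>insert a ` Pow (I - {a}). f S) = (\<Sum>S\<in>Pow (I - {a}). f (insert a S))"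
    by (subst sum.reindex) (auto simp: inj_on_def)
  finally show ?thesis by (simp add: sum.distrib)
qed

lemma supported_on_sum:
  assumes "\<And>a. a \<in> I \<Longrightarrow> supported_on J (H a)"
  shows "supported_on J (\<lambda>i j. \<Sum>a\<in>I. s a * H a i j)"
proof -
  have "\<exists>a\<in>I. H a i j \<noteq> 0" if "(\<Sum>a\<in>I. s a * H a i j) \<noteq> 0" for i j
    using that sum.not_neutral_contains_not_neutral by fastforce
  then show ?thesis using assms unfolding supported_on_def by blast
qed

text \<open>A discrete form of Gaussian integration by parts. One factor of \<open>X S\<close> is
  expanded into the \<open>H a\<close>; averaging over the sign of \<open>a\<close> leaves the
  difference of X^(2m+1) at the two signs, which telescopes into 2m+1 mixed words. Each of these is
  dominated by two pure powers, and \<open>var\<close> sums the pure powers over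
  \<open>a\<close>.\<close>

lemma khintchine_step:
  fixes H :: "'i \<Rightarrow> 'a \<Rightarrow> 'a \<Rightarrow> real"
  assumes fin: "finite I" "finite J"
    and H: "\<And>a. a \<in> I \<Longrightarrow> supported_on J (H a)" "\<And>a. a \<in> I \<Longrightarrow> sym_mat (H a)"
    and var: "\<And>z. (\<Sum>a\<in>I. \<Sum>i\<in>J. (\<Sum>j\<in>J. H a i j * z j)\<^sup>2) \<le> v * (\<Sum>j\<in>J. (z j)\<^sup>2)"
  defines "X \<equiv> \<lambda>S i j. \<Sum>a\<in>I. sgn_in S a * H a i j"
  defines "T \<equiv> \<lambda>m. \<Sum>S\<in>Pow I. frob J (mpow J (X S) m) (mpow J (X S) m)"
  shows "T (Suc m) \<le> 2 * (2 * real m + 1) * v * T m"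
proof -
  have supX: "supported_on J (X S)" for S unfolding X_def by (rule supported_on_sum) (rule H)
  have symX: "sym_mat (X S)" for S
    using H(2) unfolding X_def sym_mat_def by (intro allI sum.cong) auto
  let ?L = "\<lambda>S. mat_mult_on J (X S)" and ?R = "\<lambda>S A. mat_mult_on J A (X S)"
  define n2 where "n2 A = frob J A A" for A
  \<comment> \<open>Collects all 2m+1 remaining factors of \<open>X S\<close> on one side, so that
    only \<open>H a\<close> stands on the other.\<close>
  have HX: "frob J (mat_mult_on J (H a) (mpow J (X S) m)) (mpow J (X S) (Suc m))
      = frob J (H a) (mpow J (X S) (2 * m + 1))" if "a \<in> I" for a S
  proof -
    have "frob J (mat_mult_on J (H a) (mpow J (X S) m)) (mpow J (X S) (Suc m))
      = frob J (H a) ((?R S ^^ m) (mpow J (X S) (Suc m)))"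
      unfolding mat_mult_on_mpow[OF fin(2) supX H(1)[OF that]]
      by (rule frob_funpow) (rule frob_rmul[OF symX])
    also have "(?R S ^^ m) (mpow J (X S) (Suc m)) = mpow J (X S) (2 * m + 1)"
      unfolding mpow_conv_right[OF fin(2) supX] by (simp add: mult_2 funpow_add funpow_swap1[of "?R S" m])
    finally show ?thesis .
  qed
  \<comment> \<open>Transposition exchanges left and right multiplication, since all matrices are
    symmetric. Both end points of \<open>frob_mixed_power_le\<close> therefore reduce to the same
    kind of norm.\<close>
  have Lm: "n2 ((?L S ^^ m) (H a)) = n2 (mat_mult_on J (H a) (mpow J (X S) m))" if "a \<in> I" for a S
  proof -
    have Hs: "(\<lambda>i j. H a j i) = H a" using H(2)[OF that] by (auto simp: sym_mat_def)
    have Xs: "(\<lambda>i j. X S j i) = X S" using symX[of S] by (auto simp: sym_mat_def)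
    have "(\<lambda>i j. (?L S ^^ p) (H a) j i) = (?R S ^^ p) (H a)" for p
    proof (induction p)
      case 0
      then show ?case by (simp add: Hs)
    next
      case (Suc p)
      have "(\<lambda>i j. (?L S ^^ Suc p) (H a) j i) = mat_mult_on J (\<lambda>i j. (?L S ^^ p) (H a) j i) (X S)"
        by (simp, subst mat_mult_on_transpose) (simp add: Xs)
      then show ?case unfolding Suc by simp
    qed
    then show ?thesis
      unfolding n2_def mat_mult_on_mpow[OF fin(2) supX H(1)[OF that]]
      by (metis frob_transpose)
  qed
  \<comment> \<open>\<open>X (insert a S)\<close> and \<open>X S\<close> differ by
    \<open>2 * H a\<close>. The factor 2 and the 2m+1 words of the telescoping sum give the
    constant.\<close>
  have diff: "frob J (H a) (mpow J (X (insert a S)) (2 * m + 1)) - frob J (H a) (mpow J (X S) (2 * m + 1))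
     \<le> 2 * (2 * real m + 1) * (n2 (mat_mult_on J (H a) (mpow J (X (insert a S)) m))
         + n2 (mat_mult_on J (H a) (mpow J (X S) m)))" if a: "a \<in> I" and S: "S \<in> Pow (I - {a})" for a S
  proof -
    have I: "I = insert a (I - {a})" using a by blast
    have "X (insert a S) i j = X S i j + 2 * H a i j" for i j
    proof -
      have "(\<Sum>b\<in>I - {a}. sgn_in (insert a S) b * H b i j) = (\<Sum>b\<in>I - {a}. sgn_in S b * H b i j)"
        by (intro sum.cong) (auto simp: sgn_in_def)
      then have "X (insert a S) i j - X S i j = sgn_in (insert a S) a * H a i j - sgn_in S a * H a i j"
        unfolding X_def by (simp add: sum.remove[OF fin(1) a])
      moreover have "a \<notin> S" using S by blast
      ultimately show ?thesis by (simp add: sgn_in_def)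
    qed
    then have XY: "X (insert a S) = (\<lambda>i j. X S i j + 2 * H a i j)" by blast
    have "frob J (H a) (mpow J (X (insert a S)) (2 * m + 1)) - frob J (H a) (mpow J (X S) (2 * m + 1))
      = (\<Sum>q<2 * m + 1. 2 * frob J (H a) ((?L (insert a S) ^^ q) ((?R S ^^ (2 * m - q)) (H a))))"
    proof -
      have "frob J (H a) (mpow J (X (insert a S)) (2 * m + 1)) - frob J (H a) (mpow J (X S) (2 * m + 1))
        = frob J (H a) (\<lambda>i j. mpow J (X (insert a S)) (2 * m + 1) i j - mpow J (X S) (2 * m + 1) i j)"
        by (rule frob_diff_right[symmetric])
      also have "\<dots> = (\<Sum>q<2 * m + 1. 2 * frob J (H a) ((?L (insert a S) ^^ q) ((?R S ^^ (2 * m + 1 - 1 - q)) (H a))))"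
        unfolding mpow_diff[OF fin(2) supX H(1)[OF a] XY] by (rule frob_sum_right)
      finally show ?thesis by (simp only: add_diff_cancel_right')
    qed
    also have "\<dots> \<le> (\<Sum>q<2 * m + 1. 2 * (n2 ((?L (insert a S) ^^ m) (H a)) + n2 ((?R S ^^ m) (H a))))"
      unfolding n2_def by (intro sum_mono mult_left_mono frob_mixed_power_le symX) auto
    finally show ?thesis
      by (simp add: Lm[OF a] mat_mult_on_mpow[OF fin(2) supX H(1)[OF a]] algebra_simps)
  qed
  have "T (Suc m) = (\<Sum>S\<in>Pow I. \<Sum>a\<in>I. sgn_in S a * frob J (H a) (mpow J (X S) (2 * m + 1)))"
    unfolding T_def
  proof (intro sum.cong refl)
    fix S
    have "mpow J (X S) (Suc m) = (\<lambda>i j. \<Sum>a\<in>I. sgn_in S a * mat_mult_on J (H a) (mpow J (X S) m) i j)"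
      unfolding mat_mult_on_sum_left[symmetric] by (simp add: mpow_def X_def)
    then have "frob J (mpow J (X S) (Suc m)) (mpow J (X S) (Suc m)) =
       (\<Sum>a\<in>I. sgn_in S a * frob J (mat_mult_on J (H a) (mpow J (X S) m)) (mpow J (X S) (Suc m)))"
      by (subst (1) \<open>mpow J (X S) (Suc m) = _\<close>) (rule frob_sum_left)
    then show "frob J (mpow J (X S) (Suc m)) (mpow J (X S) (Suc m))
       = (\<Sum>a\<in>I. sgn_in S a * frob J (H a) (mpow J (X S) (2 * m + 1)))"
      using HX by simp
  qed
  also have "\<dots> = (\<Sum>a\<in>I. \<Sum>S\<in>Pow I. sgn_in S a * frob J (H a) (mpow J (X S) (2 * m + 1)))"
    by (rule sum.swap)
  also have "\<dots> \<le> (\<Sum>a\<in>I. 2 * (2 * real m + 1) * (\<Sum>S\<in>Pow I. n2 (mat_mult_on J (H a) (mpow J (X S) m))))"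
  proof (intro sum_mono)
    fix a assume a: "a \<in> I"
    have "(\<Sum>S\<in>Pow I. sgn_in S a * frob J (H a) (mpow J (X S) (2 * m + 1)))
      = (\<Sum>S\<in>Pow (I - {a}). frob J (H a) (mpow J (X (insert a S)) (2 * m + 1))
           - frob J (H a) (mpow J (X S) (2 * m + 1)))"
      unfolding sum_Pow_insert[OF fin(1) a] by (intro sum.cong) (auto simp: sgn_in_def)
    also have "\<dots> \<le> (\<Sum>S\<in>Pow (I - {a}). 2 * (2 * real m + 1) *
         (n2 (mat_mult_on J (H a) (mpow J (X (insert a S)) m)) + n2 (mat_mult_on J (H a) (mpow J (X S) m))))"
      by (intro sum_mono diff a)
    also have "\<dots> = 2 * (2 * real m + 1) * (\<Sum>S\<in>Pow I. n2 (mat_mult_on J (H a) (mpow J (X S) m)))"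
      unfolding sum_Pow_insert[OF fin(1) a] by (simp add: sum_distrib_left)
    finally show "(\<Sum>S\<in>Pow I. sgn_in S a * frob J (H a) (mpow J (X S) (2 * m + 1)))
       \<le> 2 * (2 * real m + 1) * (\<Sum>S\<in>Pow I. n2 (mat_mult_on J (H a) (mpow J (X S) m)))" .
  qed
  also have "\<dots> = 2 * (2 * real m + 1) * (\<Sum>S\<in>Pow I. \<Sum>a\<in>I. n2 (mat_mult_on J (H a) (mpow J (X S) m)))"
    by (subst sum.swap) (simp add: sum_distrib_left)
  also have "\<dots> \<le> 2 * (2 * real m + 1) * (\<Sum>S\<in>Pow I. v * n2 (mpow J (X S) m))"
  proof (intro mult_left_mono sum_mono)
    fix S
    let ?P = "mpow J (X S) m"
    \<comment> \<open>The columns of \<open>?P\<close> serve as the test vectors \<open>z\<close> of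
      \<open>var\<close>.\<close>
    have "(\<Sum>a\<in>I. n2 (mat_mult_on J (H a) ?P)) = (\<Sum>a\<in>I. \<Sum>k\<in>J. \<Sum>i\<in>J. (\<Sum>j\<in>J. H a i j * ?P j k)\<^sup>2)"
      unfolding n2_def frob_def mat_mult_on_def power2_eq_square by (intro sum.cong refl sum.swap)
    also have "\<dots> = (\<Sum>k\<in>J. \<Sum>a\<in>I. \<Sum>i\<in>J. (\<Sum>j\<in>J. H a i j * ?P j k)\<^sup>2)" by (rule sum.swap)
    also have "\<dots> \<le> (\<Sum>k\<in>J. v * (\<Sum>j\<in>J. (?P j k)\<^sup>2))" by (intro sum_mono var)
    also have "\<dots> = v * n2 ?P"
      unfolding n2_def frob_def power2_eq_square by (subst sum.swap) (simp add: sum_distrib_left)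
    finally show "(\<Sum>a\<in>I. n2 (mat_mult_on J (H a) ?P)) \<le> v * n2 ?P" .
  qed auto
  also have "\<dots> = 2 * (2 * real m + 1) * v * T m"
    unfolding T_def n2_def by (simp add: sum_distrib_left mult_ac)
  finally show ?thesis .
qed

section \<open>The operator norm as a supremum of a bilinear form\<close>

definition bform :: "'a set \<Rightarrow> 'b set \<Rightarrow> ('a \<Rightarrow> 'b \<Rightarrow> real) \<Rightarrow> ('a \<Rightarrow> real) \<Rightarrow> ('b \<Rightarrow> real) \<Rightarrow> real" where
  "bform R C M x y = (\<Sum>r\<in>R. \<Sum>c\<in>C. x r * M r c * y c)"

text \<open>The supremum runs over unit balls instead of spheres, so that the zero vectors are
  admissible: the set is nonempty even for empty \<open>R\<close> or \<open>C\<close>, and the norm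
  is nonnegative.\<close>

definition opn :: "'a set \<Rightarrow> 'b set \<Rightarrow> ('a \<Rightarrow> 'b \<Rightarrow> real) \<Rightarrow> real" where
  "opn R C M = (SUP p\<in>{(x, y). L2_set x R \<le> 1 \<and> L2_set y C \<le> 1}. bform R C M (fst p) (snd p))"

lemma L2_set_scale: "0 \<le> s \<Longrightarrow> L2_set (\<lambda>i. s * x i) A = s * L2_set x A"
  by (simp add: L2_set_right_distrib)

lemma L2_set_power2: "(L2_set x A)\<^sup>2 = (\<Sum>i\<in>A. (x i)\<^sup>2)"
  unfolding L2_set_def by (simp add: sum_nonneg)

lemma sum_mult_le_L2_set: "(\<Sum>i\<in>A. x i * y i) \<le> L2_set x A * L2_set y A"
proof -
  have "(\<Sum>i\<in>A. x i * y i) \<le> (\<Sum>i\<in>A. \<bar>x i\<bar> * \<bar>y i\<bar>)"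
    by (intro sum_mono) (simp add: abs_mult[symmetric])
  also have "\<dots> \<le> L2_set x A * L2_set y A" by (rule L2_set_mult_ineq)
  finally show ?thesis .
qed

lemma bform_le_abs:
  assumes "finite R" "finite C" "L2_set x R \<le> 1" "L2_set y C \<le> 1"
  shows "bform R C M x y \<le> (\<Sum>r\<in>R. \<Sum>c\<in>C. \<bar>M r c\<bar>)"
  unfolding bform_def
proof (intro sum_mono)
  fix r c assume rc: "r \<in> R" "c \<in> C"
  have x: "\<bar>x r\<bar> \<le> 1"
    using member_le_L2_set[OF assms(1) rc(1), of "\<lambda>i. \<bar>x i\<bar>"] assms(3)
    unfolding L2_set_def power2_abs by linarith
  have y: "\<bar>y c\<bar> \<le> 1"
    using member_le_L2_set[OF assms(2) rc(2), of "\<lambda>i. \<bar>y i\<bar>"] assms(4)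
    unfolding L2_set_def power2_abs by linarith
  have "x r * M r c * y c \<le> \<bar>x r * M r c * y c\<bar>" by simp
  also have "\<dots> = \<bar>x r\<bar> * \<bar>y c\<bar> * \<bar>M r c\<bar>" by (simp add: abs_mult)
  also have "\<dots> \<le> 1 * 1 * \<bar>M r c\<bar>" using x y by (intro mult_mono) auto
  finally show "x r * M r c * y c \<le> \<bar>M r c\<bar>" by simp
qed

lemma bform_scale: "bform R C M (\<lambda>i. s * x i) (\<lambda>j. t * y j) = s * t * bform R C M x y"
  unfolding bform_def sum_distrib_left by (intro sum.cong refl) (simp add: mult_ac)

lemma bdd_above_bform:
  assumes "finite R" "finite C"
  shows "bdd_above ((\<lambda>p. bform R C M (fst p) (snd p)) ` {(x, y). L2_set x R \<le> 1 \<and> L2_set y C \<le> 1})"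
  using bform_le_abs[OF assms] by (intro bdd_aboveI2[where M = "\<Sum>r\<in>R. \<Sum>c\<in>C. \<bar>M r c\<bar>"]) auto

lemma bform_le_opn1:
  assumes "finite R" "finite C" "L2_set x R \<le> 1" "L2_set y C \<le> 1"
  shows "bform R C M x y \<le> opn R C M"
  unfolding opn_def
  using cSUP_upper[OF _ bdd_above_bform[OF assms(1,2)], of "(x, y)"] assms by simp

lemma opn_nonneg:
  assumes "finite R" "finite C"
  shows "0 \<le> opn R C M"
  using bform_le_opn1[OF assms, of "\<lambda>_. 0" "\<lambda>_. 0" M] by (simp add: bform_def L2_set_def)

lemma L2_set_zeroD: "finite A \<Longrightarrow> L2_set x A = 0 \<Longrightarrow> i \<in> A \<Longrightarrow> x i = 0"
  by (simp add: L2_set_eq_0_iff)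

lemma bform_le_opn:
  assumes "finite R" "finite C"
  shows "bform R C M x y \<le> opn R C M * L2_set x R * L2_set y C"
proof (cases "L2_set x R = 0 \<or> L2_set y C = 0")
  case True
  then have "bform R C M x y = 0"
    unfolding bform_def using L2_set_zeroD[OF assms(1), of x] L2_set_zeroD[OF assms(2), of y]
    by (intro sum.neutral ballI) auto
  then show ?thesis using True by auto
next
  case False
  let ?s = "inverse (L2_set x R)" and ?t = "inverse (L2_set y C)"
  have "?s * ?t * bform R C M x y \<le> opn R C M"
    unfolding bform_scale[symmetric] using False
    by (intro bform_le_opn1 assms) (simp_all add: L2_set_scale)
  moreover have "0 < L2_set x R" "0 < L2_set y C" using False by (simp_all add: less_le)
  ultimately show ?thesis by (simp add: field_simps)
qed

lemma opn_le:
  assumes "\<And>x y. bform R C M x y \<le> B * L2_set x R * L2_set y C" "0 \<le> B"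
  shows "opn R C M \<le> B"
  unfolding opn_def
proof (rule cSUP_least)
  have "((\<lambda>_. 0), (\<lambda>_. 0)) \<in> {(x, y). L2_set x R \<le> 1 \<and> L2_set y C \<le> 1}" by (simp add: L2_set_def)
  then show "{(x, y). L2_set x R \<le> 1 \<and> L2_set y C \<le> 1} \<noteq> {}" by blast
  fix p assume "p \<in> {(x, y). L2_set x R \<le> 1 \<and> L2_set y C \<le> 1}"
  then have p: "L2_set (fst p) R \<le> 1" "L2_set (snd p) C \<le> 1" by auto
  have "bform R C M (fst p) (snd p) \<le> B * (L2_set (fst p) R * L2_set (snd p) C)"
    using assms(1)[of "fst p" "snd p"] by (simp add: mult_ac)
  also have "\<dots> \<le> B * (1 * 1)"
    using p assms(2) by (intro mult_left_mono mult_mono) auto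
  finally show "bform R C M (fst p) (snd p) \<le> B" by simp
qed

definition mat_vec :: "'a set \<Rightarrow> ('a \<Rightarrow> 'a \<Rightarrow> real) \<Rightarrow> ('a \<Rightarrow> real) \<Rightarrow> 'a \<Rightarrow> real" where
  "mat_vec J X z i = (\<Sum>j\<in>J. X i j * z j)"

text \<open>For symmetric X, |X^m z|^2 = <z, X^(2m) z> is at most |z| |X^(2m) z|. Repeated doubling
  of m starting from 1 bounds a power of |X z| by |X^(2^k) z|, and the Frobenius norm bounds the
  latter. The doubling is the reason why all moment orders below have the form
  \<open>2 * 2 ^ k\<close>.\<close>

lemma mat_vec_power_le:
  assumes J: "finite J" and X: "sym_mat X"
  shows "L2_set (mat_vec J X z) J ^ (2 * 2 ^ k) \<le> frob J (mpow J X (2 ^ k)) (mpow J X (2 ^ k)) * L2_set z J ^ (2 * 2 ^ k)"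
proof -
  define u where "u m = (mat_vec J X ^^ m) z" for m
  have sa: "(\<Sum>i\<in>J. mat_vec J X v i * w i) = (\<Sum>i\<in>J. v i * mat_vec J X w i)" for v w
  proof -
    have "(\<Sum>i\<in>J. mat_vec J X v i * w i) = (\<Sum>i\<in>J. \<Sum>j\<in>J. X i j * v j * w i)"
      unfolding mat_vec_def sum_distrib_right ..
    also have "\<dots> = (\<Sum>j\<in>J. \<Sum>i\<in>J. X i j * v j * w i)" by (rule sum.swap)
    also have "\<dots> = (\<Sum>j\<in>J. \<Sum>i\<in>J. v j * (X j i * w i))"
      using X unfolding sym_mat_def by (simp add: mult_ac)
    finally show ?thesis unfolding mat_vec_def sum_distrib_left .
  qed
  have sap: "(\<Sum>i\<in>J. (mat_vec J X ^^ m) v i * w i) = (\<Sum>i\<in>J. v i * (mat_vec J X ^^ m) w i)" for v w m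
    by (induction m arbitrary: v w) (simp_all add: sa funpow_swap1)
  have dbl: "(L2_set (u m) J)\<^sup>2 \<le> L2_set z J * L2_set (u (2 * m)) J" for m
  proof -
    have "(L2_set (u m) J)\<^sup>2 = (\<Sum>i\<in>J. z i * u (2 * m) i)"
      unfolding L2_set_power2 unfolding u_def power2_eq_square sap by (simp add: mult_2 funpow_add)
    also have "\<dots> \<le> L2_set z J * L2_set (u (2 * m)) J" by (rule sum_mult_le_L2_set)
    finally show ?thesis .
  qed
  have pow: "L2_set (u 1) J ^ (2 ^ k) \<le> L2_set z J ^ (2 ^ k - 1) * L2_set (u (2 ^ k)) J" for k
  proof (induction k)
    case 0
    show ?case by simp
  next
    case (Suc k)
    have "L2_set (u 1) J ^ (2 ^ Suc k) = (L2_set (u 1) J ^ (2 ^ k))\<^sup>2"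
      by (simp add: power_mult[symmetric] mult.commute)
    also have "\<dots> \<le> (L2_set z J ^ (2 ^ k - 1) * L2_set (u (2 ^ k)) J)\<^sup>2"
      using Suc by (intro power_mono) auto
    also have "\<dots> = L2_set z J ^ (2 * (2 ^ k - 1)) * (L2_set (u (2 ^ k)) J)\<^sup>2"
      by (simp add: power_mult_distrib power_mult[symmetric] mult.commute)
    also have "\<dots> \<le> L2_set z J ^ (2 * (2 ^ k - 1)) * (L2_set z J * L2_set (u (2 * 2 ^ k)) J)"
      by (intro mult_left_mono dbl) auto
    also have "\<dots> = L2_set z J ^ (2 * (2 ^ k - 1) + 1) * L2_set (u (2 ^ Suc k)) J"
      by (simp add: mult_ac)
    also have "2 * (2 ^ k - 1) + 1 = (2 ^ Suc k - 1 :: nat)"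
      using one_le_power[of "2 :: nat" k] unfolding power_Suc by arith
    finally show ?case .
  qed
  have um: "u m i = (\<Sum>j\<in>J. mpow J X m i j * z j)" if "i \<in> J" for m i
    using that
  proof (induction m arbitrary: i)
    case 0
    have "(\<Sum>j\<in>J. mpow J X 0 i j * z j) = (\<Sum>j\<in>J. if j = i then z j else 0)"
      using 0 by (intro sum.cong) (auto simp: mpow_def id_on_def)
    then show ?case using 0 J by (simp add: u_def)
  next
    case (Suc m)
    have "u (Suc m) i = (\<Sum>l\<in>J. X i l * u m l)" by (simp add: u_def mat_vec_def)
    also have "\<dots> = (\<Sum>l\<in>J. \<Sum>j\<in>J. X i l * mpow J X m l j * z j)"
      by (intro sum.cong refl) (simp add: Suc.IH sum_distrib_left mult_ac)
    also have "\<dots> = (\<Sum>j\<in>J. \<Sum>l\<in>J. X i l * mpow J X m l j * z j)" by (rule sum.swap)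
    also have "\<dots> = (\<Sum>j\<in>J. mpow J X (Suc m) i j * z j)"
      by (simp add: mpow_def mat_mult_on_def sum_distrib_right)
    finally show ?case .
  qed
  have fr: "(L2_set (u m) J)\<^sup>2 \<le> frob J (mpow J X m) (mpow J X m) * (L2_set z J)\<^sup>2" for m
  proof -
    have "(L2_set (u m) J)\<^sup>2 = (\<Sum>i\<in>J. (\<Sum>j\<in>J. mpow J X m i j * z j)\<^sup>2)"
      unfolding L2_set_power2 by (intro sum.cong refl) (simp add: um)
    also have "\<dots> \<le> (\<Sum>i\<in>J. (\<Sum>j\<in>J. (mpow J X m i j)\<^sup>2) * (\<Sum>j\<in>J. (z j)\<^sup>2))"
      by (intro sum_mono Cauchy_Schwarz_ineq_sum)
    also have "\<dots> = frob J (mpow J X m) (mpow J X m) * (L2_set z J)\<^sup>2"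
      unfolding L2_set_power2 unfolding frob_def power2_eq_square sum_distrib_right ..
    finally show ?thesis .
  qed
  have k: "2 * (2 ^ k - 1) + 2 = (2 * 2 ^ k :: nat)"
    using one_le_power[of "2 :: nat" k] by arith
  have "L2_set (u 1) J ^ (2 * 2 ^ k) = (L2_set (u 1) J ^ (2 ^ k))\<^sup>2"
    by (simp add: power_mult[symmetric] mult.commute)
  also have "\<dots> \<le> (L2_set z J ^ (2 ^ k - 1) * L2_set (u (2 ^ k)) J)\<^sup>2"
    using pow by (intro power_mono) auto
  also have "\<dots> = L2_set z J ^ (2 * (2 ^ k - 1)) * (L2_set (u (2 ^ k)) J)\<^sup>2"
    by (simp add: power_mult_distrib power_mult[symmetric] mult.commute)
  also have "\<dots> \<le> L2_set z J ^ (2 * (2 ^ k - 1)) *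
      (frob J (mpow J X (2 ^ k)) (mpow J X (2 ^ k)) * (L2_set z J)\<^sup>2)"
    by (intro mult_left_mono fr) auto
  also have "\<dots> = frob J (mpow J X (2 ^ k)) (mpow J X (2 ^ k)) * L2_set z J ^ (2 * (2 ^ k - 1) + 2)"
    by (simp only: power_add mult_ac)
  finally show ?thesis unfolding k by (simp add: u_def)
qed

text \<open>The Hermitian dilation: \<open>M\<close> and its transpose as off-diagonal blocks. It
  makes a rectangular matrix symmetric. The membership test keeps the result supported on
  \<open>R <+> C\<close>.\<close>

definition dil :: "'a set \<Rightarrow> 'b set \<Rightarrow> ('a \<Rightarrow> 'b \<Rightarrow> real) \<Rightarrow> 'a + 'b \<Rightarrow> 'a + 'b \<Rightarrow> real" where
  "dil R C M p q = (case p of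
      Inl r \<Rightarrow> (case q of Inl _ \<Rightarrow> 0 | Inr c \<Rightarrow> if r \<in> R \<and> c \<in> C then M r c else 0)
    | Inr c \<Rightarrow> (case q of Inr _ \<Rightarrow> 0 | Inl r \<Rightarrow> if r \<in> R \<and> c \<in> C then M r c else 0))"

lemma sym_mat_dil: "sym_mat (dil R C M)"
  unfolding sym_mat_def dil_def by (auto split: sum.splits)

lemma supported_on_dil: "supported_on (R <+> C) (dil R C M)"
  unfolding supported_on_def dil_def by (auto split: sum.splits if_splits)

lemma dil_sum:
  "dil R C (\<lambda>r c. \<Sum>a\<in>I. s a * X a r c) = (\<lambda>p q. \<Sum>a\<in>I. s a * dil R C (X a) p q)"
  unfolding dil_def by (intro ext) (auto split: sum.splits)

text \<open>A vector \<open>y\<close> padded by zeros on the row side is sent by the dilation to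
  \<open>M y\<close>, so the estimate for symmetric matrices applies. The root \<open>B\<close>
  turns it into a bound that is linear in \<open>x\<close> and \<open>y\<close>.\<close>

lemma opn_power_le_dil:
  assumes "finite R" "finite C"
  shows "opn R C M ^ (2 * 2 ^ k) \<le> frob (R <+> C) (mpow (R <+> C) (dil R C M) (2 ^ k)) (mpow (R <+> C) (dil R C M) (2 ^ k))"
proof -
  let ?J = "R <+> C" and ?p = "2 * 2 ^ k :: nat"
  define F where "F = frob ?J (mpow ?J (dil R C M) (2 ^ k)) (mpow ?J (dil R C M) (2 ^ k))"
  have J: "finite ?J" using assms by simp
  have F0: "0 \<le> F" unfolding F_def by (rule frob_self_nonneg)
  have p0: "?p > 0" by simp
  define B where "B = root ?p F"
  have B0: "0 \<le> B" unfolding B_def using F0 by simp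
  have BF: "B ^ ?p = F" unfolding B_def using F0 p0 by (intro real_root_pow_pos2)
  have "opn R C M \<le> B"
  proof (rule opn_le[OF _ B0])
    fix x :: "'a \<Rightarrow> real" and y :: "'b \<Rightarrow> real"
    let ?z = "case_sum (\<lambda>_. 0) y :: 'a + 'b \<Rightarrow> real"
    have z: "L2_set ?z ?J = L2_set y C"
      unfolding L2_set_def using assms by (simp add: sum.Plus)
    have mv: "mat_vec ?J (dil R C M) ?z (Inl r) = (\<Sum>c\<in>C. M r c * y c)" if "r \<in> R" for r
      unfolding mat_vec_def using assms that by (simp add: sum.Plus dil_def)
    have "L2_set (mat_vec ?J (dil R C M) ?z) ?J ^ ?p \<le> (B * L2_set y C) ^ ?p"
      using mat_vec_power_le[OF J sym_mat_dil, of R C M ?z k] unfolding z F_def[symmetric]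
      by (simp add: power_mult_distrib BF)
    then have mvle: "L2_set (mat_vec ?J (dil R C M) ?z) ?J \<le> B * L2_set y C"
      using B0 by (subst (asm) power_mono_iff[OF _ _ p0]) auto
    have "bform R C M x y = (\<Sum>r\<in>R. x r * mat_vec ?J (dil R C M) ?z (Inl r))"
      unfolding bform_def by (intro sum.cong refl) (simp add: mv sum_distrib_left mult.assoc)
    also have "\<dots> \<le> L2_set x R * L2_set (\<lambda>r. mat_vec ?J (dil R C M) ?z (Inl r)) R"
      by (rule sum_mult_le_L2_set)
    also have "\<dots> \<le> L2_set x R * L2_set (mat_vec ?J (dil R C M) ?z) ?J"
      unfolding L2_set_def using assms
      by (intro mult_left_mono real_sqrt_le_mono) (auto simp: sum.Plus sum_nonneg)
    also have "\<dots> \<le> L2_set x R * (B * L2_set y C)"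
      by (intro mult_left_mono mvle) auto
    finally show "bform R C M x y \<le> B * L2_set x R * L2_set y C" by (simp add: mult_ac)
  qed
  then have "opn R C M ^ ?p \<le> B ^ ?p" using opn_nonneg[OF assms] by (intro power_mono)
  then show ?thesis unfolding BF F_def .
qed

text \<open>Duality with \<open>w\<close> as its own test vector: the hypothesis reads Q \<le> s
  sqrt Q z, and one factor sqrt Q cancels.\<close>

lemma sum_squares_le_of_dual:
  fixes w :: "'i \<Rightarrow> 'r \<Rightarrow> real"
  assumes "(\<Sum>a\<in>I. \<Sum>r\<in>R. w a r * w a r) \<le> s * sqrt (\<Sum>a\<in>I. \<Sum>r\<in>R. (w a r)\<^sup>2) * z" "0 \<le> s" "0 \<le> z"
  shows "(\<Sum>a\<in>I. \<Sum>r\<in>R. (w a r)\<^sup>2) \<le> s\<^sup>2 * z\<^sup>2"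
proof -
  define Q where "Q = (\<Sum>a\<in>I. \<Sum>r\<in>R. (w a r)\<^sup>2)"
  have Q0: "0 \<le> Q" unfolding Q_def by (intro sum_nonneg) simp
  have "sqrt Q * sqrt Q \<le> (s * z) * sqrt Q"
    using assms(1) Q0 unfolding Q_def by (simp add: power2_eq_square mult_ac)
  then have "sqrt Q \<le> s * z" using assms(2,3) Q0
    by (cases "Q = 0") (auto intro: mult_right_le_imp_le[of _ "sqrt Q"])
  then have "(sqrt Q)\<^sup>2 \<le> (s * z)\<^sup>2" using Q0 by (intro power_mono) auto
  then show ?thesis using Q0 unfolding Q_def by (simp add: power_mult_distrib)
qed

text \<open>Stacking the matrices \<open>X a\<close> vertically or horizontally gives one tall and
  one wide matrix, and \<open>row\<close> and \<open>col\<close> bound their norms by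
  \<open>s\<close>. Applied to the two halves of a vector, they give the variance bound for the
  dilation. The recursion starts from the identity, whose trace is the dimension factor; up to the
  moment \<open>2 ^ k\<close> each step costs at most \<open>4 * 2 ^ k * s\<^sup>2\<close>.\<close>

lemma rect_khintchine:
  fixes X :: "'i \<Rightarrow> 'r \<Rightarrow> 'c \<Rightarrow> real"
  assumes fin: "finite I" "finite R" "finite C" and s0: "0 \<le> s"
    and row: "\<And>w z. (\<Sum>a\<in>I. \<Sum>r\<in>R. \<Sum>c\<in>C. w a r * X a r c * z c)
        \<le> s * sqrt (\<Sum>a\<in>I. \<Sum>r\<in>R. (w a r)\<^sup>2) * L2_set z C"
    and col: "\<And>w z. (\<Sum>a\<in>I. \<Sum>r\<in>R. \<Sum>c\<in>C. z r * X a r c * w a c)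
        \<le> s * sqrt (\<Sum>a\<in>I. \<Sum>c\<in>C. (w a c)\<^sup>2) * L2_set z R"
  shows "(\<Sum>S\<in>Pow I. opn R C (\<lambda>r c. \<Sum>a\<in>I. sgn_in S a * X a r c) ^ (2 * 2 ^ k))
    \<le> 2 ^ card I * real (card R + card C) * (4 * 2 ^ k * s\<^sup>2) ^ (2 ^ k)"
proof -
  let ?J = "R <+> C"
  let ?X = "\<lambda>S p q. \<Sum>a\<in>I. sgn_in S a * dil R C (X a) p q"
  have J: "finite ?J" using fin by simp
  have var: "(\<Sum>a\<in>I. \<Sum>i\<in>?J. (\<Sum>j\<in>?J. dil R C (X a) i j * z j)\<^sup>2) \<le> s\<^sup>2 * (\<Sum>j\<in>?J. (z j)\<^sup>2)" for z
  proof -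
    define w1 where "w1 a r = (\<Sum>c\<in>C. X a r c * z (Inr c))" for a r
    define w2 where "w2 a c = (\<Sum>r\<in>R. X a r c * z (Inl r))" for a c
    have "(\<Sum>a\<in>I. \<Sum>r\<in>R. (w1 a r)\<^sup>2) \<le> s\<^sup>2 * (L2_set (\<lambda>c. z (Inr c)) C)\<^sup>2"
    proof (rule sum_squares_le_of_dual[OF _ s0])
      have "(\<Sum>a\<in>I. \<Sum>r\<in>R. w1 a r * w1 a r) = (\<Sum>a\<in>I. \<Sum>r\<in>R. \<Sum>c\<in>C. w1 a r * X a r c * z (Inr c))"
        by (intro sum.cong refl) (subst (2) w1_def, simp add: sum_distrib_left mult.assoc)
      also have "\<dots> \<le> s * sqrt (\<Sum>a\<in>I. \<Sum>r\<in>R. (w1 a r)\<^sup>2) * L2_set (\<lambda>c. z (Inr c)) C" by (rule row)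
      finally show "(\<Sum>a\<in>I. \<Sum>r\<in>R. w1 a r * w1 a r)
         \<le> s * sqrt (\<Sum>a\<in>I. \<Sum>r\<in>R. (w1 a r)\<^sup>2) * L2_set (\<lambda>c. z (Inr c)) C" .
    qed simp
    moreover have "(\<Sum>a\<in>I. \<Sum>c\<in>C. (w2 a c)\<^sup>2) \<le> s\<^sup>2 * (L2_set (\<lambda>r. z (Inl r)) R)\<^sup>2"
    proof (rule sum_squares_le_of_dual[OF _ s0])
      have "(\<Sum>a\<in>I. \<Sum>c\<in>C. w2 a c * w2 a c) = (\<Sum>a\<in>I. \<Sum>c\<in>C. \<Sum>r\<in>R. z (Inl r) * X a r c * w2 a c)"
        by (intro sum.cong refl) (subst (1) w2_def, simp add: sum_distrib_left sum_distrib_right mult_ac)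
      also have "\<dots> = (\<Sum>a\<in>I. \<Sum>r\<in>R. \<Sum>c\<in>C. z (Inl r) * X a r c * w2 a c)"
        by (intro sum.cong refl sum.swap)
      also have "\<dots> \<le> s * sqrt (\<Sum>a\<in>I. \<Sum>c\<in>C. (w2 a c)\<^sup>2) * L2_set (\<lambda>r. z (Inl r)) R" by (rule col)
      finally show "(\<Sum>a\<in>I. \<Sum>c\<in>C. w2 a c * w2 a c)
         \<le> s * sqrt (\<Sum>a\<in>I. \<Sum>c\<in>C. (w2 a c)\<^sup>2) * L2_set (\<lambda>r. z (Inl r)) R" .
    qed simp
    moreover have "(\<Sum>a\<in>I. \<Sum>i\<in>?J. (\<Sum>j\<in>?J. dil R C (X a) i j * z j)\<^sup>2)
      = (\<Sum>a\<in>I. \<Sum>r\<in>R. (w1 a r)\<^sup>2) + (\<Sum>a\<in>I. \<Sum>c\<in>C. (w2 a c)\<^sup>2)"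
      unfolding sum.distrib[symmetric] sum.Plus[OF fin(2,3)] w1_def w2_def
      by (intro sum.cong arg_cong2[where f = "(+)"] refl) (simp_all add: dil_def)
    ultimately show ?thesis
      unfolding sum.Plus[OF fin(2,3)] L2_set_power2 by (simp add: algebra_simps)
  qed
  define T where "T m = (\<Sum>S\<in>Pow I. frob ?J (mpow ?J (?X S) m) (mpow ?J (?X S) m))" for m
  have T0: "0 \<le> T m" for m unfolding T_def by (intro sum_nonneg frob_self_nonneg)
  have step: "T (Suc m) \<le> 2 * (2 * real m + 1) * s\<^sup>2 * T m" for m
    unfolding T_def by (rule khintchine_step[OF fin(1) J supported_on_dil sym_mat_dil var])
  have "T m \<le> (4 * 2 ^ k * s\<^sup>2) ^ m * T 0" if "m \<le> 2 ^ k" for m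
    using that
  proof (induction m)
    case 0
    show ?case by simp
  next
    case (Suc m)
    have "real (Suc m) \<le> real (2 ^ k)" using Suc.prems by (rule of_nat_mono)
    then have m: "2 * (2 * real m + 1) \<le> 4 * 2 ^ k" by simp
    have "T (Suc m) \<le> 2 * (2 * real m + 1) * s\<^sup>2 * T m" by (rule step)
    also have "\<dots> \<le> 4 * 2 ^ k * s\<^sup>2 * T m"
      using m T0[of m] by (intro mult_right_mono) auto
    also have "\<dots> \<le> 4 * 2 ^ k * s\<^sup>2 * ((4 * 2 ^ k * s\<^sup>2) ^ m * T 0)"
      using Suc by (intro mult_left_mono) auto
    finally show ?case by (simp add: mult_ac)
  qed
  from this[of "2 ^ k"] have Tk: "T (2 ^ k) \<le> (4 * 2 ^ k * s\<^sup>2) ^ (2 ^ k) * T 0" by simp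
  have "frob ?J (id_on ?J) (id_on ?J) = real (card ?J)"
  proof -
    have "frob ?J (id_on ?J) (id_on ?J) = (\<Sum>i\<in>?J. \<Sum>j\<in>?J. if j = i then 1 else 0)"
      unfolding frob_def id_on_def by (intro sum.cong refl) auto
    then show ?thesis using J by simp
  qed
  then have "T 0 = 2 ^ card I * real (card R + card C)"
    unfolding T_def mpow_def using fin by (simp add: card_Pow card_Plus)
  moreover have "(\<Sum>S\<in>Pow I. opn R C (\<lambda>r c. \<Sum>a\<in>I. sgn_in S a * X a r c) ^ (2 * 2 ^ k)) \<le> T (2 ^ k)"
    unfolding T_def dil_sum[symmetric] by (intro sum_mono opn_power_le_dil fin)
  ultimately show ?thesis using Tk by (simp add: mult_ac)
qed

section \<open>Graph matrices\<close>

definition edge_prod :: "nat set set \<Rightarrow> ('v \<times> 'v) set \<Rightarrow> ('v \<Rightarrow> nat) \<Rightarrow> real" where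
  "edge_prod G E \<phi> = (\<Prod>e\<in>E. adj_sign G (\<phi> (fst e)) (\<phi> (snd e)))"

definition verts :: "('v \<times> 'v) set \<Rightarrow> 'v set" where
  "verts E = fst ` E \<union> snd ` E"

text \<open>Each template vertex \<open>v\<close> takes its label from its own class
  \<open>c v\<close>. Injectivity is not imposed: for disjoint classes it is automatic, and the
  product structure of the labellings is what the edge-by-edge argument uses.\<close>

definition gform :: "'v set \<Rightarrow> ('v \<Rightarrow> nat set) \<Rightarrow> ('v \<times> 'v) set \<Rightarrow> nat set set \<Rightarrow> 'v set \<Rightarrow> 'v set \<Rightarrow>
    (('v \<Rightarrow> nat) \<Rightarrow> real) \<Rightarrow> (('v \<Rightarrow> nat) \<Rightarrow> real) \<Rightarrow> real" where
  "gform V c E G R C x y = (\<Sum>\<phi>\<in>PiE V c. x (restrict \<phi> R) * y (restrict \<phi> C) * edge_prod G E \<phi>)"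

definition gmat :: "'v set \<Rightarrow> ('v \<Rightarrow> nat set) \<Rightarrow> ('v \<times> 'v) set \<Rightarrow> nat set set \<Rightarrow> 'v set \<Rightarrow> 'v set \<Rightarrow>
    ('v \<Rightarrow> nat) \<Rightarrow> ('v \<Rightarrow> nat) \<Rightarrow> real" where
  "gmat V c E G R C r s = (\<Sum>\<phi>\<in>PiE V c. if restrict \<phi> R = r \<and> restrict \<phi> C = s then edge_prod G E \<phi> else 0)"

definition gnorm :: "'v set \<Rightarrow> ('v \<Rightarrow> nat set) \<Rightarrow> ('v \<times> 'v) set \<Rightarrow> nat set set \<Rightarrow> 'v set \<Rightarrow> 'v set \<Rightarrow> real" where
  "gnorm V c E G R C = opn (PiE R c) (PiE C c) (gmat V c E G R C)"

lemma sum_fibre_bilinear: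
  fixes h :: "'p \<Rightarrow> real"
  assumes "finite A" "finite B" "finite P" "f ` P \<subseteq> A" "g ` P \<subseteq> B"
  shows "(\<Sum>r\<in>A. \<Sum>s\<in>B. F r s * (\<Sum>p\<in>P. if f p = r \<and> g p = s then h p else 0)) = (\<Sum>p\<in>P. F (f p) (g p) * h p)"
proof -
  have "(\<Sum>r\<in>A. \<Sum>s\<in>B. F r s * (\<Sum>p\<in>P. if f p = r \<and> g p = s then h p else 0))
     = (\<Sum>r\<in>A. \<Sum>s\<in>B. \<Sum>p\<in>P. if f p = r \<and> g p = s then F r s * h p else 0)"
    unfolding sum_distrib_left by (intro sum.cong refl) auto
  also have "\<dots> = (\<Sum>r\<in>A. \<Sum>p\<in>P. \<Sum>s\<in>B. if f p = r \<and> g p = s then F r s * h p else 0)"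
    by (intro sum.cong refl sum.swap)
  also have "\<dots> = (\<Sum>p\<in>P. \<Sum>r\<in>A. \<Sum>s\<in>B. if f p = r \<and> g p = s then F r s * h p else 0)"
    by (rule sum.swap)
  also have "\<dots> = (\<Sum>p\<in>P. F (f p) (g p) * h p)"
  proof (intro sum.cong refl)
    fix p assume p: "p \<in> P"
    have "(\<Sum>r\<in>A. \<Sum>s\<in>B. if f p = r \<and> g p = s then F r s * h p else 0)
      = (\<Sum>r\<in>A. if f p = r then (\<Sum>s\<in>B. if g p = s then F r s * h p else 0) else 0)"
      by (intro sum.cong refl) auto
    also have "\<dots> = F (f p) (g p) * h p" using assms p by (auto simp: image_subset_iff)
    finally show "(\<Sum>r\<in>A. \<Sum>s\<in>B. if f p = r \<and> g p = s then F r s * h p else 0) = F (f p) (g p) * h p" .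
  qed
  finally show ?thesis .
qed

lemma restrict_in_PiE: "\<phi> \<in> PiE V c \<Longrightarrow> R \<subseteq> V \<Longrightarrow> restrict \<phi> R \<in> PiE R c"
  by (auto simp: restrict_PiE_iff)

lemma bform_gmat:
  assumes "finite V" "\<And>v. v \<in> V \<Longrightarrow> finite (c v)" "R \<subseteq> V" "C \<subseteq> V"
  shows "bform (PiE R c) (PiE C c) (gmat V c E G R C) x y = gform V c E G R C x y"
proof -
  have fin: "finite (PiE S c)" if "S \<subseteq> V" for S
    using that assms(1,2) finite_subset by (intro finite_PiE) auto
  have "bform (PiE R c) (PiE C c) (gmat V c E G R C) x y =
     (\<Sum>r\<in>PiE R c. \<Sum>s\<in>PiE C c. x r * y s * (\<Sum>\<phi>\<in>PiE V c. if restrict \<phi> R = r \<and> restrict \<phi> C = s then edge_prod G E \<phi> else 0))"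
    unfolding bform_def gmat_def by (intro sum.cong refl) (simp add: mult_ac)
  also have "\<dots> = gform V c E G R C x y"
    unfolding gform_def by (rule sum_fibre_bilinear) (use assms fin restrict_in_PiE in auto)
  finally show ?thesis .
qed

lemma gform_le:
  assumes "finite V" "\<And>v. v \<in> V \<Longrightarrow> finite (c v)" "R \<subseteq> V" "C \<subseteq> V"
  shows "gform V c E G R C x y \<le> gnorm V c E G R C * L2_set x (PiE R c) * L2_set y (PiE C c)"
proof -
  have "finite (PiE S c)" if "S \<subseteq> V" for S
    using that assms(1,2) finite_subset by (intro finite_PiE) auto
  then have "bform (PiE R c) (PiE C c) (gmat V c E G R C) x y \<le> gnorm V c E G R C * L2_set x (PiE R c) * L2_set y (PiE C c)"
    unfolding gnorm_def using assms by (intro bform_le_opn) auto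
  moreover have "bform (PiE R c) (PiE C c) (gmat V c E G R C) x y = gform V c E G R C x y"
    by (rule bform_gmat) (use assms in auto)
  ultimately show ?thesis by simp
qed

lemma gnorm_nonneg:
  assumes "finite V" "\<And>v. v \<in> V \<Longrightarrow> finite (c v)" "R \<subseteq> V" "C \<subseteq> V"
  shows "0 \<le> gnorm V c E G R C"
proof -
  have "finite (PiE S c)" if "S \<subseteq> V" for S
    using that assms(1,2) finite_subset by (intro finite_PiE) auto
  then show ?thesis unfolding gnorm_def using assms by (intro opn_nonneg) auto
qed

text \<open>A labelling of \<open>R\<close> has at most n^|V - R| extensions to
  \<open>V\<close>.\<close>

lemma L2_set_restrict_le:
  assumes V: "finite V" and c: "\<And>v. v \<in> V \<Longrightarrow> c v \<subseteq> {1..n}" and R: "R \<subseteq> V"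
  shows "(\<Sum>\<phi>\<in>PiE V c. (x (restrict \<phi> R))\<^sup>2) \<le> real n ^ card (V - R) * (L2_set x (PiE R c))\<^sup>2"
proof -
  have fc: "finite (c v)" if "v \<in> V" for v using c[OF that] finite_subset by auto
  have fin: "finite (PiE S c)" if "S \<subseteq> V" for S
    using that V fc finite_subset by (intro finite_PiE) auto
  have card: "card {\<phi> \<in> PiE V c. restrict \<phi> R = r} \<le> n ^ card (V - R)" for r
  proof -
    have "card {\<phi> \<in> PiE V c. restrict \<phi> R = r} \<le> card (PiE (V - R) c)"
    proof (rule card_inj_on_le[where f = "\<lambda>\<phi>. restrict \<phi> (V - R)"])
      show "inj_on (\<lambda>\<phi>. restrict \<phi> (V - R)) {\<phi> \<in> PiE V c. restrict \<phi> R = r}"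
      proof (rule inj_onI)
        fix \<phi> \<psi> assume a: "\<phi> \<in> {\<phi> \<in> PiE V c. restrict \<phi> R = r}" "\<psi> \<in> {\<phi> \<in> PiE V c. restrict \<phi> R = r}"
          and e: "restrict \<phi> (V - R) = restrict \<psi> (V - R)"
        have "\<phi> v = \<psi> v" if "v \<in> V" for v
        proof (cases "v \<in> R")
          case True
          have "restrict \<phi> R v = restrict \<psi> R v" using a by simp
          then show ?thesis using True by simp
        next
          case False
          then show ?thesis using fun_cong[OF e, of v] that by simp
        qed
        then show "\<phi> = \<psi>" using a by (intro PiE_ext[of \<phi> V c \<psi>]) auto
      qed
      show "(\<lambda>\<phi>. restrict \<phi> (V - R)) ` {\<phi> \<in> PiE V c. restrict \<phi> R = r} \<subseteq> PiE (V - R) c"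
        using restrict_in_PiE[of _ V c "V - R"] by blast
      show "finite (PiE (V - R) c)" using fin by simp
    qed
    also have "\<dots> = (\<Prod>v\<in>V - R. card (c v))" using V by (simp add: card_PiE)
    also have "\<dots> \<le> (\<Prod>v\<in>V - R. n)"
      using c card_mono[of "{1..n}"] by (intro prod_mono) (auto simp: subset_iff)
    finally show ?thesis by simp
  qed
  have "(\<Sum>\<phi>\<in>PiE V c. (x (restrict \<phi> R))\<^sup>2)
      = (\<Sum>r\<in>PiE R c. \<Sum>\<phi>\<in>{\<phi> \<in> PiE V c. restrict \<phi> R = r}. (x (restrict \<phi> R))\<^sup>2)"
    by (rule sum.group[symmetric]) (use fin R restrict_in_PiE in auto)
  also have "\<dots> = (\<Sum>r\<in>PiE R c. real (card {\<phi> \<in> PiE V c. restrict \<phi> R = r}) * (x r)\<^sup>2)"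
    by (intro sum.cong refl) simp
  also have "\<dots> \<le> (\<Sum>r\<in>PiE R c. real n ^ card (V - R) * (x r)\<^sup>2)"
    using card by (intro sum_mono mult_right_mono) (auto simp flip: of_nat_power)
  finally show ?thesis unfolding L2_set_power2 sum_distrib_left .
qed

text \<open>Without edges the matrix is 0/1-valued. Cauchy-Schwarz over the labellings of
  \<open>V\<close> costs n^(|V - R|/2) for the rows and n^(|V - C|/2) for the columns; because
  \<open>R\<close> and \<open>C\<close> cover \<open>V\<close>, the two exponents add up to half of
  |V| minus the overlap.\<close>

lemma gnorm_no_edges:
  assumes V: "finite V" and c: "\<And>v. v \<in> V \<Longrightarrow> c v \<subseteq> {1..n}" and RC: "R \<union> C = V"
    and s: "s \<le> card (R \<inter> C)" and n: "n \<ge> 1"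
  shows "(gnorm V c {} G R C)\<^sup>2 \<le> real n ^ (card V - s)"
proof -
  have fc: "finite (c v)" if "v \<in> V" for v using c[OF that] finite_subset by auto
  have R: "R \<subseteq> V" and C: "C \<subseteq> V" using RC by auto
  let ?B = "sqrt (real n ^ card (V - R)) * sqrt (real n ^ card (V - C))"
  have "gnorm V c {} G R C \<le> ?B"
    unfolding gnorm_def
  proof (rule opn_le)
    fix x y
    have "bform (PiE R c) (PiE C c) (gmat V c {} G R C) x y = (\<Sum>\<phi>\<in>PiE V c. x (restrict \<phi> R) * y (restrict \<phi> C))"
      by (subst bform_gmat) (use V fc R C in \<open>auto simp: gform_def edge_prod_def\<close>)
    also have "\<dots> \<le> L2_set (\<lambda>\<phi>. x (restrict \<phi> R)) (PiE V c) * L2_set (\<lambda>\<phi>. y (restrict \<phi> C)) (PiE V c)"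
      by (rule sum_mult_le_L2_set)
    also have "\<dots> \<le> (sqrt (real n ^ card (V - R)) * L2_set x (PiE R c)) *
        (sqrt (real n ^ card (V - C)) * L2_set y (PiE C c))"
    proof (intro mult_mono)
      show "L2_set (\<lambda>\<phi>. x (restrict \<phi> R)) (PiE V c) \<le> sqrt (real n ^ card (V - R)) * L2_set x (PiE R c)"
        using real_sqrt_le_mono[OF L2_set_restrict_le[OF V c R, where x = x]]
        by (simp add: real_sqrt_mult L2_set_def[of "\<lambda>\<phi>. x (restrict \<phi> R)"])
      show "L2_set (\<lambda>\<phi>. y (restrict \<phi> C)) (PiE V c) \<le> sqrt (real n ^ card (V - C)) * L2_set y (PiE C c)"
        using real_sqrt_le_mono[OF L2_set_restrict_le[OF V c C, where x = y]]
        by (simp add: real_sqrt_mult L2_set_def[of "\<lambda>\<phi>. y (restrict \<phi> C)"])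
    qed auto
    finally show "bform (PiE R c) (PiE C c) (gmat V c {} G R C) x y \<le> ?B * L2_set x (PiE R c) * L2_set y (PiE C c)"
      by (simp add: mult_ac)
  qed simp
  then have "(gnorm V c {} G R C)\<^sup>2 \<le> ?B\<^sup>2"
    using gnorm_nonneg[OF V fc R C] by (intro power_mono) auto
  also have "\<dots> = real n ^ (card (V - R) + card (V - C))"
    by (simp add: power_mult_distrib power_add)
  also have "\<dots> \<le> real n ^ (card V - s)"
  proof (rule power_increasing)
    have "(V - R) \<union> (V - C) = V - R \<inter> C" "(V - R) \<inter> (V - C) = {}" using RC by auto
    then have "card (V - R) + card (V - C) = card (V - R \<inter> C)"
      using V card_Un_disjoint[of "V - R" "V - C"] by auto
    also have "\<dots> = card V - card (R \<inter> C)" using V R by (intro card_Diff_subset) (auto intro: finite_subset)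
    finally show "card (V - R) + card (V - C) \<le> card V - s" using s by simp
  qed (use n in simp)
  finally show ?thesis .
qed

section \<open>Conditioning on all graph edges except those between two classes\<close>

definition bip_edges :: "nat set \<Rightarrow> nat set \<Rightarrow> nat set set" where
  "bip_edges A B = (\<lambda>(a, b). {a, b}) ` (A \<times> B)"

lemma adj_sign_union_bip_edges:
  assumes "a \<in> A" "b \<in> B" "A \<inter> B = {}" "G' \<inter> bip_edges A B = {}"
  shows "adj_sign (S \<union> G') a b = sgn_in S {a, b}"
  using assms unfolding adj_sign_def sgn_in_def bip_edges_def by auto

text \<open>With disjoint classes, a graph edge between \<open>c u\<close> and \<open>c v\<close>
  can only be the image of the template edge \<open>{u, v}\<close>. All other template edges are
  blind to \<open>S\<close>.\<close>

lemma edge_prod_union_bip_edges: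
  assumes dc: "\<And>v w. v \<in> V \<Longrightarrow> w \<in> V \<Longrightarrow> v \<noteq> w \<Longrightarrow> c v \<inter> c w = {}"
    and uv: "u \<in> V" "v \<in> V" "u \<noteq> v"
    and E: "\<And>e. e \<in> E \<Longrightarrow> fst e \<in> V \<and> snd e \<in> V \<and> fst e \<noteq> snd e \<and> {fst e, snd e} \<noteq> {u, v}"
    and S: "S \<subseteq> bip_edges (c u) (c v)" and \<phi>: "\<phi> \<in> PiE V c"
  shows "edge_prod (S \<union> G') E \<phi> = edge_prod G' E \<phi>"
  unfolding edge_prod_def
proof (intro prod.cong refl)
  fix e assume e: "e \<in> E"
  have m: "\<phi> (fst e) \<in> c (fst e)" "\<phi> (snd e) \<in> c (snd e)" using E[OF e] \<phi> by (auto simp: PiE_iff)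
  have "{\<phi> (fst e), \<phi> (snd e)} \<notin> bip_edges (c u) (c v)"
  proof
    assume "{\<phi> (fst e), \<phi> (snd e)} \<in> bip_edges (c u) (c v)"
    then obtain a b where ab: "a \<in> c u" "b \<in> c v" "{\<phi> (fst e), \<phi> (snd e)} = {a, b}"
      unfolding bip_edges_def by auto
    then have "\<phi> (fst e) = a \<and> \<phi> (snd e) = b \<or> \<phi> (fst e) = b \<and> \<phi> (snd e) = a"
      by (auto simp: doubleton_eq_iff)
    then show False
    proof
      assume "\<phi> (fst e) = a \<and> \<phi> (snd e) = b"
      then have "fst e = u" "snd e = v" using m ab dc E[OF e] uv by (metis disjoint_iff)+
      then show False using E[OF e] by auto
    next
      assume "\<phi> (fst e) = b \<and> \<phi> (snd e) = a"
      then have "fst e = v" "snd e = u" using m ab dc E[OF e] uv by (metis disjoint_iff)+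
      then show False using E[OF e] by auto
    qed
  qed
  then show "adj_sign (S \<union> G') (\<phi> (fst e)) (\<phi> (snd e)) = adj_sign G' (\<phi> (fst e)) (\<phi> (snd e))"
    using S unfolding adj_sign_def by auto
qed

text \<open>One template edge \<open>(u, v)\<close> is handled by conditioning on all other edges of the graph: the index
  pair of that edge is moved either to the row side or to the column side.\<close>

lemma gnorm_edge_step:
  fixes V :: "'v set"
  assumes V: "finite V" and c: "\<And>v. v \<in> V \<Longrightarrow> finite (c v)"
    and dc: "\<And>v w. v \<in> V \<Longrightarrow> w \<in> V \<Longrightarrow> v \<noteq> w \<Longrightarrow> c v \<inter> c w = {}"
    and R: "R \<subseteq> V" and C: "C \<subseteq> V"
    and uv: "u \<in> V" "v \<in> V" "u \<noteq> v"
    and E: "finite E" "(u, v) \<notin> E" "\<And>e. e \<in> E \<Longrightarrow> fst e \<in> V \<and> snd e \<in> V \<and> fst e \<noteq> snd e \<and> {fst e, snd e} \<noteq> {u, v}"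
    and G': "G' \<inter> bip_edges (c u) (c v) = {}"
    and D: "real (card (PiE R c) + card (PiE C c)) \<le> D"
  defines "I \<equiv> bip_edges (c u) (c v)"
  shows "(\<Sum>S\<in>Pow I. gnorm V c (insert (u, v) E) (S \<union> G') R C ^ (2 * 2 ^ k))
    \<le> 2 ^ card I * (D * (4 * 2 ^ k) ^ (2 ^ k)) * (gnorm V c E G' (R \<union> {u, v}) C ^ (2 * 2 ^ k)
       + gnorm V c E G' R (C \<union> {u, v}) ^ (2 * 2 ^ k))"
proof -
  have fin: "finite (PiE S c)" if "S \<subseteq> V" for S
    using that V c finite_subset by (intro finite_PiE) auto
  have finI: "finite I" unfolding I_def bip_edges_def using c uv by auto
  \<comment> \<open>The part of the matrix coming from labellings that send the template edge
    \<open>(u, v)\<close> to the graph edge \<open>a\<close>; the sign of \<open>a\<close> is then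
    the only factor depending on \<open>S\<close>.\<close>
  define X where "X a r s = (\<Sum>\<phi>\<in>PiE V c. if restrict \<phi> R = r \<and> restrict \<phi> C = s
      then (if {\<phi> u, \<phi> v} = a then edge_prod G' E \<phi> else 0) else 0)" for a r s
  have mem: "{\<phi> u, \<phi> v} \<in> I" if "\<phi> \<in> PiE V c" for \<phi>
    using that uv unfolding I_def bip_edges_def by (auto simp: PiE_iff)
  have ep: "edge_prod (S \<union> G') (insert (u, v) E) \<phi> = sgn_in S {\<phi> u, \<phi> v} * edge_prod G' E \<phi>"
    if S: "S \<subseteq> I" and \<phi>: "\<phi> \<in> PiE V c" for S \<phi>
  proof -
    have "adj_sign (S \<union> G') (\<phi> u) (\<phi> v) = sgn_in S {\<phi> u, \<phi> v}"
      using \<phi> uv dc G' by (intro adj_sign_union_bip_edges[of _ "c u" _ "c v"]) (auto simp: PiE_iff)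
    moreover have "edge_prod (S \<union> G') E \<phi> = edge_prod G' E \<phi>"
      by (rule edge_prod_union_bip_edges[OF dc uv E(3) S[unfolded I_def] \<phi>])
    ultimately show ?thesis
      using E(1,2) by (simp add: edge_prod_def)
  qed
  have gm: "gmat V c (insert (u, v) E) (S \<union> G') R C = (\<lambda>r s. \<Sum>a\<in>I. sgn_in S a * X a r s)" if S: "S \<subseteq> I" for S
  proof (intro ext)
    fix r s
    have "(\<Sum>a\<in>I. sgn_in S a * X a r s) = (\<Sum>a\<in>I. \<Sum>\<phi>\<in>PiE V c. if restrict \<phi> R = r \<and> restrict \<phi> C = s
      then (if {\<phi> u, \<phi> v} = a then sgn_in S a * edge_prod G' E \<phi> else 0) else 0)"
      unfolding X_def sum_distrib_left by (intro sum.cong refl) auto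
    also have "\<dots> = (\<Sum>\<phi>\<in>PiE V c. \<Sum>a\<in>I. if restrict \<phi> R = r \<and> restrict \<phi> C = s
      then (if {\<phi> u, \<phi> v} = a then sgn_in S a * edge_prod G' E \<phi> else 0) else 0)" by (rule sum.swap)
    also have "\<dots> = gmat V c (insert (u, v) E) (S \<union> G') R C r s"
      unfolding gmat_def using mem finI ep[OF S] by (intro sum.cong refl) auto
    finally show "gmat V c (insert (u, v) E) (S \<union> G') R C r s = (\<Sum>a\<in>I. sgn_in S a * X a r s)" by simp
  qed
  have triple: "(\<Sum>a\<in>I. \<Sum>r\<in>PiE R c. \<Sum>s\<in>PiE C c. F a r s * X a r s)
     = (\<Sum>\<phi>\<in>PiE V c. F {\<phi> u, \<phi> v} (restrict \<phi> R) (restrict \<phi> C) * edge_prod G' E \<phi>)" for F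
  proof -
    have "(\<Sum>a\<in>I. \<Sum>r\<in>PiE R c. \<Sum>s\<in>PiE C c. F a r s * X a r s)
      = (\<Sum>a\<in>I. \<Sum>\<phi>\<in>PiE V c. F a (restrict \<phi> R) (restrict \<phi> C) * (if {\<phi> u, \<phi> v} = a then edge_prod G' E \<phi> else 0))"
      unfolding X_def using fin R C restrict_in_PiE by (intro sum.cong refl sum_fibre_bilinear) auto
    also have "\<dots> = (\<Sum>\<phi>\<in>PiE V c. \<Sum>a\<in>I. if {\<phi> u, \<phi> v} = a then F a (restrict \<phi> R) (restrict \<phi> C) * edge_prod G' E \<phi> else 0)"
      by (subst sum.swap) (intro sum.cong refl, auto)
    also have "\<dots> = (\<Sum>\<phi>\<in>PiE V c. F {\<phi> u, \<phi> v} (restrict \<phi> R) (restrict \<phi> C) * edge_prod G' E \<phi>)"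
      using mem finI by (intro sum.cong refl) auto
    finally show ?thesis .
  qed
  \<comment> \<open>A weight indexed by an edge \<open>a\<close> and a labelling of \<open>T\<close>
    is a weight on labellings of \<open>T \<union> {u, v}\<close>: as the classes of
    \<open>u\<close> and \<open>v\<close> are disjoint, the unordered edge determines both labels,
    so no entry is counted twice.\<close>
  have flat: "L2_set (\<lambda>\<psi>. w {\<psi> u, \<psi> v} (restrict \<psi> T)) (PiE (T \<union> {u, v}) c) \<le> sqrt (\<Sum>a\<in>I. \<Sum>r\<in>PiE T c. (w a r)\<^sup>2)"
    if T: "T \<subseteq> V" for T and w :: "nat set \<Rightarrow> ('v \<Rightarrow> nat) \<Rightarrow> real"
  proof -
    let ?f = "\<lambda>\<psi>. ({\<psi> u, \<psi> v}, restrict \<psi> T)"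
    have inj: "inj_on ?f (PiE (T \<union> {u, v}) c)"
    proof (rule inj_onI)
      fix \<phi> \<psi> assume a: "\<phi> \<in> PiE (T \<union> {u, v}) c" "\<psi> \<in> PiE (T \<union> {u, v}) c" and e: "?f \<phi> = ?f \<psi>"
      have m: "\<phi> u \<in> c u" "\<phi> v \<in> c v" "\<psi> u \<in> c u" "\<psi> v \<in> c v" using a by (auto simp: PiE_iff)
      have "\<phi> u = \<psi> u \<and> \<phi> v = \<psi> v"
        using e m dc[OF uv] by (auto simp: doubleton_eq_iff)
      moreover have "\<phi> t = \<psi> t" if "t \<in> T" for t
      proof -
        have "restrict \<phi> T t = restrict \<psi> T t" using e by simp
        then show ?thesis using that by simp
      qed
      ultimately show "\<phi> = \<psi>" using a by (intro PiE_ext[of \<phi> "T \<union> {u, v}" c \<psi>]) auto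
    qed
    have im: "?f ` PiE (T \<union> {u, v}) c \<subseteq> I \<times> PiE T c"
      unfolding I_def bip_edges_def by (auto simp: PiE_iff)
    have "(\<Sum>\<psi>\<in>PiE (T \<union> {u, v}) c. (w {\<psi> u, \<psi> v} (restrict \<psi> T))\<^sup>2)
      = (\<Sum>p\<in>?f ` PiE (T \<union> {u, v}) c. (w (fst p) (snd p))\<^sup>2)"
      by (subst sum.reindex[OF inj]) simp
    also have "\<dots> \<le> (\<Sum>p\<in>I \<times> PiE T c. (w (fst p) (snd p))\<^sup>2)"
      using im finI fin[OF T] by (intro sum_mono2) auto
    also have "\<dots> = (\<Sum>a\<in>I. \<Sum>r\<in>PiE T c. (w a r)\<^sup>2)"
      by (simp add: sum.cartesian_product case_prod_beta)
    finally show ?thesis unfolding L2_set_def by (rule real_sqrt_le_mono)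
  qed
  have RR: "R \<union> {u, v} \<subseteq> V" and CC: "C \<union> {u, v} \<subseteq> V" using R C uv by auto
  have abs_int: "insert u (insert v T) \<inter> T = T" for T by blast
  define N1 where "N1 = gnorm V c E G' (R \<union> {u, v}) C"
  define N2 where "N2 = gnorm V c E G' R (C \<union> {u, v})"
  have N0: "0 \<le> N1" "0 \<le> N2" unfolding N1_def N2_def by (rule gnorm_nonneg[OF V c]; use RR CC R C in simp)+
  have "(\<Sum>S\<in>Pow I. opn (PiE R c) (PiE C c) (\<lambda>r s. \<Sum>a\<in>I. sgn_in S a * X a r s) ^ (2 * 2 ^ k))
    \<le> 2 ^ card I * real (card (PiE R c) + card (PiE C c)) * (4 * 2 ^ k * (max N1 N2)\<^sup>2) ^ (2 ^ k)"
  proof (rule rect_khintchine)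
    show "finite I" "finite (PiE R c)" "finite (PiE C c)" "0 \<le> max N1 N2"
      using finI fin R C N0 by auto
    fix w :: "nat set \<Rightarrow> ('v \<Rightarrow> nat) \<Rightarrow> real" and z :: "('v \<Rightarrow> nat) \<Rightarrow> real"
    have "(\<Sum>a\<in>I. \<Sum>r\<in>PiE R c. \<Sum>s\<in>PiE C c. w a r * X a r s * z s)
       = (\<Sum>a\<in>I. \<Sum>r\<in>PiE R c. \<Sum>s\<in>PiE C c. (w a r * z s) * X a r s)"
      by (simp add: mult_ac)
    also have "\<dots> = gform V c E G' (R \<union> {u, v}) C (\<lambda>\<psi>. w {\<psi> u, \<psi> v} (restrict \<psi> R)) z"
      unfolding triple gform_def by (intro sum.cong refl) (simp add: abs_int)
    also have "\<dots> \<le> N1 * L2_set (\<lambda>\<psi>. w {\<psi> u, \<psi> v} (restrict \<psi> R)) (PiE (R \<union> {u, v}) c) * L2_set z (PiE C c)"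
      unfolding N1_def by (rule gform_le[OF V c RR C])
    also have "\<dots> \<le> max N1 N2 * sqrt (\<Sum>a\<in>I. \<Sum>r\<in>PiE R c. (w a r)\<^sup>2) * L2_set z (PiE C c)"
      using N0 by (intro mult_right_mono mult_mono flat R) (auto simp: sum_nonneg)
    finally show "(\<Sum>a\<in>I. \<Sum>r\<in>PiE R c. \<Sum>s\<in>PiE C c. w a r * X a r s * z s)
       \<le> max N1 N2 * sqrt (\<Sum>a\<in>I. \<Sum>r\<in>PiE R c. (w a r)\<^sup>2) * L2_set z (PiE C c)" .
    have "(\<Sum>a\<in>I. \<Sum>r\<in>PiE R c. \<Sum>s\<in>PiE C c. z r * X a r s * w a s)
       = (\<Sum>a\<in>I. \<Sum>r\<in>PiE R c. \<Sum>s\<in>PiE C c. (z r * w a s) * X a r s)"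
      by (simp add: mult_ac)
    also have "\<dots> = gform V c E G' R (C \<union> {u, v}) z (\<lambda>\<psi>. w {\<psi> u, \<psi> v} (restrict \<psi> C))"
      unfolding triple gform_def by (intro sum.cong refl) (simp add: abs_int)
    also have "\<dots> \<le> N2 * L2_set z (PiE R c) * L2_set (\<lambda>\<psi>. w {\<psi> u, \<psi> v} (restrict \<psi> C)) (PiE (C \<union> {u, v}) c)"
      unfolding N2_def by (rule gform_le[OF V c R CC])
    also have "\<dots> \<le> max N1 N2 * L2_set z (PiE R c) * sqrt (\<Sum>a\<in>I. \<Sum>r\<in>PiE C c. (w a r)\<^sup>2)"
      using N0 by (intro mult_mono flat C) (auto simp: sum_nonneg)
    finally show "(\<Sum>a\<in>I. \<Sum>r\<in>PiE R c. \<Sum>s\<in>PiE C c. z r * X a r s * w a s)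
       \<le> max N1 N2 * sqrt (\<Sum>a\<in>I. \<Sum>r\<in>PiE C c. (w a r)\<^sup>2) * L2_set z (PiE R c)" by (simp add: mult_ac)
  qed
  also have "\<dots> = 2 ^ card I * (real (card (PiE R c) + card (PiE C c)) * (4 * 2 ^ k) ^ (2 ^ k)) * max N1 N2 ^ (2 * 2 ^ k)"
    by (simp add: power_mult_distrib power_mult mult_ac)
  also have "\<dots> \<le> 2 ^ card I * (D * (4 * 2 ^ k) ^ (2 ^ k)) * (N1 ^ (2 * 2 ^ k) + N2 ^ (2 * 2 ^ k))"
  proof (intro mult_mono mult_left_mono mult_right_mono D)
    \<comment> \<open>The maximum is replaced by a sum of powers, so that the two placements of the
      edge can be averaged separately in the induction.\<close>
    show "max N1 N2 ^ (2 * 2 ^ k) \<le> N1 ^ (2 * 2 ^ k) + N2 ^ (2 * 2 ^ k)"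
      using N0 by (auto simp: max_def)
  qed (use D N0 in auto)
  also have "(\<Sum>S\<in>Pow I. opn (PiE R c) (PiE C c) (\<lambda>r s. \<Sum>a\<in>I. sgn_in S a * X a r s) ^ (2 * 2 ^ k))
     = (\<Sum>S\<in>Pow I. gnorm V c (insert (u, v) E) (S \<union> G') R C ^ (2 * 2 ^ k))"
    by (intro sum.cong refl) (simp add: gnorm_def gm)
  finally show ?thesis unfolding N1_def N2_def .
qed

lemma finite_pairs: "finite (pairs n)"
  by (rule finite_subset[of _ "Pow {1..n}"]) (auto simp: pairs_def)

text \<open>In terms of uniformly random edge sets this is the independence of the edges inside and
  outside \<open>I\<close>.\<close>

lemma sum_Pow_split:
  fixes f :: "'a set \<Rightarrow> real"
  assumes "finite P" "I \<subseteq> P"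
  shows "(\<Sum>G\<in>Pow P. f G) = (\<Sum>G'\<in>Pow (P - I). \<Sum>S\<in>Pow I. f (S \<union> G'))"
proof -
  have "(\<Sum>G'\<in>Pow (P - I). \<Sum>S\<in>Pow I. f (S \<union> G')) = (\<Sum>p\<in>Pow (P - I) \<times> Pow I. f (snd p \<union> fst p))"
    by (simp add: sum.cartesian_product case_prod_beta)
  also have "\<dots> = (\<Sum>G\<in>Pow P. f G)"
    by (rule sum.reindex_bij_witness[of _ "\<lambda>G. (G - I, G \<inter> I)" "\<lambda>p. snd p \<union> fst p"])
       (use assms in \<open>auto simp: Un_Diff Int_Un_distrib2 Diff_Int_distrib2\<close>)
  finally show ?thesis by simp
qed

lemma bip_edges_subset_pairs:
  assumes "A \<subseteq> {1..n}" "B \<subseteq> {1..n}" "A \<inter> B = {}"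
  shows "bip_edges A B \<subseteq> pairs n"
  using assms unfolding bip_edges_def pairs_def by (auto simp: card_insert_if)

lemma card_PiE_le_power:
  assumes "finite V" "n \<ge> 1" "\<And>v. v \<in> V \<Longrightarrow> c v \<subseteq> {1..n}" "R \<subseteq> V"
  shows "real (card (PiE R c)) \<le> real n ^ card V"
proof -
  have fR: "finite R" using assms finite_subset by auto
  have "card (PiE R c) = (\<Prod>v\<in>R. card (c v))" using fR by (simp add: card_PiE)
  also have "\<dots> \<le> (\<Prod>v\<in>R. n)"
    using assms card_mono[of "{1..n}"] by (intro prod_mono) (auto simp: subset_iff)
  also have "\<dots> \<le> n ^ card V"
    using assms by (simp add: power_increasing card_mono)
  finally show ?thesis by (metis of_nat_le_iff of_nat_power)
qed

lemma verts_insert: "verts (insert e E) = insert (fst e) (insert (snd e) (verts E))"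
  unfolding verts_def by auto

text \<open>Induction over the template edges. Each edge is assigned to the row or the column side,
  which costs one factor 2 for the choice and one Khintchine constant. Once all edges are assigned,
  \<open>sep\<close> guarantees an overlap of at least \<open>s\<close>, whichever assignment was
  made. The order on the vertices orients the edges, so that no undirected edge occurs
  twice.\<close>

lemma gnorm_moment:
  fixes V :: "'v::linorder set"
  assumes V: "finite V" and n: "n \<ge> 1" and c: "\<And>v. v \<in> V \<Longrightarrow> c v \<subseteq> {1..n}"
    and dc: "\<And>v w. v \<in> V \<Longrightarrow> w \<in> V \<Longrightarrow> v \<noteq> w \<Longrightarrow> c v \<inter> c w = {}"
    and E: "finite E" "\<And>e. e \<in> E \<Longrightarrow> fst e \<in> V \<and> snd e \<in> V \<and> fst e < snd e"
    and RC: "R \<union> C \<union> verts E = V"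
    and sep: "\<And>E1. E1 \<subseteq> E \<Longrightarrow> s \<le> card ((R \<union> verts E1) \<inter> (C \<union> verts (E - E1)))"
  shows "(\<Sum>G\<in>Pow (pairs n). gnorm V c E G R C ^ (2 * 2 ^ k))
    \<le> 2 ^ card (pairs n) * (2 * (2 * real n ^ card V) * (4 * 2 ^ k) ^ (2 ^ k)) ^ card E
        * (real n ^ (card V - s)) ^ (2 ^ k)"
  using E RC sep
proof (induction E arbitrary: R C rule: finite_induct)
  case empty
  have fc: "finite (c v)" if "v \<in> V" for v using c[OF that] finite_subset by auto
  have "gnorm V c {} G R C ^ (2 * 2 ^ k) \<le> (real n ^ (card V - s)) ^ (2 ^ k)" for G
  proof -
    have "(gnorm V c {} G R C)\<^sup>2 \<le> real n ^ (card V - s)"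
      using empty(2) empty(3)[of "{}"] by (intro gnorm_no_edges V c n) (auto simp: verts_def)
    then show ?thesis unfolding power_mult by (intro power_mono) auto
  qed
  then have "(\<Sum>G\<in>Pow (pairs n). gnorm V c {} G R C ^ (2 * 2 ^ k))
     \<le> (\<Sum>G\<in>Pow (pairs n). (real n ^ (card V - s)) ^ (2 ^ k))" by (intro sum_mono)
  then show ?case by (simp add: card_Pow finite_pairs)
next
  case (insert e E)
  obtain u v where e: "e = (u, v)" by (cases e)
  have uv: "u \<in> V" "v \<in> V" "u < v" using insert.prems(1)[of e] e by auto
  then have uv': "u \<noteq> v" by simp
  let ?p = "2 * 2 ^ k :: nat" and ?I = "bip_edges (c u) (c v)" and ?P = "pairs n"
  let ?D = "2 * real n ^ card V"
  define q where "q = (4 * 2 ^ k :: real) ^ (2 ^ k)"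
  have q0: "0 \<le> q" unfolding q_def by simp
  have fc: "finite (c v)" if "v \<in> V" for v using c[OF that] finite_subset by auto
  have E': "fst f \<in> V \<and> snd f \<in> V \<and> fst f \<noteq> snd f \<and> {fst f, snd f} \<noteq> {u, v}" if f: "f \<in> E" for f
  proof -
    have "fst f \<in> V" "snd f \<in> V" "fst f < snd f" using insert.prems(1)[of f] f by auto
    moreover have "f \<noteq> (u, v)" using insert.hyps f e by auto
    ultimately show ?thesis using uv by (cases f) (auto simp: doubleton_eq_iff)
  qed
  have IP: "?I \<subseteq> ?P" using c[OF uv(1)] c[OF uv(2)] dc[OF uv(1,2) uv'] by (rule bip_edges_subset_pairs)
  have R: "R \<subseteq> V" and C: "C \<subseteq> V" using insert.prems(2) by auto
  have RR: "R \<union> {u, v} \<subseteq> V" and CC: "C \<union> {u, v} \<subseteq> V" using R C uv by auto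
  have D: "real (card (PiE R c) + card (PiE C c)) \<le> ?D"
  proof -
    have "real (card (PiE R c)) \<le> real n ^ card V" "real (card (PiE C c)) \<le> real n ^ card V"
      by (rule card_PiE_le_power[OF V n]; use c R C in simp)+
    then show ?thesis by linarith
  qed
  have indep: "gnorm V c E (S \<union> G') R' C' = gnorm V c E G' R' C'" if "S \<subseteq> ?I" for S G' R' C'
  proof -
    have "gmat V c E (S \<union> G') R' C' = gmat V c E G' R' C'"
      unfolding gmat_def using edge_prod_union_bip_edges[OF dc uv(1,2) uv' E' that]
      by (intro ext sum.cong refl) simp
    then show ?thesis by (simp add: gnorm_def)
  qed
  \<comment> \<open>After the removal of the edge the norm no longer depends on \<open>S\<close>, so
    averaging over \<open>S\<close> can be put back and yields the full average that the induction
    hypothesis speaks of.\<close>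
  have avg: "(\<Sum>G'\<in>Pow (?P - ?I). 2 ^ card ?I * gnorm V c E G' R' C' ^ ?p) = (\<Sum>G\<in>Pow ?P. gnorm V c E G R' C' ^ ?p)" for R' C'
  proof -
    have "(\<Sum>S\<in>Pow ?I. gnorm V c E (S \<union> G') R' C' ^ ?p) = 2 ^ card ?I * gnorm V c E G' R' C' ^ ?p" for G'
    proof -
      have "(\<Sum>S\<in>Pow ?I. gnorm V c E (S \<union> G') R' C' ^ ?p) = (\<Sum>S\<in>Pow ?I. gnorm V c E G' R' C' ^ ?p)"
        using indep by (intro sum.cong refl) simp
      then show ?thesis using finite_subset[OF IP finite_pairs] by (simp add: card_Pow)
    qed
    then show ?thesis unfolding sum_Pow_split[OF finite_pairs IP] by simp
  qed
  \<comment> \<open>\<open>sep1\<close> is the assignment with \<open>e\<close> in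
    \<open>E1\<close>, \<open>sep2\<close> the one with \<open>e\<close> in the complement.\<close>
  have sep1: "s \<le> card (((R \<union> {u, v}) \<union> verts E1) \<inter> (C \<union> verts (E - E1)))" if "E1 \<subseteq> E" for E1
  proof -
    have "insert e E - insert e E1 = E - E1" using insert.hyps by auto
    then show ?thesis using insert.prems(3)[of "insert e E1"] that by (simp add: verts_insert e subset_insertI2)
  qed
  have sep2: "s \<le> card ((R \<union> verts E1) \<inter> ((C \<union> {u, v}) \<union> verts (E - E1)))" if "E1 \<subseteq> E" for E1
  proof -
    have "insert e E - E1 = insert e (E - E1)" using insert.hyps that by auto
    then show ?thesis using insert.prems(3)[of E1] that by (simp add: verts_insert e subset_insertI2)
  qed
  let ?B = "2 ^ card ?P * (2 * ?D * q) ^ card E * (real n ^ (card V - s)) ^ (2 ^ k)"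
  have ih1: "(\<Sum>G\<in>Pow ?P. gnorm V c E G (R \<union> {u, v}) C ^ ?p) \<le> ?B"
    unfolding q_def using insert.prems(1,2) sep1 by (intro insert.IH) (auto simp: verts_insert e)
  have ih2: "(\<Sum>G\<in>Pow ?P. gnorm V c E G R (C \<union> {u, v}) ^ ?p) \<le> ?B"
    unfolding q_def using insert.prems(1,2) sep2 by (intro insert.IH) (auto simp: verts_insert e)
  have "(\<Sum>G\<in>Pow ?P. gnorm V c (insert e E) G R C ^ ?p)
     = (\<Sum>G'\<in>Pow (?P - ?I). \<Sum>S\<in>Pow ?I. gnorm V c (insert (u, v) E) (S \<union> G') R C ^ ?p)"
    unfolding e by (rule sum_Pow_split[OF finite_pairs IP])
  also have "\<dots> \<le> (\<Sum>G'\<in>Pow (?P - ?I). 2 ^ card ?I * (?D * q) *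
      (gnorm V c E G' (R \<union> {u, v}) C ^ ?p + gnorm V c E G' R (C \<union> {u, v}) ^ ?p))"
    unfolding q_def
    by (intro sum_mono gnorm_edge_step V fc dc R C uv uv' insert.hyps E' D)
       (use insert.hyps e E' in auto)
  also have "\<dots> = (?D * q) * (\<Sum>G'\<in>Pow (?P - ?I). 2 ^ card ?I * gnorm V c E G' (R \<union> {u, v}) C ^ ?p)
     + (?D * q) * (\<Sum>G'\<in>Pow (?P - ?I). 2 ^ card ?I * gnorm V c E G' R (C \<union> {u, v}) ^ ?p)"
    unfolding sum_distrib_left sum.distrib[symmetric] by (intro sum.cong refl) (simp only: ring_distribs mult_ac)
  also have "\<dots> \<le> (?D * q) * ?B + (?D * q) * ?B"
    unfolding avg using q0 by (intro add_mono mult_left_mono ih1 ih2) auto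
  also have "\<dots> = 2 ^ card ?P * (2 * ?D * q) ^ card (insert e E) * (real n ^ (card V - s)) ^ (2 ^ k)"
    using insert.hyps by (simp add: algebra_simps)
  finally show ?case unfolding q_def .
qed

section \<open>Injective labellings, decoupling by colourings and the norm bound\<close>

definition inj_maps :: "nat \<Rightarrow> 'v set \<Rightarrow> ('v \<Rightarrow> nat) set" where
  "inj_maps n V = {\<phi> \<in> PiE V (\<lambda>_. {1..n}). inj_on \<phi> V}"

definition iform :: "nat \<Rightarrow> 'v set \<Rightarrow> ('v \<times> 'v) set \<Rightarrow> nat set set \<Rightarrow> 'v set \<Rightarrow> 'v set \<Rightarrow>
    (('v \<Rightarrow> nat) \<Rightarrow> real) \<Rightarrow> (('v \<Rightarrow> nat) \<Rightarrow> real) \<Rightarrow> real" where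
  "iform n V E G R C x y = (\<Sum>\<phi>\<in>inj_maps n V. x (restrict \<phi> R) * y (restrict \<phi> C) * edge_prod G E \<phi>)"

definition colour_class :: "nat \<Rightarrow> (nat \<Rightarrow> 'v) \<Rightarrow> 'v \<Rightarrow> nat set" where
  "colour_class n \<xi> v = {a \<in> {1..n}. \<xi> a = v}"

text \<open>The colours of the |V| points in the image are forced and the others are free.
  Injectivity ensures that |V| is at most n, so the natural subtraction is exact.\<close>

lemma card_compatible_colourings:
  assumes V: "finite V" and \<phi>: "\<phi> \<in> inj_maps n V"
  shows "card {\<xi> \<in> PiE {1..n} (\<lambda>_. V). \<forall>v\<in>V. \<xi> (\<phi> v) = v} = card V ^ (n - card V)"
proof -
  have inj: "inj_on \<phi> V" and im: "\<phi> ` V \<subseteq> {1..n}" using \<phi> by (auto simp: inj_maps_def PiE_iff)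
  define T where "T a = (if a \<in> \<phi> ` V then {the_inv_into V \<phi> a} else V)" for a
  have "{\<xi> \<in> PiE {1..n} (\<lambda>_. V). \<forall>v\<in>V. \<xi> (\<phi> v) = v} = PiE {1..n} T"
  proof (intro equalityI subsetI)
    fix \<xi> assume a: "\<xi> \<in> {\<xi> \<in> PiE {1..n} (\<lambda>_. V). \<forall>v\<in>V. \<xi> (\<phi> v) = v}"
    have "\<xi> b \<in> T b" if "b \<in> {1..n}" for b
      using a that inj by (auto simp: T_def PiE_iff the_inv_into_f_f)
    then show "\<xi> \<in> PiE {1..n} T" using a by (auto simp: PiE_iff)
  next
    fix \<xi> assume a: "\<xi> \<in> PiE {1..n} T"
    then have T: "\<xi> b \<in> T b" if "b \<in> {1..n}" for b using that by (auto simp: PiE_iff)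
    have "\<xi> (\<phi> v) = v" if "v \<in> V" for v
      using T[of "\<phi> v"] im that inj by (auto simp: T_def the_inv_into_f_f)
    moreover have "\<xi> b \<in> V" if b: "b \<in> {1..n}" for b
      using T[OF b] the_inv_into_into[OF inj, of b V] by (auto simp: T_def split: if_splits)
    ultimately show "\<xi> \<in> {\<xi> \<in> PiE {1..n} (\<lambda>_. V). \<forall>v\<in>V. \<xi> (\<phi> v) = v}" using a by (auto simp: PiE_iff)
  qed
  then have "card {\<xi> \<in> PiE {1..n} (\<lambda>_. V). \<forall>v\<in>V. \<xi> (\<phi> v) = v} = (\<Prod>a\<in>{1..n}. card (T a))"
    by (simp add: card_PiE)
  also have "\<dots> = (\<Prod>a\<in>{1..n} - \<phi> ` V. card (T a)) * (\<Prod>a\<in>\<phi> ` V. card (T a))"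
    using im by (intro prod.subset_diff) auto
  also have "(\<Prod>a\<in>\<phi> ` V. card (T a)) = 1" by (intro prod.neutral) (auto simp: T_def)
  also have "(\<Prod>a\<in>{1..n} - \<phi> ` V. card (T a)) = card V ^ card ({1..n} - \<phi> ` V)"
    by (simp add: T_def)
  also have "card ({1..n} - \<phi> ` V) = n - card V"
    using im V card_image[OF inj] by (subst card_Diff_subset) auto
  finally show ?thesis by simp
qed

text \<open>Double counting: every injective labelling is compatible with the same number of
  colourings, and a labelling compatible with some colouring is injective because its labels have
  different colours.\<close>

lemma decoupling:
  assumes V: "finite V"
  shows "real (card V) ^ (n - card V) * iform n V E G R C x y
    = (\<Sum>\<xi>\<in>PiE {1..n} (\<lambda>_. V). gform V (colour_class n \<xi>) E G R C x y)"
proof -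
  let ?X = "PiE {1..n} (\<lambda>_. V)"
  define t where "t \<phi> = x (restrict \<phi> R) * y (restrict \<phi> C) * edge_prod G E \<phi>" for \<phi>
  have fX: "finite ?X" using V by (intro finite_PiE) auto
  have fI: "finite (inj_maps n V)"
    by (rule finite_subset[of _ "PiE V (\<lambda>_. {1..n})"]) (use V in \<open>auto simp: inj_maps_def intro!: finite_PiE\<close>)
  have P: "PiE V (colour_class n \<xi>) = {\<phi> \<in> inj_maps n V. \<forall>v\<in>V. \<xi> (\<phi> v) = v}" for \<xi>
  proof (intro set_eqI iffI)
    fix \<phi> assume "\<phi> \<in> PiE V (colour_class n \<xi>)"
    then have a: "\<And>v. v \<in> V \<Longrightarrow> \<phi> v \<in> {1..n} \<and> \<xi> (\<phi> v) = v" "\<phi> \<in> extensional V"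
      by (auto simp: PiE_iff colour_class_def)
    moreover have "inj_on \<phi> V" using a(1) by (metis inj_onI)
    ultimately show "\<phi> \<in> {\<phi> \<in> inj_maps n V. \<forall>v\<in>V. \<xi> (\<phi> v) = v}"
      by (simp add: inj_maps_def PiE_iff)
  qed (simp add: inj_maps_def PiE_iff colour_class_def)
  have "(\<Sum>\<xi>\<in>?X. gform V (colour_class n \<xi>) E G R C x y)
     = (\<Sum>\<xi>\<in>?X. \<Sum>\<phi>\<in>inj_maps n V. if \<forall>v\<in>V. \<xi> (\<phi> v) = v then t \<phi> else 0)"
    unfolding gform_def P t_def[symmetric] using fI by (intro sum.cong refl sum.inter_filter)
  also have "\<dots> = (\<Sum>\<phi>\<in>inj_maps n V. \<Sum>\<xi>\<in>?X. if \<forall>v\<in>V. \<xi> (\<phi> v) = v then t \<phi> else 0)" by (rule sum.swap)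
  also have "\<dots> = (\<Sum>\<phi>\<in>inj_maps n V. \<Sum>\<xi>\<in>{\<xi>\<in>?X. \<forall>v\<in>V. \<xi> (\<phi> v) = v}. t \<phi>)"
    using fX by (intro sum.cong refl sum.inter_filter[symmetric])
  also have "\<dots> = (\<Sum>\<phi>\<in>inj_maps n V. real (card V) ^ (n - card V) * t \<phi>)"
    by (intro sum.cong refl) (simp only: sum_constant card_compatible_colourings[OF V] of_nat_power)
  finally show ?thesis unfolding iform_def t_def by (simp add: sum_distrib_left)
qed

lemma power_mean_le:
  fixes a :: "'x \<Rightarrow> real"
  assumes "finite X" "X \<noteq> {}" "even N"
  shows "((\<Sum>i\<in>X. a i) / real (card X)) ^ N \<le> (\<Sum>i\<in>X. a i ^ N) / real (card X)"
proof -
  have "(\<Sum>i\<in>X. (1 / real (card X)) *\<^sub>R a i) ^ N \<le> (\<Sum>i\<in>X. (1 / real (card X)) * a i ^ N)"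
    using assms by (intro convex_on_sum[OF _ _ convex_power_even]) auto
  then show ?thesis by (simp add: sum_divide_distrib)
qed

text \<open>Supplies a moment order that is a power of two and comparable to ln n.\<close>

lemma ex_power2_between:
  fixes y :: real
  assumes "1 \<le> y"
  shows "\<exists>k. y \<le> 2 ^ k \<and> 2 ^ k \<le> 2 * y"
proof -
  define k where "k = (LEAST k. y \<le> 2 ^ k)"
  have ex: "\<exists>k. y \<le> 2 ^ k" using real_arch_pow[of 2 y] by (auto intro: less_imp_le)
  then have 1: "y \<le> 2 ^ k" unfolding k_def by (rule LeastI_ex)
  have "2 ^ k \<le> 2 * y"
  proof (cases k)
    case 0
    then show ?thesis using assms by simp
  next
    case (Suc j)
    then have "\<not> y \<le> 2 ^ j" unfolding k_def by (intro not_less_Least) simp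
    then show ?thesis using Suc by simp
  qed
  then show ?thesis using 1 by blast
qed

lemma gnp_half: "gnp n (1/2) = pmf_of_set (Pow (pairs n))"
  unfolding gnp_def by (rule pmf_of_set_Pow_conv_bernoulli[OF finite_pairs])

lemma markov_Pow:
  fixes Z :: "nat set set \<Rightarrow> real"
  assumes Z: "\<And>G. 0 \<le> Z G" and t: "0 < t"
    and mom: "(\<Sum>G\<in>Pow (pairs n). Z G ^ N) \<le> 2 ^ card (pairs n) * B"
  shows "measure_pmf.prob (gnp n (1/2)) {G. t < Z G} \<le> B / t ^ N"
proof -
  let ?P = "Pow (pairs n)"
  have fin: "finite ?P" using finite_pairs by simp
  have ne: "?P \<noteq> {}" by auto
  have "real (card (?P \<inter> {G. t < Z G})) * t ^ N = (\<Sum>G\<in>?P \<inter> {G. t < Z G}. t ^ N)" by simp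
  also have "\<dots> \<le> (\<Sum>G\<in>?P \<inter> {G. t < Z G}. Z G ^ N)" using t by (intro sum_mono power_mono) auto
  also have "\<dots> \<le> (\<Sum>G\<in>?P. Z G ^ N)" using fin Z by (intro sum_mono2) auto
  finally have 1: "real (card (?P \<inter> {G. t < Z G})) * t ^ N \<le> 2 ^ card (pairs n) * B" using mom by simp
  have "measure_pmf.prob (gnp n (1/2)) {G. t < Z G} = real (card (?P \<inter> {G. t < Z G})) / 2 ^ card (pairs n)"
    unfolding gnp_half using fin ne by (simp add: measure_pmf_of_set card_Pow finite_pairs)
  also have "\<dots> \<le> B / t ^ N" using 1 t by (simp add: field_simps)
  finally show ?thesis .
qed

text \<open>The exponent of \<open>n\<close> comes from the smallest vertex separator between \<open>U\<close> and \<open>W\<close>: an assignment of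
  the template edges to rows (\<open>E1\<close>) and columns (\<open>E - E1\<close>) turns the matrix into a 0/1 matrix whose norm is
  determined by the number of vertices that occur on both sides.\<close>

theorem graph_matrix_norm:
  fixes V :: "'v::linorder set"
  assumes V: "finite V" "V \<noteq> {}" and E: "finite E" "\<And>e. e \<in> E \<Longrightarrow> fst e \<in> V \<and> snd e \<in> V \<and> fst e < snd e"
    and UW: "U \<union> W \<union> verts E = V"
    and sep: "\<And>E1. E1 \<subseteq> E \<Longrightarrow> s \<le> card ((U \<union> verts E1) \<inter> (W \<union> verts (E - E1)))"
  shows "\<exists>K>0. \<forall>n\<ge>max 4 (card V). measure_pmf.prob (gnp n (1/2))
     {G. \<not> (\<forall>x y. iform n V E G U W x y \<le> K * ln (real n) ^ card E * sqrt (real n ^ (card V - s))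
            * L2_set x (PiE U (\<lambda>_. {1..n})) * L2_set y (PiE W (\<lambda>_. {1..n})))} \<le> 1 / real n ^ 4"
proof -
  define v where "v = card V"
  define e where "e = card E"
  \<comment> \<open>The power of n to be absorbed: n^4 for the failure probability, and for each
    template edge the dimension factor 4 n^v \<le> n^(v+1).\<close>
  define \<kappa> where "\<kappa> = (v + 1) * e + 4"
  \<comment> \<open>The factor v^v is the loss of decoupling, v^n colourings against v^(n-v)
    compatible ones; 8^e comes from 4 * 2^k \<le> 8 ln n; and exp \<kappa> absorbs n^\<kappa>,
    because the moment order p is at least ln n.\<close>
  define K where "K = real v ^ v * 8 ^ e * exp (real \<kappa>)"
  have v1: "v \<ge> 1" unfolding v_def using V by (simp add: Suc_le_eq card_gt_0_iff)
  have K0: "K > 0" unfolding K_def using v1 by simp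
  show ?thesis
  proof (intro exI[of _ K] conjI K0 allI impI)
    fix n assume "n \<ge> max 4 (card V)"
    then have n4: "n \<ge> 4" and nv: "n \<ge> v" by (auto simp: v_def)
    have "exp 1 \<le> (4::real)" using exp_le by simp
    then have ln1: "1 \<le> ln (real n)" using n4 by (subst ln_ge_iff) auto
    obtain k where k: "ln (real n) \<le> 2 ^ k" "2 ^ k \<le> 2 * ln (real n)" using ex_power2_between[OF ln1] by blast
    define p where "p = (2 :: nat) ^ k"
    have rp: "real p = 2 ^ k" by (simp add: p_def)
    let ?X = "PiE {1..n} (\<lambda>_. V)"
    have fX: "finite ?X" using V by (intro finite_PiE) auto
    have cX: "card ?X = v ^ n" by (simp add: card_PiE v_def)
    have neX: "?X \<noteq> {}" using cX v1 by (metis card.empty power_not_zero not_one_le_zero)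
    define N where "N \<xi> G = gnorm V (colour_class n \<xi>) E G U W" for \<xi> G
    define Z where "Z G = real v ^ v * ((\<Sum>\<xi>\<in>?X. N \<xi> G) / real (card ?X))" for G
    have cc: "colour_class n \<xi> w \<subseteq> {1..n}" for \<xi> and w :: 'v by (auto simp: colour_class_def)
    have fcc: "finite (colour_class n \<xi> w)" for \<xi> and w :: 'v by (auto simp: colour_class_def)
    have U: "U \<subseteq> V" and W: "W \<subseteq> V" using UW by auto
    have N0: "0 \<le> N \<xi> G" for \<xi> G
      unfolding N_def by (rule gnorm_nonneg) (use V fcc U W in auto)
    have Z0: "0 \<le> Z G" for G unfolding Z_def using N0 by (intro mult_nonneg_nonneg divide_nonneg_nonneg sum_nonneg) auto
    define B1 where "B1 = (2 * (2 * real n ^ v) * (4 * 2 ^ k) ^ p) ^ e * (real n ^ (v - s)) ^ p"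
    have mom: "(\<Sum>G\<in>Pow (pairs n). N \<xi> G ^ (2 * p)) \<le> 2 ^ card (pairs n) * B1" for \<xi>
    proof -
      have "(\<Sum>G\<in>Pow (pairs n). N \<xi> G ^ (2 * 2 ^ k))
       \<le> 2 ^ card (pairs n) * (2 * (2 * real n ^ card V) * (4 * 2 ^ k) ^ (2 ^ k)) ^ card E
        * (real n ^ (card V - s)) ^ (2 ^ k)"
        unfolding N_def
        by (rule gnorm_moment[OF V(1) _ cc _ E UW sep]) (use n4 in \<open>auto simp: colour_class_def\<close>)
      then show ?thesis by (simp add: B1_def p_def v_def e_def mult.assoc)
    qed
    have "(\<Sum>G\<in>Pow (pairs n). Z G ^ (2 * p)) \<le> 2 ^ card (pairs n) * ((real v ^ v) ^ (2 * p) * B1)"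
    proof -
      have "(\<Sum>G\<in>Pow (pairs n). Z G ^ (2 * p))
        \<le> (\<Sum>G\<in>Pow (pairs n). (real v ^ v) ^ (2 * p) * ((\<Sum>\<xi>\<in>?X. N \<xi> G ^ (2 * p)) / real (card ?X)))"
        unfolding Z_def power_mult_distrib[of "real v ^ v"]
        by (intro sum_mono mult_left_mono power_mean_le fX neX) auto
      also have "\<dots> = (real v ^ v) ^ (2 * p) * ((\<Sum>G\<in>Pow (pairs n). \<Sum>\<xi>\<in>?X. N \<xi> G ^ (2 * p)) / real (card ?X))"
        by (simp add: sum_distrib_left sum_divide_distrib)
      also have "(\<Sum>G\<in>Pow (pairs n). \<Sum>\<xi>\<in>?X. N \<xi> G ^ (2 * p)) = (\<Sum>\<xi>\<in>?X. \<Sum>G\<in>Pow (pairs n). N \<xi> G ^ (2 * p))"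
        by (rule sum.swap)
      also have "(real v ^ v) ^ (2 * p) * ((\<Sum>\<xi>\<in>?X. \<Sum>G\<in>Pow (pairs n). N \<xi> G ^ (2 * p)) / real (card ?X))
        \<le> (real v ^ v) ^ (2 * p) * ((\<Sum>\<xi>\<in>?X. 2 ^ card (pairs n) * B1) / real (card ?X))"
        by (intro mult_left_mono divide_right_mono sum_mono mom) auto
      also have "\<dots> = 2 ^ card (pairs n) * ((real v ^ v) ^ (2 * p) * B1)"
        using neX fX by (simp add: card_eq_0_iff)
      finally show ?thesis .
    qed
    note Zmom = this
    define t where "t = K * ln (real n) ^ e * sqrt (real n ^ (v - s))"
    have n0: "real n > 0" using n4 by simp
    have t0: "0 < t" unfolding t_def using K0 ln1 n4 by (intro mult_pos_pos zero_less_power) auto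
    have iform_le: "iform n V E G U W x y \<le> Z G * L2_set x (PiE U (\<lambda>_. {1..n})) * L2_set y (PiE W (\<lambda>_. {1..n}))" for G x y
    proof -
      let ?x = "L2_set x (PiE U (\<lambda>_. {1..n}))" and ?y = "L2_set y (PiE W (\<lambda>_. {1..n}))"
      have mono: "L2_set z (PiE R (colour_class n \<xi>)) \<le> L2_set z (PiE R (\<lambda>_. {1..n}))" if "R \<subseteq> V" for R z \<xi>
      proof -
        have "finite R" using that V finite_subset by auto
        then show ?thesis unfolding L2_set_def
          by (intro real_sqrt_le_mono sum_mono2 finite_PiE) (auto simp: PiE_iff colour_class_def)
      qed
      have "real v ^ (n - v) * iform n V E G U W x y = (\<Sum>\<xi>\<in>?X. gform V (colour_class n \<xi>) E G U W x y)"
        unfolding v_def by (rule decoupling[OF V(1)])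
      also have "\<dots> \<le> (\<Sum>\<xi>\<in>?X. N \<xi> G * ?x * ?y)"
      proof (rule sum_mono)
        fix \<xi>
        have "gform V (colour_class n \<xi>) E G U W x y
          \<le> N \<xi> G * L2_set x (PiE U (colour_class n \<xi>)) * L2_set y (PiE W (colour_class n \<xi>))"
          unfolding N_def by (rule gform_le) (use V fcc U W in auto)
        also have "\<dots> \<le> N \<xi> G * ?x * ?y" using N0 by (intro mult_mono mono U W) auto
        finally show "gform V (colour_class n \<xi>) E G U W x y \<le> N \<xi> G * ?x * ?y" .
      qed
      also have "\<dots> = (\<Sum>\<xi>\<in>?X. N \<xi> G) * (?x * ?y)" by (simp add: sum_distrib_right mult.assoc)
      also have "(\<Sum>\<xi>\<in>?X. N \<xi> G) = real v ^ (n - v) * Z G"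
      proof -
        have "real v ^ n = real v ^ (n - v) * real v ^ v" using nv by (simp flip: power_add)
        then show ?thesis unfolding Z_def cX using v1 by (simp add: field_simps)
      qed
      finally have "real v ^ (n - v) * iform n V E G U W x y \<le> real v ^ (n - v) * (Z G * ?x * ?y)"
        by (simp add: mult_ac)
      then show ?thesis using v1 by (subst (asm) mult_le_cancel_left_pos) auto
    qed
    have "measure_pmf.prob (gnp n (1/2))
     {G. \<not> (\<forall>x y. iform n V E G U W x y \<le> K * ln (real n) ^ card E * sqrt (real n ^ (card V - s))
            * L2_set x (PiE U (\<lambda>_. {1..n})) * L2_set y (PiE W (\<lambda>_. {1..n})))}
       \<le> measure_pmf.prob (gnp n (1/2)) {G. t < Z G}"
    proof (rule measure_pmf.finite_measure_mono)
      show "{G. \<not> (\<forall>x y. iform n V E G U W x y \<le> K * ln (real n) ^ card E * sqrt (real n ^ (card V - s))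
            * L2_set x (PiE U (\<lambda>_. {1..n})) * L2_set y (PiE W (\<lambda>_. {1..n})))} \<subseteq> {G. t < Z G}"
      proof (rule subsetI, rule ccontr)
        fix G assume G: "G \<in> {G. \<not> (\<forall>x y. iform n V E G U W x y \<le> K * ln (real n) ^ card E * sqrt (real n ^ (card V - s))
            * L2_set x (PiE U (\<lambda>_. {1..n})) * L2_set y (PiE W (\<lambda>_. {1..n})))}" and "G \<notin> {G. t < Z G}"
        then have "Z G \<le> t" by simp
        then have "Z G * L2_set x (PiE U (\<lambda>_. {1..n})) * L2_set y (PiE W (\<lambda>_. {1..n}))
          \<le> t * L2_set x (PiE U (\<lambda>_. {1..n})) * L2_set y (PiE W (\<lambda>_. {1..n}))" for x y
          by (intro mult_right_mono) auto
        then have "iform n V E G U W x y \<le> t * L2_set x (PiE U (\<lambda>_. {1..n})) * L2_set y (PiE W (\<lambda>_. {1..n}))" for x y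
          using iform_le order_trans by blast
        then show False using G by (simp add: t_def v_def e_def)
      qed
    qed simp
    also have "\<dots> \<le> ((real v ^ v) ^ (2 * p) * B1) / t ^ (2 * p)"
      by (rule markov_Pow[OF Z0 t0 Zmom])
    also have "\<dots> \<le> 1 / real n ^ 4"
    proof -
      \<comment> \<open>The Khintchine constants enter a squared norm, so only half a power of the
        logarithm is spent per edge. Squaring once more is wasteful but gives the integral power
        \<open>ln (real n) ^ e\<close>.\<close>
      have "(4 * 2 ^ k) ^ e \<le> (8 * ln (real n)) ^ e" using k by (intro power_mono) auto
      also have "\<dots> \<le> ((8 * ln (real n)) ^ e)\<^sup>2"
        using ln1 by (intro self_le_power one_le_power) auto
      finally have L: "(4 * 2 ^ k) ^ e \<le> (8 ^ e * ln (real n) ^ e)\<^sup>2" by (simp add: power_mult_distrib)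
      have "(real v ^ v)\<^sup>2 * (4 * 2 ^ k) ^ e * exp (real \<kappa>) \<le> (real v ^ v)\<^sup>2 * (8 ^ e * ln (real n) ^ e)\<^sup>2 * (exp (real \<kappa>))\<^sup>2"
        using L by (intro mult_mono self_le_power) auto
      also have "\<dots> = (K * ln (real n) ^ e)\<^sup>2" unfolding K_def by (simp add: power_mult_distrib mult_ac)
      finally have KL: "(real v ^ v)\<^sup>2 * (4 * 2 ^ k) ^ e * exp (real \<kappa>) \<le> (K * ln (real n) ^ e)\<^sup>2" .
      have "real n ^ 4 * (4 * real n ^ v) ^ e \<le> real n ^ 4 * (real n * real n ^ v) ^ e"
        using n4 by (intro mult_left_mono power_mono mult_right_mono) auto
      also have "\<dots> = real n ^ \<kappa>" unfolding \<kappa>_def by (simp flip: power_Suc power_mult power_add add: add.commute)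
      also have "\<dots> = exp (real \<kappa> * ln (real n))" using n0 by (simp add: exp_of_nat_mult)
      also have "\<dots> \<le> exp (real \<kappa> * real p)" using k rp by (simp add: mult_left_mono)
      also have "\<dots> = exp (real \<kappa>) ^ p" by (simp add: exp_of_nat2_mult)
      finally have nk: "real n ^ 4 * (4 * real n ^ v) ^ e \<le> exp (real \<kappa>) ^ p" .
      have "real n ^ 4 * ((real v ^ v) ^ (2 * p) * B1)
        = (real n ^ 4 * (4 * real n ^ v) ^ e) * ((real v ^ v)\<^sup>2 * (4 * 2 ^ k) ^ e) ^ p * (real n ^ (v - s)) ^ p"
        unfolding B1_def by (simp add: power_mult_distrib power_mult[symmetric] mult_ac)
      also have "\<dots> \<le> exp (real \<kappa>) ^ p * ((real v ^ v)\<^sup>2 * (4 * 2 ^ k) ^ e) ^ p * (real n ^ (v - s)) ^ p"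
        by (intro mult_right_mono nk) auto
      also have "\<dots> = ((real v ^ v)\<^sup>2 * (4 * 2 ^ k) ^ e * exp (real \<kappa>)) ^ p * (real n ^ (v - s)) ^ p"
        by (simp add: power_mult_distrib mult_ac)
      also have "\<dots> \<le> ((K * ln (real n) ^ e)\<^sup>2) ^ p * (real n ^ (v - s)) ^ p"
        by (intro mult_right_mono power_mono KL) auto
      also have "\<dots> = t ^ (2 * p)"
      proof -
        have "t\<^sup>2 = (K * ln (real n) ^ e)\<^sup>2 * real n ^ (v - s)"
          unfolding t_def power_mult_distrib[of _ "sqrt _"] by simp
        then show ?thesis by (simp add: power_mult power_mult_distrib)
      qed
      finally show ?thesis using t0 n0 by (simp add: field_simps)
    qed
    finally show "measure_pmf.prob (gnp n (1/2))
     {G. \<not> (\<forall>x y. iform n V E G U W x y \<le> K * ln (real n) ^ card E * sqrt (real n ^ (card V - s))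
            * L2_set x (PiE U (\<lambda>_. {1..n})) * L2_set y (PiE W (\<lambda>_. {1..n})))} \<le> 1 / real n ^ 4" .
  qed
qed

section \<open>The templates that occur\<close>

definition dsum4 :: "nat \<Rightarrow> (nat \<Rightarrow> nat \<Rightarrow> nat \<Rightarrow> nat \<Rightarrow> real) \<Rightarrow> real" where
  "dsum4 n F = (\<Sum>k\<in>{1..n}. \<Sum>l\<in>{1..n}. \<Sum>p\<in>{1..n}. \<Sum>q\<in>{1..n}.
     if distinct [k, l, p, q] then F k l p q else 0)"

definition dsum5 :: "nat \<Rightarrow> (nat \<Rightarrow> nat \<Rightarrow> nat \<Rightarrow> nat \<Rightarrow> nat \<Rightarrow> real) \<Rightarrow> real" where
  "dsum5 n F = (\<Sum>k\<in>{1..n}. \<Sum>l\<in>{1..n}. \<Sum>p\<in>{1..n}. \<Sum>q\<in>{1..n}. \<Sum>i\<in>{1..n}.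
     if distinct [k, l, p, q, i] then F k l p q i else 0)"

definition hs_norm :: "nat \<Rightarrow> (nat \<Rightarrow> nat \<Rightarrow> real) \<Rightarrow> real" where
  "hs_norm n X = sqrt (\<Sum>k\<in>{1..n}. \<Sum>l\<in>{1..n}. (X k l)\<^sup>2)"

lemma sum_PiE_insert:
  fixes h :: "('v \<Rightarrow> 'b) \<Rightarrow> real"
  assumes "a \<notin> S"
  shows "(\<Sum>\<phi>\<in>PiE (insert a S) T. h \<phi>) = (\<Sum>y\<in>T a. \<Sum>\<phi>\<in>PiE S T. h (\<phi>(a := y)))"
proof -
  have "(\<Sum>\<phi>\<in>PiE (insert a S) T. h \<phi>) = (\<Sum>p\<in>T a \<times> PiE S T. h ((snd p)(a := fst p)))"
    unfolding PiE_insert_eq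
    by (subst sum.reindex) (use inj_combinator[OF assms] in \<open>auto simp: case_prod_beta\<close>)
  then show ?thesis by (simp add: sum.cartesian_product case_prod_beta)
qed

lemma iform_conv:
  assumes "finite V"
  shows "iform n V E G R C x y = (\<Sum>\<phi>\<in>PiE V (\<lambda>_. {1..n}). if inj_on \<phi> V
     then x (restrict \<phi> R) * y (restrict \<phi> C) * edge_prod G E \<phi> else 0)"
  unfolding iform_def inj_maps_def using assms by (intro sum.inter_filter finite_PiE) auto

lemma iform_dsum4:
  assumes "\<And>\<phi>. edge_prod G E \<phi> = P (\<phi> 0) (\<phi> 1) (\<phi> 2) (\<phi> (3::nat))"
  shows "iform n {0, 1, 2, 3} E G {0, 1} {2, 3} (\<lambda>r. X (r 0) (r 1)) (\<lambda>r. Y (r 2) (r 3))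
    = dsum4 n (\<lambda>k l p q. X k l * Y p q * P k l p q)"
  unfolding iform_conv[OF finite.insertI[OF finite.insertI[OF finite.insertI[OF finite.insertI[OF finite.emptyI]]]]] assms
  by (subst sum_PiE_insert, simp)+ (auto simp: dsum4_def inj_on_def intro!: sum.cong)

lemma iform_dsum5:
  assumes "\<And>\<phi>. edge_prod G E \<phi> = P (\<phi> 0) (\<phi> 1) (\<phi> 2) (\<phi> 3) (\<phi> (4::nat))"
  shows "iform n {0, 1, 2, 3, 4} E G {0, 1} {2, 3} (\<lambda>r. X (r 0) (r 1)) (\<lambda>r. Y (r 2) (r 3))
    = dsum5 n (\<lambda>k l p q i. X k l * Y p q * P k l p q i)"
  unfolding iform_conv[OF finite.insertI[OF finite.insertI[OF finite.insertI[OF finite.insertI[OF finite.insertI[OF finite.emptyI]]]]]] assms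
  by (subst sum_PiE_insert, simp)+ (auto simp: dsum5_def inj_on_def intro!: sum.cong)

lemma iform_gram:
  assumes "\<And>\<phi>. edge_prod G E \<phi> = P (\<phi> 0) (\<phi> 1) (\<phi> 2) (\<phi> (3::nat))"
  shows "iform n {0, 1, 2, 3} E G {0} {1} (\<lambda>r. x (r 0)) (\<lambda>r. y (r 1))
    = dsum4 n (\<lambda>k l p q. x k * y l * P k l p q)"
  unfolding iform_conv[OF finite.insertI[OF finite.insertI[OF finite.insertI[OF finite.insertI[OF finite.emptyI]]]]] assms
  by (subst sum_PiE_insert, simp)+ (auto simp: dsum4_def inj_on_def intro!: sum.cong)

lemma iform_edge:
  "iform n {0, 1 :: nat} {(0, 1)} G {0} {1} (\<lambda>r. x (r 0)) (\<lambda>r. y (r 1))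
    = (\<Sum>k\<in>{1..n}. \<Sum>l\<in>{1..n}. x k * y l * adj_sign G k l)"
  unfolding iform_conv[OF finite.insertI[OF finite.insertI[OF finite.emptyI]]] edge_prod_def
  by (subst sum_PiE_insert, simp)+ (auto simp: inj_on_def adj_sign_def intro!: sum.cong)

lemma L2_set_PiE1: "L2_set (\<lambda>r. x (r a)) (PiE {a} (\<lambda>_. {1..n})) = L2_set x {1..n}"
  unfolding L2_set_def by (subst sum_PiE_insert) auto

lemma L2_set_PiE2:
  "a \<noteq> b \<Longrightarrow> L2_set (\<lambda>r. X (r a) (r b)) (PiE {a, b} (\<lambda>_. {1..n})) = hs_norm n X"
  unfolding L2_set_def hs_norm_def by (subst sum_PiE_insert, simp)+ simp

text \<open>The exponent \<open>m\<close> of the logarithm is independent of the template, so that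
  templates with different numbers of edges can share one bound.\<close>

definition ibound :: "nat set \<Rightarrow> (nat \<times> nat) set \<Rightarrow> nat set \<Rightarrow> nat set \<Rightarrow> nat \<Rightarrow> nat \<Rightarrow> real \<Rightarrow> nat \<Rightarrow> nat set set \<Rightarrow> bool" where
  "ibound V E U W m d K n G \<longleftrightarrow> (\<forall>x y. \<bar>iform n V E G U W x y\<bar> \<le> K * ln (real n) ^ m * sqrt (real n ^ d)
      * L2_set x (PiE U (\<lambda>_. {1..n})) * L2_set y (PiE W (\<lambda>_. {1..n})))"

lemma ln_ge_1: "n \<ge> 4 \<Longrightarrow> 1 \<le> ln (real n)"
  using exp_le by (subst ln_ge_iff) auto

lemma ibound_mono:
  assumes "ibound V E U W m d K n G" "K \<le> K'" "n \<ge> 4"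
  shows "ibound V E U W m d K' n G"
  unfolding ibound_def
proof (intro allI)
  fix x y
  let ?t = "sqrt (real n ^ d) * L2_set x (PiE U (\<lambda>_. {1..n})) * L2_set y (PiE W (\<lambda>_. {1..n}))"
  have "\<bar>iform n V E G U W x y\<bar> \<le> K * (ln (real n) ^ m * ?t)"
    using assms(1) by (simp add: ibound_def mult_ac)
  also have "\<dots> \<le> K' * (ln (real n) ^ m * ?t)" using assms ln_ge_1[of n] by (intro mult_right_mono) auto
  finally show "\<bar>iform n V E G U W x y\<bar> \<le> K' * ln (real n) ^ m * sqrt (real n ^ d)
      * L2_set x (PiE U (\<lambda>_. {1..n})) * L2_set y (PiE W (\<lambda>_. {1..n}))" by (simp add: mult_ac)
qed

text \<open>The logarithm is at least 1, so its exponent may be raised from the number of edges to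
  \<open>m\<close>. With at most five vertices, \<open>n \<ge> 5\<close> meets the size condition of
  \<open>graph_matrix_norm\<close>.\<close>

lemma ibound_prob:
  assumes V: "finite V" "V \<noteq> {}" "card V \<le> 5" and E: "\<And>e. e \<in> E \<Longrightarrow> fst e \<in> V \<and> snd e \<in> V \<and> fst e < snd e"
    and UW: "U \<union> W \<union> verts E = V"
    and sep: "\<And>E1. E1 \<subseteq> E \<Longrightarrow> s \<le> card ((U \<union> verts E1) \<inter> (W \<union> verts (E - E1)))"
    and m: "card E \<le> m" and d: "d = card V - s"
  shows "\<exists>K>0. \<forall>n\<ge>5. measure_pmf.prob (gnp n (1/2)) {G. \<not> ibound V E U W m d K n G} \<le> 1 / real n ^ 4"
proof -
  have fE: "finite E" by (rule finite_subset[of _ "V \<times> V"]) (use E V in auto)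
  obtain K where K: "K > 0" "\<And>n. n \<ge> max 4 (card V) \<Longrightarrow> measure_pmf.prob (gnp n (1/2))
     {G. \<not> (\<forall>x y. iform n V E G U W x y \<le> K * ln (real n) ^ card E * sqrt (real n ^ (card V - s))
            * L2_set x (PiE U (\<lambda>_. {1..n})) * L2_set y (PiE W (\<lambda>_. {1..n})))} \<le> 1 / real n ^ 4"
    using graph_matrix_norm[OF V(1,2) fE E UW sep] by blast
  show ?thesis
  proof (intro exI[of _ K] conjI allI impI K(1))
    fix n :: nat assume n: "n \<ge> 5"
    have "{G. \<not> ibound V E U W m d K n G} \<subseteq>
      {G. \<not> (\<forall>x y. iform n V E G U W x y \<le> K * ln (real n) ^ card E * sqrt (real n ^ (card V - s))
            * L2_set x (PiE U (\<lambda>_. {1..n})) * L2_set y (PiE W (\<lambda>_. {1..n})))}"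
    proof (rule subsetI, rule ccontr)
      fix G assume G: "G \<in> {G. \<not> ibound V E U W m d K n G}" "G \<notin> {G. \<not> (\<forall>x y. iform n V E G U W x y
            \<le> K * ln (real n) ^ card E * sqrt (real n ^ (card V - s))
            * L2_set x (PiE U (\<lambda>_. {1..n})) * L2_set y (PiE W (\<lambda>_. {1..n})))}"
      have le: "iform n V E G U W x y \<le> K * ln (real n) ^ m * sqrt (real n ^ d)
            * L2_set x (PiE U (\<lambda>_. {1..n})) * L2_set y (PiE W (\<lambda>_. {1..n}))" for x y
      proof -
        let ?t = "sqrt (real n ^ d) * L2_set x (PiE U (\<lambda>_. {1..n})) * L2_set y (PiE W (\<lambda>_. {1..n}))"
        have "iform n V E G U W x y \<le> K * (ln (real n) ^ card E * ?t)"
          using G(2) unfolding d by (simp add: mult_ac)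
        also have "\<dots> \<le> K * (ln (real n) ^ m * ?t)"
          using K(1) n m ln_ge_1[of n] by (intro mult_left_mono mult_right_mono power_increasing) auto
        finally show ?thesis by (simp add: mult_ac)
      qed
      \<comment> \<open>Replacing \<open>x\<close> by its negative makes the one-sided bound
        two-sided, without a further event.\<close>
      have "- iform n V E G U W x y \<le> K * ln (real n) ^ m * sqrt (real n ^ d)
            * L2_set x (PiE U (\<lambda>_. {1..n})) * L2_set y (PiE W (\<lambda>_. {1..n}))" for x y
      proof -
        have "iform n V E G U W (\<lambda>r. - x r) y = - iform n V E G U W x y"
          unfolding iform_def by (simp add: sum_negf)
        then show ?thesis using le[of "\<lambda>r. - x r" y] by (simp add: L2_set_def)
      qed
      then have "ibound V E U W m d K n G" unfolding ibound_def using le by (auto simp: abs_le_iff)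
      then show False using G(1) by simp
    qed
    then have "measure_pmf.prob (gnp n (1/2)) {G. \<not> ibound V E U W m d K n G} \<le> measure_pmf.prob (gnp n (1/2))
      {G. \<not> (\<forall>x y. iform n V E G U W x y \<le> K * ln (real n) ^ card E * sqrt (real n ^ (card V - s))
            * L2_set x (PiE U (\<lambda>_. {1..n})) * L2_set y (PiE W (\<lambda>_. {1..n})))}"
      by (intro measure_pmf.finite_measure_mono) auto
    also have "\<dots> \<le> 1 / real n ^ 4" by (rule K(2)) (use n V in auto)
    finally show "measure_pmf.prob (gnp n (1/2)) {G. \<not> ibound V E U W m d K n G} \<le> 1 / real n ^ 4" .
  qed
qed

text \<open>A union bound. The properties are monotone in the constant, so the maximum of the
  individual constants serves all of them.\<close>

lemma prob_all_of_list:
  fixes Ps :: "(real \<Rightarrow> nat \<Rightarrow> nat set set \<Rightarrow> bool) list"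
  assumes "\<And>P. P \<in> set Ps \<Longrightarrow> \<exists>K>0. \<forall>n\<ge>5. measure_pmf.prob (gnp n (1/2)) {G. \<not> P K n G} \<le> 1 / real n ^ 4"
    and mono: "\<And>P K K' n G. P \<in> set Ps \<Longrightarrow> n \<ge> 5 \<Longrightarrow> K \<le> K' \<Longrightarrow> P K n G \<Longrightarrow> P K' n G"
  shows "\<exists>K>0. \<forall>n\<ge>5. measure_pmf.prob (gnp n (1/2)) {G. \<not> (\<forall>P\<in>set Ps. P K n G)} \<le> real (length Ps) / real n ^ 4"
  using assms
proof (induction Ps)
  case Nil
  then show ?case by (auto intro: exI[of _ 1])
next
  case (Cons P Ps)
  obtain K1 where K1: "K1 > 0" "\<And>n. n \<ge> 5 \<Longrightarrow> measure_pmf.prob (gnp n (1/2)) {G. \<not> P K1 n G} \<le> 1 / real n ^ 4"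
    using Cons.prems(1)[of P] by auto
  obtain K2 where K2: "K2 > 0" "\<And>n. n \<ge> 5 \<Longrightarrow> measure_pmf.prob (gnp n (1/2)) {G. \<not> (\<forall>P\<in>set Ps. P K2 n G)} \<le> real (length Ps) / real n ^ 4"
  proof -
    have "\<exists>K>0. \<forall>n\<ge>5. measure_pmf.prob (gnp n (1/2)) {G. \<not> (\<forall>P\<in>set Ps. P K n G)} \<le> real (length Ps) / real n ^ 4"
    proof (rule Cons.IH)
      show "\<exists>K>0. \<forall>n\<ge>5. measure_pmf.prob (gnp n (1/2)) {G. \<not> P K n G} \<le> 1 / real n ^ 4" if "P \<in> set Ps" for P
        using that by (intro Cons.prems(1)) simp
      show "P K' n G" if "P \<in> set Ps" "n \<ge> 5" "K \<le> K'" "P K n G" for P K K' n G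
        using Cons.prems(2)[of P n K K' G] that by simp
    qed
    then show ?thesis using that by blast
  qed
  show ?case
  proof (intro exI[of _ "max K1 K2"] conjI allI impI)
    show "max K1 K2 > 0" using K1 by simp
    fix n :: nat assume n: "n \<ge> 5"
    have "{G. \<not> (\<forall>Q\<in>set (P # Ps). Q (max K1 K2) n G)} \<subseteq> {G. \<not> P K1 n G} \<union> {G. \<not> (\<forall>P\<in>set Ps. P K2 n G)}"
    proof (rule subsetI, rule ccontr)
      fix G assume G: "G \<in> {G. \<not> (\<forall>Q\<in>set (P # Ps). Q (max K1 K2) n G)}"
        "G \<notin> {G. \<not> P K1 n G} \<union> {G. \<not> (\<forall>P\<in>set Ps. P K2 n G)}"
      have "Q (max K1 K2) n G" if "Q \<in> set (P # Ps)" for Q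
      proof (cases "Q = P")
        case True
        then show ?thesis using G(2) Cons.prems(2)[of P n K1 "max K1 K2" G] n by auto
      next
        case False
        then show ?thesis using that G(2) Cons.prems(2)[of Q n K2 "max K1 K2" G] n by auto
      qed
      then show False using G(1) by blast
    qed
    then have "measure_pmf.prob (gnp n (1/2)) {G. \<not> (\<forall>Q\<in>set (P # Ps). Q (max K1 K2) n G)}
      \<le> measure_pmf.prob (gnp n (1/2)) ({G. \<not> P K1 n G} \<union> {G. \<not> (\<forall>P\<in>set Ps. P K2 n G)})"
      by (intro measure_pmf.finite_measure_mono) auto
    also have "\<dots> \<le> measure_pmf.prob (gnp n (1/2)) {G. \<not> P K1 n G}
        + measure_pmf.prob (gnp n (1/2)) {G. \<not> (\<forall>P\<in>set Ps. P K2 n G)}"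
      by (rule measure_Un_le) simp_all
    also have "\<dots> \<le> 1 / real n ^ 4 + real (length Ps) / real n ^ 4"
      by (intro add_mono K1(2) K2(2) n)
    also have "\<dots> = real (length (P # Ps)) / real n ^ 4" by (simp add: add_divide_distrib)
    finally show "measure_pmf.prob (gnp n (1/2)) {G. \<not> (\<forall>Q\<in>set (P # Ps). Q (max K1 K2) n G)}
       \<le> real (length (P # Ps)) / real n ^ 4" .
  qed
qed

section \<open>Separators of the templates\<close>

lemma two_le_card: "finite S \<Longrightarrow> a \<in> S \<Longrightarrow> b \<in> S \<Longrightarrow> a \<noteq> b \<Longrightarrow> 2 \<le> card S"
  using card_mono[of S "{a, b}"] by simp

text \<open>Either side receives both ends of its edges. An edge between a row vertex and a column
  vertex therefore always puts one of its ends into the overlap.\<close>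

lemma edge_on_one_side:
  assumes "(u, v) \<in> E"
  shows "u \<in> verts E1 \<and> v \<in> verts E1 \<or> u \<in> verts (E - E1) \<and> v \<in> verts (E - E1)"
proof -
  have mem: "u \<in> verts F \<and> v \<in> verts F" if "(u, v) \<in> F" for F
    using imageI[OF that, of fst] imageI[OF that, of snd] by (simp add: verts_def)
  show ?thesis using mem[of E1] mem[of "E - E1"] assms by blast
qed

lemma finite_verts: "finite E \<Longrightarrow> finite (verts E)"
  unfolding verts_def by simp

text \<open>The four signs contributed by the two factors \<open>D\<^sub>i\<close>.\<close>

definition star5 :: "(nat \<times> nat) set" where
  "star5 = {(0, 4), (1, 4), (2, 4), (3, 4)}"

text \<open>In the templates, \<open>0, 1\<close> stand for the elements \<open>k, l\<close> of a row index, \<open>2, 3\<close> for the elements \<open>p, q\<close> of a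
  column index and \<open>4\<close> for the index \<open>i\<close> of \<open>D\<^sub>i\<close>; the second template is that of the Gram matrix, with
  \<open>0, 1\<close> for the two vectors. By symmetry in \<open>k, l\<close> and in \<open>p, q\<close> these are all the subgraphs of the
  4-cycle that are needed.\<close>

definition good :: "real \<Rightarrow> nat \<Rightarrow> nat set set \<Rightarrow> bool" where
  "good K n G \<longleftrightarrow> (\<forall>P\<in>set (
      [ibound {0, 1} {(0, 1)} {0} {1} 1 1,
       ibound {0, 1, 2, 3} {(0, 2), (0, 3), (1, 2), (1, 3)} {0} {1} 8 3] @
      map (\<lambda>E. ibound {0, 1, 2, 3} E {0, 1} {2, 3} 8 2)
        [{(0, 2), (1, 3)}, {(0, 2), (0, 3), (1, 3)}, {(0, 2), (0, 3), (1, 2), (1, 3)}] @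
      map (\<lambda>E. ibound {0, 1, 2, 3, 4} (E \<union> star5) {0, 1} {2, 3} 8 3)
        [{(0, 2)}, {(0, 2), (0, 3)}, {(0, 2), (1, 3)}, {(0, 2), (0, 3), (1, 3)}, {(0, 2), (0, 3), (1, 2), (1, 3)}]).
     P K n G)"

text \<open>Two disjoint edges from rows to columns put two different vertices into the overlap, as
  in Menger's theorem; this leaves the exponent 4 - 2.\<close>

lemma ibound4_prob:
  assumes E: "{(0, 2), (1, 3)} \<subseteq> E" "E \<subseteq> {(0, 2), (0, 3), (1, 2), (1, 3)}"
  shows "\<exists>K>0. \<forall>n\<ge>5. measure_pmf.prob (gnp n (1/2)) {G. \<not> ibound {0, 1, 2, 3} E {0, 1} {2, 3} 8 2 K n G} \<le> 1 / real n ^ 4"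
proof (rule ibound_prob[where s = 2])
  have fE: "finite E" using finite_subset[OF E(2)] by simp
  show "fst e \<in> {0, 1, 2, 3} \<and> snd e \<in> {0, 1, 2, 3} \<and> fst e < snd e" if "e \<in> E" for e
    using that E(2) by auto
  show "{0, 1} \<union> {2, 3} \<union> verts E = {0, 1, 2, 3}" using E(2) unfolding verts_def by auto
  have "card E \<le> card {(0::nat, 2::nat), (0, 3), (1, 2), (1, 3)}" using E(2) by (intro card_mono) auto
  then show "card E \<le> 8" by simp
  fix E1 assume "E1 \<subseteq> E"
  then have fin: "finite (({0, 1} \<union> verts E1) \<inter> ({2, 3} \<union> verts (E - E1)))"
    using finite_subset[OF _ fE] by (simp add: finite_verts fE)
  have 1: "0 \<in> verts E1 \<and> 2 \<in> verts E1 \<or> 0 \<in> verts (E - E1) \<and> 2 \<in> verts (E - E1)"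
    using E(1) by (intro edge_on_one_side) auto
  have 2: "1 \<in> verts E1 \<and> 3 \<in> verts E1 \<or> 1 \<in> verts (E - E1) \<and> 3 \<in> verts (E - E1)"
    using E(1) by (intro edge_on_one_side) auto
  obtain a b where "a \<in> {0, 2}" "b \<in> {1, 3}" "a \<in> ({0, 1} \<union> verts E1) \<inter> ({2, 3} \<union> verts (E - E1))"
    "b \<in> ({0, 1} \<union> verts E1) \<inter> ({2, 3} \<union> verts (E - E1))"
    using 1 2 by auto
  moreover from this have "a \<noteq> b" by auto
  ultimately show "2 \<le> card (({0, 1} \<union> verts E1) \<inter> ({2, 3} \<union> verts (E - E1)))"
    by (intro two_le_card[OF fin, of a b])
qed simp_all

text \<open>The edge (0, 2) provides one vertex of the overlap. Either the centre 4 is a second one,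
  or all star edges lie on one side, and then both column vertices or both row vertices belong to
  the overlap. This leaves the exponent 5 - 2.\<close>

lemma ibound5_prob:
  assumes E: "(0, 2) \<in> E" "E \<subseteq> {(0, 2), (0, 3), (1, 2), (1, 3)}"
  shows "\<exists>K>0. \<forall>n\<ge>5. measure_pmf.prob (gnp n (1/2)) {G. \<not> ibound {0, 1, 2, 3, 4} (E \<union> star5) {0, 1} {2, 3} 8 3 K n G} \<le> 1 / real n ^ 4"
proof (rule ibound_prob[where s = 2])
  have fE: "finite (E \<union> star5)" using finite_subset[OF E(2)] unfolding star5_def by simp
  show "fst e \<in> {0, 1, 2, 3, 4} \<and> snd e \<in> {0, 1, 2, 3, 4} \<and> fst e < snd e" if "e \<in> E \<union> star5" for e
    using that E(2) unfolding star5_def by auto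
  show "{0, 1} \<union> {2, 3} \<union> verts (E \<union> star5) = {0, 1, 2, 3, 4}" using E(2) unfolding verts_def star5_def by auto
  have "card (E \<union> star5) \<le> card ({(0::nat, 2::nat), (0, 3), (1, 2), (1, 3)} \<union> star5)"
    using E(2) by (intro card_mono) (auto simp: star5_def)
  then show "card (E \<union> star5) \<le> 8" by (simp add: star5_def)
  fix E1 assume "E1 \<subseteq> E \<union> star5"
  define S where "S = ({0, 1} \<union> verts E1) \<inter> ({2, 3} \<union> verts (E \<union> star5 - E1))"
  have fin: "finite S"
    unfolding S_def using finite_subset[OF \<open>E1 \<subseteq> E \<union> star5\<close> fE] by (simp add: finite_verts)
  have side: "u \<in> verts E1 \<and> v \<in> verts E1 \<or> u \<in> verts (E \<union> star5 - E1) \<and> v \<in> verts (E \<union> star5 - E1)"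
    if "(u, v) \<in> E \<union> star5" for u v by (rule edge_on_one_side[OF that])
  have 02: "0 \<in> S \<or> 2 \<in> S" using side[of 0 2] E(1) unfolding S_def by auto
  have "4 \<in> S \<or> (0 \<in> S \<and> 1 \<in> S) \<or> (2 \<in> S \<and> 3 \<in> S)"
    using side[of 0 4] side[of 1 4] side[of 2 4] side[of 3 4] unfolding S_def star5_def by auto
  then have "2 \<le> card S"
    using 02 two_le_card[OF fin, of 0 4] two_le_card[OF fin, of 2 4] two_le_card[OF fin, of 0 1]
      two_le_card[OF fin, of 2 3] by auto
  then show "2 \<le> card (({0, 1} \<union> verts E1) \<inter> ({2, 3} \<union> verts (E \<union> star5 - E1)))"
    unfolding S_def .
qed simp_all

text \<open>A union bound over 2 + 3 + 5 = 10 templates.\<close>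

lemma good_prob:
  "\<exists>K>0. \<forall>n\<ge>5. measure_pmf.prob (gnp n (1/2)) {G. \<not> good K n G} \<le> 10 / real n ^ 4"
proof -
  let ?L4 = "[{(0, 2), (1, 3)}, {(0, 2), (0, 3), (1, 3)}, {(0, 2), (0, 3), (1, 2), (1, 3)}] :: (nat \<times> nat) set list"
  let ?L5 = "[{(0, 2)}, {(0, 2), (0, 3)}, {(0, 2), (1, 3)}, {(0, 2), (0, 3), (1, 3)}, {(0, 2), (0, 3), (1, 2), (1, 3)}] :: (nat \<times> nat) set list"
  let ?Ps = "[ibound {0, 1} {(0, 1)} {0} {1} 1 1,
       ibound {0, 1, 2, 3} {(0, 2), (0, 3), (1, 2), (1, 3)} {0} {1} 8 3] @
      map (\<lambda>E. ibound {0, 1, 2, 3} E {0, 1} {2, 3} 8 2)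
        [{(0, 2), (1, 3)}, {(0, 2), (0, 3), (1, 3)}, {(0, 2), (0, 3), (1, 2), (1, 3)}] @
      map (\<lambda>E. ibound {0, 1, 2, 3, 4} (E \<union> star5) {0, 1} {2, 3} 8 3)
        [{(0, 2)}, {(0, 2), (0, 3)}, {(0, 2), (1, 3)}, {(0, 2), (0, 3), (1, 3)}, {(0, 2), (0, 3), (1, 2), (1, 3)}]"
  have p1: "\<exists>K>0. \<forall>n\<ge>5. measure_pmf.prob (gnp n (1/2)) {G. \<not> ibound {0, 1} {(0, 1)} {0} {1} 1 1 K n G} \<le> 1 / real n ^ 4"
  proof (rule ibound_prob[where s = 1])
    fix E1 :: "(nat \<times> nat) set" assume E1: "E1 \<subseteq> {(0, 1)}"
    let ?S = "({0} \<union> verts E1) \<inter> ({1} \<union> verts ({(0, 1)} - E1))"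
    have "finite ?S" using finite_subset[OF E1] by (simp add: finite_verts)
    moreover have "?S \<noteq> {}" using edge_on_one_side[of 0 1 "{(0, 1)}" E1] by auto
    ultimately show "1 \<le> card ?S" by (metis One_nat_def Suc_leI card_gt_0_iff)
  qed (simp_all add: verts_def insert_commute, (elim disjE; simp)?)
  have p2: "\<exists>K>0. \<forall>n\<ge>5. measure_pmf.prob (gnp n (1/2)) {G. \<not> ibound {0, 1, 2, 3} {(0, 2), (0, 3), (1, 2), (1, 3)} {0} {1} 8 3 K n G} \<le> 1 / real n ^ 4"
  proof (rule ibound_prob[where s = 1])
    let ?E = "{(0, 2), (0, 3), (1, 2), (1, 3)} :: (nat \<times> nat) set"
    fix E1 :: "(nat \<times> nat) set" assume E1: "E1 \<subseteq> ?E"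
    let ?S = "({0} \<union> verts E1) \<inter> ({1} \<union> verts (?E - E1))"
    have "finite ?S" using finite_subset[OF E1] by (simp add: finite_verts)
    \<comment> \<open>The path 0 - 2 - 1 already joins the row vertex 0 to the column vertex 1, so
      some vertex of it lies on both sides.\<close>
    moreover have "?S \<noteq> {}"
      using edge_on_one_side[of 0 2 ?E E1] edge_on_one_side[of 1 2 ?E E1] by auto
    ultimately show "1 \<le> card ?S" by (metis One_nat_def Suc_leI card_gt_0_iff)
  qed (simp_all add: verts_def insert_commute, (elim disjE; simp)?)
  have "\<exists>K>0. \<forall>n\<ge>5. measure_pmf.prob (gnp n (1/2)) {G. \<not> (\<forall>P\<in>set ?Ps. P K n G)} \<le> real (length ?Ps) / real n ^ 4"
  proof (rule prob_all_of_list)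
    fix P assume "P \<in> set ?Ps"
    then have "P = ibound {0, 1} {(0, 1)} {0} {1} 1 1
      \<or> P = ibound {0, 1, 2, 3} {(0, 2), (0, 3), (1, 2), (1, 3)} {0} {1} 8 3
      \<or> (\<exists>E\<in>set ?L4. P = ibound {0, 1, 2, 3} E {0, 1} {2, 3} 8 2)
      \<or> (\<exists>E\<in>set ?L5. P = ibound {0, 1, 2, 3, 4} (E \<union> star5) {0, 1} {2, 3} 8 3)"
      by (simp only: set_append set_map Un_iff image_iff) simp
    moreover have "{(0, 2), (1, 3)} \<subseteq> E \<and> E \<subseteq> {(0, 2), (0, 3), (1, 2), (1, 3)}" if "E \<in> set ?L4" for E
      using that by auto
    moreover have "(0, 2) \<in> E \<and> E \<subseteq> {(0, 2), (0, 3), (1, 2), (1, 3)}" if "E \<in> set ?L5" for E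
      using that by auto
    ultimately show "\<exists>K>0. \<forall>n\<ge>5. measure_pmf.prob (gnp n (1/2)) {G. \<not> P K n G} \<le> 1 / real n ^ 4"
      using p1 p2 ibound4_prob ibound5_prob by metis
  next
    fix P K K' n G assume "P \<in> set ?Ps" "n \<ge> 5" "K \<le> K'" "P K n G"
    then show "P K' n G" using ibound_mono[where n = n and K = K and K' = K'] by auto
  qed
  then show ?thesis unfolding good_def by simp
qed

section \<open>Sums over distinct indices\<close>

lemma goodD:
  assumes "good K n G"
  defines "A \<equiv> adj_sign G"
  shows good_edge: "\<And>x y. \<bar>\<Sum>k\<in>{1..n}. \<Sum>l\<in>{1..n}. x k * y l * A k l\<bar>
      \<le> K * ln (real n) * sqrt (real n) * L2_set x {1..n} * L2_set y {1..n}"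
    and good_gram: "\<And>x y. \<bar>dsum4 n (\<lambda>i j k l. x i * y j * (A i k * A i l * A j k * A j l))\<bar>
      \<le> K * ln (real n) ^ 8 * sqrt (real n ^ 3) * L2_set x {1..n} * L2_set y {1..n}"
    and good4_ad: "\<And>X Y. \<bar>dsum4 n (\<lambda>k l p q. X k l * Y p q * (A k p * A l q))\<bar>
      \<le> K * ln (real n) ^ 8 * real n * hs_norm n X * hs_norm n Y"
    and good4_abd: "\<And>X Y. \<bar>dsum4 n (\<lambda>k l p q. X k l * Y p q * (A k p * A k q * A l q))\<bar>
      \<le> K * ln (real n) ^ 8 * real n * hs_norm n X * hs_norm n Y"
    and good4_abcd: "\<And>X Y. \<bar>dsum4 n (\<lambda>k l p q. X k l * Y p q * (A k p * A k q * A l p * A l q))\<bar>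
      \<le> K * ln (real n) ^ 8 * real n * hs_norm n X * hs_norm n Y"
    and good5_a: "\<And>X Y. \<bar>dsum5 n (\<lambda>k l p q i. X k l * Y p q * (A k p * (A k i * A l i * A p i * A q i)))\<bar>
      \<le> K * ln (real n) ^ 8 * sqrt (real n ^ 3) * hs_norm n X * hs_norm n Y"
    and good5_ab: "\<And>X Y. \<bar>dsum5 n (\<lambda>k l p q i. X k l * Y p q * (A k p * A k q * (A k i * A l i * A p i * A q i)))\<bar>
      \<le> K * ln (real n) ^ 8 * sqrt (real n ^ 3) * hs_norm n X * hs_norm n Y"
    and good5_ad: "\<And>X Y. \<bar>dsum5 n (\<lambda>k l p q i. X k l * Y p q * (A k p * A l q * (A k i * A l i * A p i * A q i)))\<bar>
      \<le> K * ln (real n) ^ 8 * sqrt (real n ^ 3) * hs_norm n X * hs_norm n Y"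
    and good5_abd: "\<And>X Y. \<bar>dsum5 n (\<lambda>k l p q i. X k l * Y p q * (A k p * A k q * A l q * (A k i * A l i * A p i * A q i)))\<bar>
      \<le> K * ln (real n) ^ 8 * sqrt (real n ^ 3) * hs_norm n X * hs_norm n Y"
    and good5_abcd: "\<And>X Y. \<bar>dsum5 n (\<lambda>k l p q i. X k l * Y p q * (A k p * A k q * A l p * A l q * (A k i * A l i * A p i * A q i)))\<bar>
      \<le> K * ln (real n) ^ 8 * sqrt (real n ^ 3) * hs_norm n X * hs_norm n Y"
proof -
  fix x y :: "nat \<Rightarrow> real"
  have "ibound {0, 1} {(0, 1)} {0} {1} 1 1 K n G" using assms(1) unfolding good_def by simp
  then have "\<bar>iform n {0, 1 :: nat} {(0, 1)} G {0} {1} (\<lambda>r. x (r 0)) (\<lambda>r. y (r 1))\<bar> \<le> K * ln (real n) ^ 1 * sqrt (real n ^ 1)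
      * L2_set (\<lambda>r. x (r 0)) (PiE {0 :: nat} (\<lambda>_. {1..n})) * L2_set (\<lambda>r. y (r 1)) (PiE {1 :: nat} (\<lambda>_. {1..n}))"
    unfolding ibound_def by blast
  then show "\<bar>\<Sum>k\<in>{1..n}. \<Sum>l\<in>{1..n}. x k * y l * A k l\<bar>
      \<le> K * ln (real n) * sqrt (real n) * L2_set x {1..n} * L2_set y {1..n}"
    unfolding iform_edge L2_set_PiE1 A_def by simp
  have "ibound {0, 1, 2, 3} {(0, 2), (0, 3), (1, 2), (1, 3)} {0} {1} 8 3 K n G"
    using assms(1) unfolding good_def by simp
  then have "\<bar>iform n {0, 1, 2, 3 :: nat} {(0, 2), (0, 3), (1, 2), (1, 3)} G {0} {1} (\<lambda>r. x (r 0)) (\<lambda>r. y (r 1))\<bar>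
      \<le> K * ln (real n) ^ 8 * sqrt (real n ^ 3)
      * L2_set (\<lambda>r. x (r 0)) (PiE {0 :: nat} (\<lambda>_. {1..n})) * L2_set (\<lambda>r. y (r 1)) (PiE {1 :: nat} (\<lambda>_. {1..n}))"
    unfolding ibound_def by blast
  moreover have ep: "edge_prod G {(0, 2), (0, 3), (1, 2), (1, 3)} \<phi> =
      A (\<phi> 0) (\<phi> 2) * A (\<phi> 0) (\<phi> 3) * A (\<phi> 1) (\<phi> 2) * A (\<phi> 1) (\<phi> (3 :: nat))" for \<phi>
    unfolding edge_prod_def A_def by simp
  ultimately show "\<bar>dsum4 n (\<lambda>i j k l. x i * y j * (A i k * A i l * A j k * A j l))\<bar>
      \<le> K * ln (real n) ^ 8 * sqrt (real n ^ 3) * L2_set x {1..n} * L2_set y {1..n}"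
    unfolding L2_set_PiE1 iform_gram[where E = "{(0, 2), (0, 3), (1, 2), (1, 3)}" and G = G
        and P = "\<lambda>i j k l. A i k * A i l * A j k * A j l", OF ep] by simp
next
  fix X Y :: "nat \<Rightarrow> nat \<Rightarrow> real"
  have nrm: "L2_set (\<lambda>r. X (r 0) (r 1)) (PiE {0, 1 :: nat} (\<lambda>_. {1..n})) = hs_norm n X"
    "L2_set (\<lambda>r. Y (r 2) (r 3)) (PiE {2, 3 :: nat} (\<lambda>_. {1..n})) = hs_norm n Y"
    by (rule L2_set_PiE2, simp)+
  have gen4: "\<bar>dsum4 n (\<lambda>k l p q. X k l * Y p q * P k l p q)\<bar> \<le> K * ln (real n) ^ 8 * real n * hs_norm n X * hs_norm n Y"
    if "ibound {0, 1, 2, 3} E {0, 1} {2, 3} 8 2 K n G"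
      "\<And>\<phi>. edge_prod G E \<phi> = P (\<phi> 0) (\<phi> 1) (\<phi> 2) (\<phi> (3::nat))" for E P
  proof -
    have "\<bar>iform n {0, 1, 2, 3 :: nat} E G {0, 1} {2, 3} (\<lambda>r. X (r 0) (r 1)) (\<lambda>r. Y (r 2) (r 3))\<bar>
      \<le> K * ln (real n) ^ 8 * sqrt (real n ^ 2)
       * L2_set (\<lambda>r. X (r 0) (r 1)) (PiE {0, 1 :: nat} (\<lambda>_. {1..n})) * L2_set (\<lambda>r. Y (r 2) (r 3)) (PiE {2, 3 :: nat} (\<lambda>_. {1..n}))"
      using that(1) unfolding ibound_def by blast
    then show ?thesis unfolding iform_dsum4[OF that(2)] nrm by simp
  qed
  have gen5: "\<bar>dsum5 n (\<lambda>k l p q i. X k l * Y p q * P k l p q i)\<bar> \<le> K * ln (real n) ^ 8 * sqrt (real n ^ 3) * hs_norm n X * hs_norm n Y"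
    if "ibound {0, 1, 2, 3, 4} E {0, 1} {2, 3} 8 3 K n G"
      "\<And>\<phi>. edge_prod G E \<phi> = P (\<phi> 0) (\<phi> 1) (\<phi> 2) (\<phi> 3) (\<phi> (4::nat))" for E P
  proof -
    have "\<bar>iform n {0, 1, 2, 3, 4 :: nat} E G {0, 1} {2, 3} (\<lambda>r. X (r 0) (r 1)) (\<lambda>r. Y (r 2) (r 3))\<bar>
      \<le> K * ln (real n) ^ 8 * sqrt (real n ^ 3)
       * L2_set (\<lambda>r. X (r 0) (r 1)) (PiE {0, 1 :: nat} (\<lambda>_. {1..n})) * L2_set (\<lambda>r. Y (r 2) (r 3)) (PiE {2, 3 :: nat} (\<lambda>_. {1..n}))"
      using that(1) unfolding ibound_def by blast
    then show ?thesis unfolding iform_dsum5[OF that(2)] nrm .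
  qed
  have g4: "ibound {0, 1, 2, 3} {(0, 2), (1, 3)} {0, 1} {2, 3} 8 2 K n G"
    "ibound {0, 1, 2, 3} {(0, 2), (0, 3), (1, 3)} {0, 1} {2, 3} 8 2 K n G"
    "ibound {0, 1, 2, 3} {(0, 2), (0, 3), (1, 2), (1, 3)} {0, 1} {2, 3} 8 2 K n G"
    using assms(1) unfolding good_def by simp_all
  have g5: "ibound {0, 1, 2, 3, 4} ({(0, 2)} \<union> star5) {0, 1} {2, 3} 8 3 K n G"
    "ibound {0, 1, 2, 3, 4} ({(0, 2), (0, 3)} \<union> star5) {0, 1} {2, 3} 8 3 K n G"
    "ibound {0, 1, 2, 3, 4} ({(0, 2), (1, 3)} \<union> star5) {0, 1} {2, 3} 8 3 K n G"
    "ibound {0, 1, 2, 3, 4} ({(0, 2), (0, 3), (1, 3)} \<union> star5) {0, 1} {2, 3} 8 3 K n G"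
    "ibound {0, 1, 2, 3, 4} ({(0, 2), (0, 3), (1, 2), (1, 3)} \<union> star5) {0, 1} {2, 3} 8 3 K n G"
    using assms(1) unfolding good_def by simp_all
  show "\<bar>dsum4 n (\<lambda>k l p q. X k l * Y p q * (A k p * A l q))\<bar>
      \<le> K * ln (real n) ^ 8 * real n * hs_norm n X * hs_norm n Y"
    by (rule gen4[OF g4(1)]) (simp add: edge_prod_def A_def)
  show "\<bar>dsum4 n (\<lambda>k l p q. X k l * Y p q * (A k p * A k q * A l q))\<bar>
      \<le> K * ln (real n) ^ 8 * real n * hs_norm n X * hs_norm n Y"
    by (rule gen4[OF g4(2)]) (simp add: edge_prod_def A_def)
  show "\<bar>dsum4 n (\<lambda>k l p q. X k l * Y p q * (A k p * A k q * A l p * A l q))\<bar>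
      \<le> K * ln (real n) ^ 8 * real n * hs_norm n X * hs_norm n Y"
    by (rule gen4[OF g4(3)]) (simp add: edge_prod_def A_def)
  show "\<bar>dsum5 n (\<lambda>k l p q i. X k l * Y p q * (A k p * (A k i * A l i * A p i * A q i)))\<bar>
      \<le> K * ln (real n) ^ 8 * sqrt (real n ^ 3) * hs_norm n X * hs_norm n Y"
    by (rule gen5[OF g5(1)]) (simp add: edge_prod_def A_def star5_def)
  show "\<bar>dsum5 n (\<lambda>k l p q i. X k l * Y p q * (A k p * A k q * (A k i * A l i * A p i * A q i)))\<bar>
      \<le> K * ln (real n) ^ 8 * sqrt (real n ^ 3) * hs_norm n X * hs_norm n Y"
    by (rule gen5[OF g5(2)]) (simp add: edge_prod_def A_def star5_def)
  show "\<bar>dsum5 n (\<lambda>k l p q i. X k l * Y p q * (A k p * A l q * (A k i * A l i * A p i * A q i)))\<bar>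
      \<le> K * ln (real n) ^ 8 * sqrt (real n ^ 3) * hs_norm n X * hs_norm n Y"
    by (rule gen5[OF g5(3)]) (simp add: edge_prod_def A_def star5_def)
  show "\<bar>dsum5 n (\<lambda>k l p q i. X k l * Y p q * (A k p * A k q * A l q * (A k i * A l i * A p i * A q i)))\<bar>
      \<le> K * ln (real n) ^ 8 * sqrt (real n ^ 3) * hs_norm n X * hs_norm n Y"
    by (rule gen5[OF g5(4)]) (simp add: edge_prod_def A_def star5_def)
  show "\<bar>dsum5 n (\<lambda>k l p q i. X k l * Y p q * (A k p * A k q * A l p * A l q * (A k i * A l i * A p i * A q i)))\<bar>
      \<le> K * ln (real n) ^ 8 * sqrt (real n ^ 3) * hs_norm n X * hs_norm n Y"
    by (rule gen5[OF g5(5)]) (simp add: edge_prod_def A_def star5_def)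
qed

section \<open>Symmetries of sums over distinct indices, and the Hilbert-Schmidt norm\<close>

lemma dsum4_add: "dsum4 n (\<lambda>k l p q. F k l p q + H k l p q) = dsum4 n F + dsum4 n H"
  unfolding dsum4_def sum.distrib[symmetric] by (intro sum.cong refl) simp

lemma dsum4_scale: "dsum4 n (\<lambda>k l p q. s * F k l p q) = s * dsum4 n F"
  unfolding dsum4_def sum_distrib_left by (intro sum.cong refl) simp

lemma dsum4_cong:
  assumes "\<And>k l p q. distinct [k, l, p, q] \<Longrightarrow> F k l p q = H k l p q"
  shows "dsum4 n F = dsum4 n H"
  unfolding dsum4_def using assms by (intro sum.cong refl if_cong) auto

lemma dsum4_swap_left: "dsum4 n (\<lambda>k l p q. F l k p q) = dsum4 n F"
  unfolding dsum4_def by (subst sum.swap) (intro sum.cong refl if_cong, auto)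

lemma dsum4_swap_right: "dsum4 n (\<lambda>k l p q. F k l q p) = dsum4 n F"
  unfolding dsum4_def
  by (rule sum.cong[OF refl], rule sum.cong[OF refl], subst sum.swap) (intro sum.cong refl if_cong, auto)

lemma dsum4_swap_mid: "dsum4 n (\<lambda>k l p q. F k p l q) = dsum4 n F"
  unfolding dsum4_def
  by (rule sum.cong[OF refl], subst sum.swap) (intro sum.cong refl if_cong, auto)

lemma dsum4_swap_pairs: "dsum4 n (\<lambda>k l p q. F p q k l) = dsum4 n F"
proof -
  have "dsum4 n (\<lambda>k l p q. F p q k l) = dsum4 n (\<lambda>k l p q. F l q k p)" by (rule dsum4_swap_mid[symmetric])
  also have "\<dots> = dsum4 n (\<lambda>k l p q. F k q l p)" by (rule dsum4_swap_left[symmetric])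
  also have "\<dots> = dsum4 n (\<lambda>k l p q. F k p l q)" by (rule dsum4_swap_right[symmetric])
  also have "\<dots> = dsum4 n F" by (rule dsum4_swap_mid)
  finally show ?thesis .
qed

lemma dsum5_conv: "dsum5 n F = dsum4 n (\<lambda>k l p q. \<Sum>i\<in>{1..n}. if i \<notin> {k, l, p, q} then F k l p q i else 0)"
  unfolding dsum5_def dsum4_def
  by (intro sum.cong refl) (auto intro!: sum.neutral sum.cong)

lemma sum_sq_eq_hs: "(\<Sum>k\<in>{1..n}. \<Sum>l\<in>{1..n}. (X k l)\<^sup>2) = (hs_norm n X)\<^sup>2"
  unfolding hs_norm_def by (simp add: sum_nonneg)

lemma hs_norm_nonneg: "0 \<le> hs_norm n X"
  unfolding hs_norm_def by (simp add: sum_nonneg)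

lemma hs_cauchy_schwarz:
  "\<bar>\<Sum>k\<in>{1..n}. \<Sum>l\<in>{1..n}. X k l * Y k l\<bar> \<le> hs_norm n X * hs_norm n Y"
proof -
  let ?I = "{1..n} \<times> {1..n}"
  have "\<bar>\<Sum>k\<in>{1..n}. \<Sum>l\<in>{1..n}. X k l * Y k l\<bar> = \<bar>\<Sum>p\<in>?I. X (fst p) (snd p) * Y (fst p) (snd p)\<bar>"
    by (simp add: sum.cartesian_product case_prod_beta)
  also have "\<dots> \<le> (\<Sum>p\<in>?I. \<bar>X (fst p) (snd p)\<bar> * \<bar>Y (fst p) (snd p)\<bar>)"
    by (rule order_trans[OF sum_abs]) (simp add: abs_mult)
  also have "\<dots> \<le> L2_set (\<lambda>p. X (fst p) (snd p)) ?I * L2_set (\<lambda>p. Y (fst p) (snd p)) ?I"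
    by (rule L2_set_mult_ineq)
  also have "\<dots> = hs_norm n X * hs_norm n Y"
    unfolding L2_set_def hs_norm_def by (simp add: sum.cartesian_product case_prod_beta)
  finally show ?thesis .
qed

lemma hs_norm_mono:
  assumes "\<And>k l. \<bar>X k l\<bar> \<le> \<bar>Y k l\<bar>"
  shows "hs_norm n X \<le> hs_norm n Y"
  unfolding hs_norm_def using assms by (intro real_sqrt_le_mono sum_mono) (simp add: abs_le_square_iff)

lemma hs_norm_transpose: "hs_norm n (\<lambda>k l. X l k) = hs_norm n X"
  unfolding hs_norm_def by (subst sum.swap) simp

text \<open>For fixed \<open>k\<close> and \<open>p\<close> the free indices \<open>l\<close>,
  \<open>q\<close> run over neighbours of \<open>k\<close> and \<open>p\<close>. Excluding
  \<open>l = p\<close> and \<open>q = k\<close> corrects the two degrees, excluding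
  \<open>l = q\<close> subtracts a diagonal sum; the other coincidences vanish since
  \<open>X\<close> is zero on the diagonal.\<close>

lemma dsum4_edge:
  fixes X A :: "nat \<Rightarrow> nat \<Rightarrow> real" and n :: nat
  assumes X: "\<And>k. X k k = 0" and A: "\<And>k. A k k = 0"
  defines "d \<equiv> \<lambda>k. \<Sum>l\<in>{1..n}. X k l"
  shows "dsum4 n (\<lambda>k l p q. X k l * X p q * A k p) =
    (\<Sum>k\<in>{1..n}. \<Sum>p\<in>{1..n}. A k p * ((d k - X k p) * (d p - X p k) - (\<Sum>l\<in>{1..n}. X k l * X p l)))"
proof -
  have "dsum4 n (\<lambda>k l p q. X k l * X p q * A k p) = (\<Sum>k\<in>{1..n}. \<Sum>p\<in>{1..n}. \<Sum>l\<in>{1..n}. \<Sum>q\<in>{1..n}.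
     if distinct [k, l, p, q] then X k l * X p q * A k p else 0)"
    unfolding dsum4_def by (intro sum.cong refl sum.swap)
  also have "\<dots> = (\<Sum>k\<in>{1..n}. \<Sum>p\<in>{1..n}. A k p * ((d k - X k p) * (d p - X p k) - (\<Sum>l\<in>{1..n}. X k l * X p l)))"
  proof (intro sum.cong refl)
    fix k p assume kp: "k \<in> {1..n}" "p \<in> {1..n}"
    show "(\<Sum>l\<in>{1..n}. \<Sum>q\<in>{1..n}. if distinct [k, l, p, q] then X k l * X p q * A k p else 0)
      = A k p * ((d k - X k p) * (d p - X p k) - (\<Sum>l\<in>{1..n}. X k l * X p l))"
    proof (cases "k = p")
      case True
      then show ?thesis using A by simp
    next
      case False
      define x where "x l = (if l = p then 0 else X k l)" for l
      define y where "y q = (if q = k then 0 else X p q)" for q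
      have "(\<Sum>l\<in>{1..n}. \<Sum>q\<in>{1..n}. if distinct [k, l, p, q] then X k l * X p q * A k p else 0)
        = (\<Sum>l\<in>{1..n}. \<Sum>q\<in>{1..n}. A k p * (x l * y q) - (if q = l then A k p * (x l * y l) else 0))"
        using False X by (intro sum.cong refl) (auto simp: x_def y_def)
      also have "\<dots> = (\<Sum>l\<in>{1..n}. \<Sum>q\<in>{1..n}. A k p * (x l * y q)) - (\<Sum>l\<in>{1..n}. A k p * (x l * y l))"
        by (simp add: sum_subtractf)
      also have "\<dots> = A k p * ((\<Sum>l\<in>{1..n}. x l) * (\<Sum>q\<in>{1..n}. y q) - (\<Sum>l\<in>{1..n}. x l * y l))"
        unfolding sum_product unfolding right_diff_distrib sum_distrib_left ..
      also have "(\<Sum>l\<in>{1..n}. x l) = d k - X k p"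
      proof -
        have "(\<Sum>l\<in>{1..n}. x l) = (\<Sum>l\<in>{1..n}. X k l - (if l = p then X k p else 0))"
          by (intro sum.cong refl) (simp add: x_def)
        then show ?thesis using kp by (simp add: sum_subtractf d_def)
      qed
      also have "(\<Sum>q\<in>{1..n}. y q) = d p - X p k"
      proof -
        have "(\<Sum>l\<in>{1..n}. y l) = (\<Sum>l\<in>{1..n}. X p l - (if l = k then X p k else 0))"
          by (intro sum.cong refl) (simp add: y_def)
        then show ?thesis using kp by (simp add: sum_subtractf d_def)
      qed
      also have "(\<Sum>l\<in>{1..n}. x l * y l) = (\<Sum>l\<in>{1..n}. X k l * X p l)"
        using X by (intro sum.cong refl) (auto simp: x_def y_def)
      finally show ?thesis .
    qed
  qed
  finally show ?thesis .
qed

text \<open>Only \<open>l\<close> is free once the path is fixed; the values \<open>l = p\<close>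
  and \<open>l = q\<close> have to be removed from the degree of \<open>k\<close>.\<close>

lemma dsum4_path:
  fixes X A :: "nat \<Rightarrow> nat \<Rightarrow> real" and n :: nat
  assumes X: "\<And>k. X k k = 0" and A: "\<And>k. A k k = 0"
  defines "d \<equiv> \<lambda>k. \<Sum>l\<in>{1..n}. X k l"
  shows "dsum4 n (\<lambda>k l p q. X k l * X p q * (A k p * A k q)) =
    (\<Sum>k\<in>{1..n}. \<Sum>p\<in>{1..n}. \<Sum>q\<in>{1..n}. X p q * A k p * A k q * (d k - X k p - X k q))"
proof -
  have "dsum4 n (\<lambda>k l p q. X k l * X p q * (A k p * A k q)) = (\<Sum>k\<in>{1..n}. \<Sum>p\<in>{1..n}. \<Sum>l\<in>{1..n}. \<Sum>q\<in>{1..n}.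
     if distinct [k, l, p, q] then X k l * X p q * (A k p * A k q) else 0)"
    unfolding dsum4_def by (intro sum.cong refl sum.swap)
  also have "\<dots> = (\<Sum>k\<in>{1..n}. \<Sum>p\<in>{1..n}. \<Sum>q\<in>{1..n}. \<Sum>l\<in>{1..n}.
     if distinct [k, l, p, q] then X k l * X p q * (A k p * A k q) else 0)"
    by (intro sum.cong refl sum.swap)
  also have "\<dots> = (\<Sum>k\<in>{1..n}. \<Sum>p\<in>{1..n}. \<Sum>q\<in>{1..n}. X p q * A k p * A k q * (d k - X k p - X k q))"
  proof (intro sum.cong refl)
    fix k p q assume kpq: "k \<in> {1..n}" "p \<in> {1..n}" "q \<in> {1..n}"
    show "(\<Sum>l\<in>{1..n}. if distinct [k, l, p, q] then X k l * X p q * (A k p * A k q) else 0)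
      = X p q * A k p * A k q * (d k - X k p - X k q)"
    proof (cases "distinct [k, p, q]")
      case False
      then show ?thesis using X A by auto
    next
      case True
      have "(\<Sum>l\<in>{1..n}. if distinct [k, l, p, q] then X k l * X p q * (A k p * A k q) else 0)
        = (\<Sum>l\<in>{1..n}. X p q * A k p * A k q * (X k l - (if l = p then X k p else 0) - (if l = q then X k q else 0)))"
        using True X by (intro sum.cong refl) auto
      also have "\<dots> = X p q * A k p * A k q * (\<Sum>l\<in>{1..n}. X k l - (if l = p then X k p else 0) - (if l = q then X k q else 0))"
        by (simp add: sum_distrib_left)
      also have "\<dots> = X p q * A k p * A k q * (d k - X k p - X k q)"
        using kpq by (simp add: sum_subtractf d_def)
      finally show ?thesis .
    qed
  qed
  finally show ?thesis .
qed

text \<open>Testing the bilinear bound with the image vector itself and cancelling one factor of its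
  length.\<close>

lemma mat_vec_bound:
  fixes A :: "nat \<Rightarrow> nat \<Rightarrow> real"
  assumes nrm: "\<And>x y. \<bar>\<Sum>k\<in>{1..n}. \<Sum>l\<in>{1..n}. x k * y l * A k l\<bar> \<le> B * L2_set x {1..n} * L2_set y {1..n}"
    and B: "0 \<le> B"
  shows "L2_set (\<lambda>k. \<Sum>l\<in>{1..n}. A k l * v l) {1..n} \<le> B * L2_set v {1..n}"
proof -
  define w where "w = (\<lambda>k. \<Sum>l\<in>{1..n}. A k l * v l)"
  have "(L2_set w {1..n})\<^sup>2 = (\<Sum>k\<in>{1..n}. \<Sum>l\<in>{1..n}. w k * v l * A k l)"
    unfolding L2_set_power2 unfolding power2_eq_square
    by (intro sum.cong refl, subst (2) w_def) (simp add: sum_distrib_left mult_ac)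
  also have "\<dots> \<le> B * L2_set w {1..n} * L2_set v {1..n}" using nrm[of w v] by linarith
  finally have 1: "L2_set w {1..n} * L2_set w {1..n} \<le> (B * L2_set v {1..n}) * L2_set w {1..n}"
    by (simp add: power2_eq_square mult_ac)
  have "L2_set w {1..n} \<le> B * L2_set v {1..n}"
  proof (cases "L2_set w {1..n} = 0")
    case True
    then show ?thesis using B by simp
  next
    case False
    then have "0 < L2_set w {1..n}" by (simp add: less_le)
    then show ?thesis using 1 by (rule mult_right_le_imp_le[rotated])
  qed
  then show ?thesis unfolding w_def .
qed

lemma hs_cauchy_schwarz_le:
  assumes "hs_norm n X \<le> a" "hs_norm n Y \<le> b"
  shows "\<bar>\<Sum>k\<in>{1..n}. \<Sum>l\<in>{1..n}. X k l * Y k l\<bar> \<le> a * b"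
proof (rule order_trans[OF hs_cauchy_schwarz])
  have "0 \<le> a" using assms(1) hs_norm_nonneg[of n X] by linarith
  then show "hs_norm n X * hs_norm n Y \<le> a * b" using assms hs_norm_nonneg[of n Y] by (intro mult_mono)
qed

text \<open>The main term is the form of \<open>A\<close> at the degree vector, hence at most B D^2.
  The terms that repair coincidences are entrywise products with \<open>A\<close> and are bounded by
  Cauchy-Schwarz, except the last one, where \<open>A\<close> acts on every column of
  \<open>X\<close> separately.\<close>

lemma edge_sum_bound:
  fixes X A :: "nat \<Rightarrow> nat \<Rightarrow> real" and n :: nat
  assumes X: "\<And>k. X k k = 0" "\<And>k l. X k l = X l k" and A: "\<And>k. A k k = 0" "\<And>k l. \<bar>A k l\<bar> \<le> 1"
    and nrm: "\<And>x y. \<bar>\<Sum>k\<in>{1..n}. \<Sum>l\<in>{1..n}. x k * y l * A k l\<bar> \<le> B * L2_set x {1..n} * L2_set y {1..n}"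
  defines "d \<equiv> \<lambda>k. \<Sum>l\<in>{1..n}. X k l"
  defines "D \<equiv> L2_set d {1..n}"
  shows "\<bar>dsum4 n (\<lambda>k l p q. X k l * X p q * A k p)\<bar>
    \<le> B * D\<^sup>2 + 2 * sqrt (real n) * D * hs_norm n X + (hs_norm n X)\<^sup>2 + B * (hs_norm n X)\<^sup>2"
proof -
  let ?h = "hs_norm n X"
  have dk: "(\<Sum>l\<in>{1..n}. X k l) = d k" for k by (simp add: d_def)
  define t1 where "t1 = (\<Sum>k\<in>{1..n}. \<Sum>p\<in>{1..n}. d k * d p * A k p)"
  define t2 where "t2 = (\<Sum>k\<in>{1..n}. \<Sum>p\<in>{1..n}. (A k p * d k) * X k p)"
  define t3 where "t3 = (\<Sum>k\<in>{1..n}. \<Sum>p\<in>{1..n}. (A k p * d p) * X k p)"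
  define t4 where "t4 = (\<Sum>k\<in>{1..n}. \<Sum>p\<in>{1..n}. (A k p * X k p) * X k p)"
  define t5 where "t5 = (\<Sum>k\<in>{1..n}. \<Sum>p\<in>{1..n}. \<Sum>l\<in>{1..n}. X k l * X p l * A k p)"
  have eq: "dsum4 n (\<lambda>k l p q. X k l * X p q * A k p) = t1 - t2 - t3 + t4 - t5"
  proof -
    have "dsum4 n (\<lambda>k l p q. X k l * X p q * A k p) = (\<Sum>k\<in>{1..n}. \<Sum>p\<in>{1..n}.
      d k * d p * A k p - (A k p * d k) * X k p - (A k p * d p) * X k p + (A k p * X k p) * X k p
        - (\<Sum>l\<in>{1..n}. X k l * X p l * A k p))"
      unfolding dsum4_edge[OF X(1) A(1)] dk
    proof (intro sum.cong refl)
      fix k p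
      have "A k p * (\<Sum>l\<in>{1..n}. X k l * X p l) = (\<Sum>l\<in>{1..n}. X k l * X p l * A k p)"
        by (simp add: sum_distrib_left mult_ac)
      then show "A k p * ((d k - X k p) * (d p - X p k) - (\<Sum>l\<in>{1..n}. X k l * X p l)) =
         d k * d p * A k p - (A k p * d k) * X k p - (A k p * d p) * X k p + (A k p * X k p) * X k p
        - (\<Sum>l\<in>{1..n}. X k l * X p l * A k p)"
        unfolding X(2)[of p k] by (simp add: algebra_simps)
    qed
    then show ?thesis unfolding t1_def t2_def t3_def t4_def t5_def by (simp add: sum_subtractf sum.distrib)
  qed
  have D0: "0 \<le> D" unfolding D_def by simp
  have t1: "\<bar>t1\<bar> \<le> B * D\<^sup>2" unfolding t1_def D_def using nrm[of d d] by (simp add: power2_eq_square mult_ac)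
  have hd: "hs_norm n (\<lambda>k p. d k) = sqrt (real n) * D"
    unfolding hs_norm_def D_def L2_set_def by (simp add: real_sqrt_mult[symmetric] sum_distrib_left)
  have Ad: "\<bar>A k p * y\<bar> \<le> \<bar>y\<bar>" for k p y
    using mult_right_mono[OF A(2)[of k p], of "\<bar>y\<bar>"] by (simp add: abs_mult)
  have "hs_norm n (\<lambda>k p. A k p * d k) \<le> sqrt (real n) * D"
    using hs_norm_mono[of "\<lambda>k p. A k p * d k" "\<lambda>k p. d k" n] Ad unfolding hd by simp
  then have t2: "\<bar>t2\<bar> \<le> sqrt (real n) * D * ?h"
    unfolding t2_def by (rule hs_cauchy_schwarz_le) simp
  have "hs_norm n (\<lambda>k p. A k p * d p) \<le> sqrt (real n) * D"
    using hs_norm_mono[of "\<lambda>k p. A k p * d p" "\<lambda>k p. d p" n] Ad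
    hs_norm_transpose[of n "\<lambda>k p. d k"] hd by simp
  then have t3: "\<bar>t3\<bar> \<le> sqrt (real n) * D * ?h"
    unfolding t3_def by (rule hs_cauchy_schwarz_le) simp
  have "hs_norm n (\<lambda>k p. A k p * X k p) \<le> ?h"
    by (rule hs_norm_mono) (rule Ad)
  then have t4: "\<bar>t4\<bar> \<le> ?h * ?h"
    unfolding t4_def by (rule hs_cauchy_schwarz_le) simp
  have t5: "\<bar>t5\<bar> \<le> B * ?h\<^sup>2"
  proof -
    have "t5 = (\<Sum>k\<in>{1..n}. \<Sum>l\<in>{1..n}. \<Sum>p\<in>{1..n}. X k l * X p l * A k p)"
      unfolding t5_def by (intro sum.cong refl sum.swap)
    also have "\<dots> = (\<Sum>l\<in>{1..n}. \<Sum>k\<in>{1..n}. \<Sum>p\<in>{1..n}. X k l * X p l * A k p)" by (rule sum.swap)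
    finally have "\<bar>t5\<bar> \<le> (\<Sum>l\<in>{1..n}. \<bar>\<Sum>k\<in>{1..n}. \<Sum>p\<in>{1..n}. X k l * X p l * A k p\<bar>)" by simp
    also have "\<dots> \<le> (\<Sum>l\<in>{1..n}. B * (L2_set (\<lambda>k. X k l) {1..n})\<^sup>2)"
    proof (rule sum_mono)
      fix l
      show "\<bar>\<Sum>k\<in>{1..n}. \<Sum>p\<in>{1..n}. X k l * X p l * A k p\<bar> \<le> B * (L2_set (\<lambda>k. X k l) {1..n})\<^sup>2"
        using nrm[of "\<lambda>k. X k l" "\<lambda>k. X k l"] by (simp only: power2_eq_square mult.assoc)
    qed
    also have "\<dots> = B * ?h\<^sup>2"
    proof -
      have "?h\<^sup>2 = (\<Sum>l\<in>{1..n}. \<Sum>k\<in>{1..n}. (X k l)\<^sup>2)"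
        unfolding sum_sq_eq_hs[symmetric] by (rule sum.swap)
      then show ?thesis unfolding L2_set_power2 by (simp only: sum_distrib_left)
    qed
    finally show ?thesis .
  qed
  have "\<bar>t1 - t2 - t3 + t4 - t5\<bar> \<le> \<bar>t1\<bar> + \<bar>t2\<bar> + \<bar>t3\<bar> + \<bar>t4\<bar> + \<bar>t5\<bar>" by linarith
  also have "\<dots> \<le> B * D\<^sup>2 + sqrt (real n) * D * ?h + sqrt (real n) * D * ?h + ?h * ?h + B * ?h\<^sup>2"
    by (intro add_mono t1 t2 t3 t4 t5)
  finally show ?thesis unfolding eq by (simp add: power2_eq_square algebra_simps)
qed

text \<open>The main term is kept as it stands: it correlates the degrees with the
  \<open>a\<^sub>k\<close> and is to be compensated by the correction, not bounded by a norm. The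
  coincidences \<open>l = p\<close> and \<open>l = q\<close> give equal errors by symmetry, whence
  the factor 2.\<close>

lemma path_sum_bound:
  fixes X A :: "nat \<Rightarrow> nat \<Rightarrow> real" and n :: nat
  assumes X: "\<And>k. X k k = 0" "\<And>k l. X k l = X l k" and A: "\<And>k. A k k = 0" "\<And>k l. \<bar>A k l\<bar> \<le> 1"
    and nrm: "\<And>x y. \<bar>\<Sum>k\<in>{1..n}. \<Sum>l\<in>{1..n}. x k * y l * A k l\<bar> \<le> B * L2_set x {1..n} * L2_set y {1..n}"
    and B: "0 \<le> B"
  defines "d \<equiv> \<lambda>k. \<Sum>l\<in>{1..n}. X k l"
  shows "\<bar>dsum4 n (\<lambda>k l p q. X k l * X p q * (A k p * A k q))
     - (\<Sum>k\<in>{1..n}. d k * (\<Sum>p\<in>{1..n}. \<Sum>q\<in>{1..n}. X p q * (A k p * A k q)))\<bar> \<le> 2 * B * (hs_norm n X)\<^sup>2"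
proof -
  let ?h = "hs_norm n X"
  have dk: "(\<Sum>l\<in>{1..n}. X k l) = d k" for k by (simp add: d_def)
  define u where "u = (\<Sum>k\<in>{1..n}. \<Sum>p\<in>{1..n}. \<Sum>q\<in>{1..n}. X p q * A k p * A k q * X k p)"
  define u' where "u' = (\<Sum>k\<in>{1..n}. \<Sum>p\<in>{1..n}. \<Sum>q\<in>{1..n}. X p q * A k p * A k q * X k q)"
  have uu: "u' = u"
  proof -
    have "u' = (\<Sum>k\<in>{1..n}. \<Sum>q\<in>{1..n}. \<Sum>p\<in>{1..n}. X p q * A k p * A k q * X k q)"
      unfolding u'_def by (intro sum.cong refl sum.swap)
    also have "\<dots> = u" unfolding u_def
      by (intro sum.cong refl) (subst X(2), simp add: mult_ac)
    finally show ?thesis .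
  qed
  have "dsum4 n (\<lambda>k l p q. X k l * X p q * (A k p * A k q)) =
    (\<Sum>k\<in>{1..n}. d k * (\<Sum>p\<in>{1..n}. \<Sum>q\<in>{1..n}. X p q * (A k p * A k q))) - u - u'"
    unfolding dsum4_path[OF X(1) A(1)] dk u_def u'_def
    by (simp add: sum_distrib_left sum_subtractf[symmetric] algebra_simps)
  then have eq: "dsum4 n (\<lambda>k l p q. X k l * X p q * (A k p * A k q))
     - (\<Sum>k\<in>{1..n}. d k * (\<Sum>p\<in>{1..n}. \<Sum>q\<in>{1..n}. X p q * (A k p * A k q))) = - 2 * u"
    using uu by simp
  \<comment> \<open>Up to transposition \<open>M\<close> is the product of \<open>A\<close> and
    \<open>X\<close>, so \<open>mat_vec_bound\<close> applies column by column.\<close>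
  define M where "M k p = (\<Sum>q\<in>{1..n}. A k q * X p q)" for k p
  have "hs_norm n M \<le> B * ?h"
  proof -
    have "(hs_norm n M)\<^sup>2 = (\<Sum>p\<in>{1..n}. (L2_set (\<lambda>k. M k p) {1..n})\<^sup>2)"
      unfolding sum_sq_eq_hs[symmetric] L2_set_power2 by (rule sum.swap)
    also have "\<dots> \<le> (\<Sum>p\<in>{1..n}. (B * L2_set (\<lambda>q. X p q) {1..n})\<^sup>2)"
      unfolding M_def by (intro sum_mono power_mono mat_vec_bound nrm B) auto
    also have "\<dots> = (B * ?h)\<^sup>2"
      unfolding power_mult_distrib L2_set_power2 sum_sq_eq_hs[symmetric] by (simp add: sum_distrib_left)
    finally show ?thesis by (rule power2_le_imp_le) (intro mult_nonneg_nonneg B hs_norm_nonneg)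
  qed
  moreover have "hs_norm n (\<lambda>k p. A k p * X k p) \<le> ?h"
  proof (rule hs_norm_mono)
    show "\<bar>A k p * X k p\<bar> \<le> \<bar>X k p\<bar>" for k p
      using mult_right_mono[OF A(2)[of k p], of "\<bar>X k p\<bar>"] by (simp add: abs_mult)
  qed
  moreover have "u = (\<Sum>k\<in>{1..n}. \<Sum>p\<in>{1..n}. (A k p * X k p) * M k p)"
    unfolding u_def M_def by (intro sum.cong refl) (simp add: sum_distrib_left mult_ac)
  ultimately have "\<bar>u\<bar> \<le> ?h * (B * ?h)"
    using hs_cauchy_schwarz_le[of n "\<lambda>k p. A k p * X k p" ?h M "B * ?h"] by (simp only:)
  then show ?thesis unfolding eq by (simp add: power2_eq_square abs_mult mult_ac)
qed

text \<open>The product runs over the edges of a 4-cycle, and its 15 nonempty edge subsets fall into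
  five classes under the exchanges of \<open>k\<close> and \<open>l\<close>, of \<open>p\<close> and
  \<open>q\<close>, and of the two pairs: 4 single edges, 4 paths, 2 matchings, 4 triples and the
  cycle. The weight \<open>t\<close> covers \<open>Q\<close> itself, with \<open>t = 1\<close>, and
  its conjugates by the \<open>D\<^sub>i\<close>.\<close>

lemma expand_cycles:
  fixes X A :: "nat \<Rightarrow> nat \<Rightarrow> real" and n :: nat
  assumes X: "\<And>k l. X k l = X l k" and A: "\<And>k l. A k l = A l k"
    and t: "\<And>k l p q. t k l p q = t l k p q" "\<And>k l p q. t k l p q = t k l q p" "\<And>k l p q. t k l p q = t p q k l"
  defines "T \<equiv> \<lambda>P. dsum4 n (\<lambda>k l p q. X k l * X p q * (P k l p q * t k l p q))"
  shows "T (\<lambda>k l p q. (1 + A k p) * (1 + A k q) * (1 + A l p) * (1 + A l q) - 1) =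
     4 * T (\<lambda>k l p q. A k p) + 4 * T (\<lambda>k l p q. A k p * A k q) + 2 * T (\<lambda>k l p q. A k p * A l q)
     + 4 * T (\<lambda>k l p q. A k p * A k q * A l q) + T (\<lambda>k l p q. A k p * A k q * A l p * A l q)"
proof -
  have sl: "T (\<lambda>k l p q. P l k p q) = T P" for P
  proof -
    have "T P = dsum4 n (\<lambda>k l p q. X l k * X p q * (P l k p q * t l k p q))"
      unfolding T_def by (rule dsum4_swap_left[symmetric])
    also have "\<dots> = T (\<lambda>k l p q. P l k p q)"
      unfolding T_def by (rule dsum4_cong) (metis X t(1))
    finally show ?thesis by simp
  qed
  have sr: "T (\<lambda>k l p q. P k l q p) = T P" for P
  proof -
    have "T P = dsum4 n (\<lambda>k l p q. X k l * X q p * (P k l q p * t k l q p))"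
      unfolding T_def by (rule dsum4_swap_right[symmetric])
    also have "\<dots> = T (\<lambda>k l p q. P k l q p)"
      unfolding T_def by (rule dsum4_cong) (metis X t(2))
    finally show ?thesis by simp
  qed
  have sp: "T (\<lambda>k l p q. P p q k l) = T P" for P
  proof -
    have "T P = dsum4 n (\<lambda>k l p q. X p q * X k l * (P p q k l * t p q k l))"
      unfolding T_def by (rule dsum4_swap_pairs[symmetric])
    also have "\<dots> = T (\<lambda>k l p q. P p q k l)"
      unfolding T_def by (rule dsum4_cong) (metis mult.commute t(3))
    finally show ?thesis by simp
  qed
  have add: "T (\<lambda>k l p q. P k l p q + Q k l p q) = T P + T Q" for P Q
    unfolding T_def dsum4_add[symmetric] by (rule dsum4_cong) (simp add: algebra_simps)
  have b: "T (\<lambda>k l p q. A k q) = T (\<lambda>k l p q. A k p)" by (rule sr)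
  have c: "T (\<lambda>k l p q. A l p) = T (\<lambda>k l p q. A k p)" by (rule sl)
  have d: "T (\<lambda>k l p q. A l q) = T (\<lambda>k l p q. A k p)" using sr[of "\<lambda>k l p q. A l p"] c by simp
  have cd: "T (\<lambda>k l p q. A l p * A l q) = T (\<lambda>k l p q. A k p * A k q)" by (rule sl)
  have ac: "T (\<lambda>k l p q. A k p * A l p) = T (\<lambda>k l p q. A k p * A k q)"
    using sp[of "\<lambda>k l p q. A k p * A k q"] A by (simp add: A)
  have bd: "T (\<lambda>k l p q. A k q * A l q) = T (\<lambda>k l p q. A k p * A k q)"
    using sr[of "\<lambda>k l p q. A k p * A l p"] ac by simp
  have bc: "T (\<lambda>k l p q. A k q * A l p) = T (\<lambda>k l p q. A k p * A l q)" by (rule sr)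
  have abc: "T (\<lambda>k l p q. A k q * A k p * A l p) = T (\<lambda>k l p q. A k p * A k q * A l q)" by (rule sr)
  have bcd: "T (\<lambda>k l p q. A l p * A l q * A k q) = T (\<lambda>k l p q. A k p * A k q * A l q)" by (rule sl)
  have acd: "T (\<lambda>k l p q. A l q * A l p * A k p) = T (\<lambda>k l p q. A k p * A k q * A l q)"
    using sl[of "\<lambda>k l p q. A k q * A k p * A l p"] abc by simp
  have "T (\<lambda>k l p q. (1 + A k p) * (1 + A k q) * (1 + A l p) * (1 + A l q) - 1)
    = T (\<lambda>k l p q. A k p + (A k q + (A l p + (A l q + (A k p * A k q + (A l p * A l q + (A k p * A l p + (A k q * A l q
       + (A k p * A l q + (A k q * A l p + (A k q * A k p * A l p + (A k p * A k q * A l q + (A l p * A l q * A k q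
       + (A l q * A l p * A k p + A k p * A k q * A l p * A l q))))))))))))))"
    by (rule arg_cong[where f = T]) (intro ext, simp add: algebra_simps)
  also have "\<dots> = 4 * T (\<lambda>k l p q. A k p) + 4 * T (\<lambda>k l p q. A k p * A k q) + 2 * T (\<lambda>k l p q. A k p * A l q)
     + 4 * T (\<lambda>k l p q. A k p * A k q * A l q) + T (\<lambda>k l p q. A k p * A k q * A l p * A l q)"
    unfolding add b c d cd ac bd bc abc bcd acd by simp
  finally show ?thesis .
qed

section \<open>Sums over 2-element sets as sums over ordered indices\<close>

lemma sum_pairs:
  fixes f :: "nat set \<Rightarrow> real"
  shows "(\<Sum>S\<in>pairs n. f S) = (\<Sum>k\<in>{1..n}. \<Sum>l\<in>{1..n}. if k = l then 0 else f {k, l}) / 2"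
proof -
  let ?I = "{p \<in> {1..n} \<times> {1..n}. fst p \<noteq> snd p}"
  have "(\<Sum>k\<in>{1..n}. \<Sum>l\<in>{1..n}. if k = l then 0 else f {k, l})
     = (\<Sum>p\<in>{1..n} \<times> {1..n}. if fst p \<noteq> snd p then f {fst p, snd p} else 0)"
    unfolding sum.cartesian_product by (intro sum.cong refl) (simp add: case_prod_beta)
  also have "\<dots> = (\<Sum>p\<in>?I. f {fst p, snd p})" by (rule sum.inter_filter[symmetric]) simp
  also have "\<dots> = (\<Sum>S\<in>pairs n. \<Sum>p\<in>{p \<in> ?I. {fst p, snd p} = S}. f {fst p, snd p})"
    by (rule sum.group[symmetric]) (auto simp: finite_pairs pairs_def card_insert_if)
  also have "\<dots> = (\<Sum>S\<in>pairs n. 2 * f S)"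
  proof (intro sum.cong refl)
    fix S assume "S \<in> pairs n"
    then obtain a b where ab: "S = {a, b}" "a \<noteq> b" "a \<in> {1..n}" "b \<in> {1..n}"
      by (auto simp: pairs_def card_2_iff)
    have "{p \<in> ?I. {fst p, snd p} = S} = {(a, b), (b, a)}" using ab by (auto simp: doubleton_eq_iff)
    then show "(\<Sum>p\<in>{p \<in> ?I. {fst p, snd p} = S}. f {fst p, snd p}) = 2 * f S"
      using ab by (simp add: insert_commute[of b a])
  qed
  finally show ?thesis unfolding sum_distrib_left[symmetric] by simp
qed

lemma sum_pairs2:
  fixes F :: "nat set \<Rightarrow> nat set \<Rightarrow> real"
  shows "(\<Sum>S\<in>pairs n. \<Sum>S'\<in>pairs n. F S S') = (\<Sum>k\<in>{1..n}. \<Sum>l\<in>{1..n}. \<Sum>p\<in>{1..n}. \<Sum>q\<in>{1..n}.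
     if k = l \<or> p = q then 0 else F {k, l} {p, q}) / 4"
proof -
  have "(\<Sum>S\<in>pairs n. \<Sum>S'\<in>pairs n. F S S') = (\<Sum>k\<in>{1..n}. \<Sum>l\<in>{1..n}.
      if k = l then 0 else (\<Sum>p\<in>{1..n}. \<Sum>q\<in>{1..n}. if p = q then 0 else F {k, l} {p, q}) / 2) / 2"
    by (subst sum_pairs, subst sum_pairs) rule
  also have "\<dots> = (\<Sum>k\<in>{1..n}. \<Sum>l\<in>{1..n}. (\<Sum>p\<in>{1..n}. \<Sum>q\<in>{1..n}.
     if k = l \<or> p = q then 0 else F {k, l} {p, q}) / 2) / 2"
    by (intro arg_cong2[where f = "(/)"] sum.cong refl) auto
  finally show ?thesis unfolding sum_divide_distrib[symmetric] by simp
qed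

lemma sum_disjoint_pairs:
  fixes F :: "nat set \<Rightarrow> nat set \<Rightarrow> real"
  shows "(\<Sum>S\<in>pairs n. \<Sum>S'\<in>pairs n. if S \<inter> S' = {} then F S S' else 0)
    = dsum4 n (\<lambda>k l p q. F {k, l} {p, q}) / 4"
  unfolding sum_pairs2 dsum4_def by (intro arg_cong2[where f = "(/)"] sum.cong refl) auto

section \<open>The entries of the matrices\<close>

lemma adj_sign_sym: "adj_sign G k l = adj_sign G l k"
  by (simp add: adj_sign_def insert_commute)

lemma adj_sign_diag: "adj_sign G k k = 0"
  by (simp add: adj_sign_def)

lemma adj_sign_le_1: "\<bar>adj_sign G k l\<bar> \<le> 1"
  by (simp add: adj_sign_def)

lemma edge_ind_conv: "k \<noteq> l \<Longrightarrow> edge_ind G k l = (1 + adj_sign G k l) / 2"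
  by (simp add: adj_sign_def edge_ind_def)

lemma pair_in_pairs: "k \<in> {1..n} \<Longrightarrow> l \<in> {1..n} \<Longrightarrow> k \<noteq> l \<Longrightarrow> {k, l} \<in> pairs n"
  by (simp add: pairs_def)

lemma a_vec_pair:
  "k \<in> {1..n} \<Longrightarrow> l \<in> {1..n} \<Longrightarrow> k \<noteq> l \<Longrightarrow> a_vec n G i {k, l} = adj_sign G i k * adj_sign G i l"
  by (simp add: a_vec_def pair_in_pairs)

lemma prod_edge_ind:
  assumes "finite A" "finite B"
  shows "(\<Prod>i\<in>A. \<Prod>j\<in>B. edge_ind G i j) = (if bip_edges A B \<subseteq> G then 1 else 0)"
proof (cases "bip_edges A B \<subseteq> G")
  case True
  then show ?thesis by (auto simp: edge_ind_def bip_edges_def intro!: prod.neutral)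
next
  case False
  then obtain i j where ij: "i \<in> A" "j \<in> B" "{i, j} \<notin> G" by (auto simp: bip_edges_def)
  then have "(\<Prod>j\<in>B. edge_ind G i j) = 0" using assms by (intro prod_zero) (auto simp: edge_ind_def)
  then have "(\<Prod>i\<in>A. \<Prod>j\<in>B. edge_ind G i j) = 0" using assms ij by (intro prod_zero) auto
  then show ?thesis using False by simp
qed

lemma card_supersets:
  assumes "finite P" "F \<subseteq> P"
  shows "card {G \<in> Pow P. F \<subseteq> G} = 2 ^ card (P - F)"
proof -
  have "bij_betw (\<lambda>G. G \<union> F) (Pow (P - F)) {G \<in> Pow P. F \<subseteq> G}"
    by (rule bij_betwI[where g = "\<lambda>G. G - F"]) (use assms in auto)
  then have "card (Pow (P - F)) = card {G \<in> Pow P. F \<subseteq> G}" by (rule bij_betw_same_card)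
  then show ?thesis using assms by (simp add: card_Pow)
qed

lemma expectation_superset:
  assumes "F \<subseteq> pairs n"
  shows "measure_pmf.expectation (gnp n (1/2)) (\<lambda>G. if F \<subseteq> G then 1 else 0 :: real) = 1 / 2 ^ card F"
proof -
  let ?P = "pairs n"
  have fin: "finite (Pow ?P)" using finite_pairs by simp
  have fF: "finite F" using assms finite_pairs finite_subset by blast
  have "measure_pmf.expectation (gnp n (1/2)) (\<lambda>G. if F \<subseteq> G then 1 else 0 :: real)
      = (\<Sum>G\<in>Pow ?P. if F \<subseteq> G then 1 else 0) / real (card (Pow ?P))"
    unfolding gnp_half using fin by (intro integral_pmf_of_set) auto
  also have "(\<Sum>G\<in>Pow ?P. if F \<subseteq> G then 1 else 0 :: real) = (\<Sum>G\<in>{G\<in>Pow ?P. F \<subseteq> G}. 1)"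
    by (rule sum.inter_filter[OF fin, symmetric])
  also have "\<dots> = 2 ^ card (?P - F)" using card_supersets[OF finite_pairs assms] by simp
  also have "real (card (Pow ?P)) = 2 ^ (card (?P - F) + card F)"
    using card_Diff_subset[OF fF assms] card_mono[OF finite_pairs assms]
    by (simp add: card_Pow finite_pairs)
  finally show ?thesis by (simp add: power_add)
qed

lemma finite_pair_member: "S \<in> pairs n \<Longrightarrow> finite S"
  by (auto simp: pairs_def intro: card_ge_0_finite)

text \<open>The product of edge indicators is the indicator that all edges between the two set
  differences are present, which has probability 2 to the minus their number.\<close>

lemma EH22_eq:
  assumes "A \<in> pairs n" "B \<in> pairs n"
  shows "EH22 n \<alpha> A B = \<alpha> (card (A \<union> B)) / 2 ^ card (bip_edges (A - B) (B - A)) - (\<alpha> 2)\<^sup>2"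
proof -
  have fin: "finite A" "finite B" using assms finite_pair_member by auto
  have sub: "bip_edges (A - B) (B - A) \<subseteq> pairs n"
    using assms by (intro bip_edges_subset_pairs) (auto simp: pairs_def)
  have "EH22 n \<alpha> A B = measure_pmf.expectation (gnp n (1/2)) (\<lambda>G. \<alpha> (card (A \<union> B)) *
      (if bip_edges (A - B) (B - A) \<subseteq> G then 1 else 0) - (\<alpha> 2)\<^sup>2)"
    unfolding EH22_def H22_def N_mat_def rank1_mat_def using fin assms
    by (simp add: prod_edge_ind pairs_def power2_eq_square)
  also have "\<dots> = \<alpha> (card (A \<union> B)) * measure_pmf.expectation (gnp n (1/2))
      (\<lambda>G. if bip_edges (A - B) (B - A) \<subseteq> G then 1 else 0) - (\<alpha> 2)\<^sup>2"
  proof -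
    have fs: "finite (set_pmf (gnp n (1/2)))"
      unfolding gnp_half using finite_pairs by (subst set_pmf_of_set) auto
    show ?thesis
      by (subst Bochner_Integration.integral_diff) (auto intro!: integrable_measure_pmf_finite fs)
  qed
  finally show ?thesis unfolding expectation_superset[OF sub] by simp
qed

lemma EH22_disjoint:
  assumes "{k, l, p, q} \<subseteq> {1..n}" "distinct [k, l, p, q]"
  shows "EH22 n \<alpha> {k, l} {p, q} = \<alpha> 4 / 16 - (\<alpha> 2)\<^sup>2"
proof -
  have 1: "{k, l} - {p, q} = {k, l}" "{p, q} - {k, l} = {p, q}" using assms by auto
  have 2: "bip_edges {k, l} {p, q} = {{k, p}, {k, q}, {l, p}, {l, q}}" by (auto simp: bip_edges_def)
  have 3: "card {{k, p}, {k, q}, {l, p}, {l, q}} = 4" using assms by (simp add: doubleton_eq_iff)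
  have 4: "card ({k, l} \<union> {p, q}) = 4" using assms by simp
  have 5: "{k, l} \<in> pairs n" "{p, q} \<in> pairs n" using assms by (auto simp: pair_in_pairs)
  show ?thesis unfolding EH22_eq[OF 5] 1 2 3 4 by simp
qed

lemma EH22_meet:
  assumes "{h, i, j} \<subseteq> {1..n}" "distinct [h, i, j]"
  shows "EH22 n \<alpha> {h, i} {h, j} = \<alpha> 3 / 2 - (\<alpha> 2)\<^sup>2"
proof -
  have "{h, i} - {h, j} = {i}" "{h, j} - {h, i} = {j}" using assms by auto
  moreover have "bip_edges {i} {j} = {{i, j}}" by (auto simp: bip_edges_def)
  moreover have "card ({h, i} \<union> {h, j}) = 3" using assms by (simp add: insert_commute)
  ultimately show ?thesis using assms by (subst EH22_eq) (auto simp: pair_in_pairs)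
qed

lemma EH22_diag:
  assumes "S \<in> pairs n"
  shows "EH22 n \<alpha> S S = \<alpha> 2 - (\<alpha> 2)\<^sup>2"
proof -
  have "bip_edges (S - S) (S - S) = {}" by (simp add: bip_edges_def)
  then show ?thesis using assms by (subst EH22_eq) (auto simp: pairs_def)
qed

lemma Q_mat_disjoint:
  fixes G :: "nat set set"
  assumes "{k, l, p, q} \<subseteq> {1..n}" "distinct [k, l, p, q]"
  defines "A \<equiv> adj_sign G"
  shows "Q_mat n \<alpha> G {k, l} {p, q} = \<alpha> 4 / 16 * ((1 + A k p) * (1 + A k q) * (1 + A l p) * (1 + A l q) - 1)"
proof -
  have "{k, l} - {p, q} = {k, l}" "{p, q} - {k, l} = {p, q}" "{k, l} \<inter> {p, q} = {}" using assms by auto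
  moreover have "card ({k, l} \<union> {p, q}) = 4" using assms by simp
  moreover have "card {k, l} = 2" "card {p, q} = 2" using assms by auto
  ultimately show ?thesis
    unfolding Q_mat_def H22_def N_mat_def rank1_mat_def EH22_disjoint[OF assms(1,2)] using assms(2)
    by (simp add: edge_ind_conv A_def power2_eq_square numeral_2_eq_2[symmetric] field_simps del: card.insert)
qed

lemma K_mat_meet:
  assumes "{h, i, j} \<subseteq> {1..n}" "distinct [h, i, j]"
  shows "K_mat n \<alpha> G {h, i} {h, j} = \<alpha> 3 / 2 * adj_sign G i j"
proof -
  have "{h, i} - {h, j} = {i}" "{h, j} - {h, i} = {j}" "{h, i} \<inter> {h, j} \<noteq> {}" using assms by auto
  moreover have "card ({h, i} \<union> {h, j}) = 3" using assms by (simp add: insert_commute)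
  moreover have "card {h, i} = 2" "card {h, j} = 2" using assms by auto
  ultimately show ?thesis
    unfolding K_mat_def Q_mat_def H22_def N_mat_def rank1_mat_def EH22_meet[OF assms] using assms(2)
    by (simp add: edge_ind_conv power2_eq_square numeral_2_eq_2[symmetric] field_simps)
qed

text \<open>One formula for all positions of the two pairs, so that it can be summed without cases.
  For equal pairs two conditions hold, but then the signs are taken on the diagonal and
  vanish.\<close>

lemma K_mat_pairs:
  fixes G :: "nat set set"
  assumes "{k, l, p, q} \<subseteq> {1..n}" "k \<noteq> l" "p \<noteq> q"
  defines "A \<equiv> adj_sign G"
  shows "K_mat n \<alpha> G {k, l} {p, q} = \<alpha> 3 / 2 * ((if k = p then A l q else 0) + (if k = q then A l p else 0)
     + (if l = p then A k q else 0) + (if l = q then A k p else 0))"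
proof -
  consider "distinct [k, l, p, q]" | "{k, l} = {p, q}" | "k = p" "l \<noteq> q" | "k = q" "l \<noteq> p"
    | "l = p" "k \<noteq> q" | "l = q" "k \<noteq> p"
    using assms by auto
  then show ?thesis
  proof cases
    case 1
    then show ?thesis by (simp add: K_mat_def Q_mat_def)
  next
    case 2
    have "K_mat n \<alpha> G {p, q} {p, q} = 0"
      using assms by (simp add: K_mat_def Q_mat_def EH22_diag pair_in_pairs H22_def N_mat_def rank1_mat_def power2_eq_square
          numeral_2_eq_2[symmetric])
    then have K0: "K_mat n \<alpha> G {k, l} {p, q} = 0" using 2 by simp
    show ?thesis unfolding K0 using 2 assms(2,3) by (auto simp: doubleton_eq_iff A_def adj_sign_diag)
  next
    case 3
    then show ?thesis using K_mat_meet[of k l q n \<alpha> G] assms by (auto simp: A_def)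
  next
    case 4
    then show ?thesis using K_mat_meet[of k l p n \<alpha> G] assms by (auto simp: A_def insert_commute)
  next
    case 5
    then show ?thesis using K_mat_meet[of l k q n \<alpha> G] assms by (auto simp: A_def insert_commute)
  next
    case 6
    then show ?thesis using K_mat_meet[of l k p n \<alpha> G] assms by (auto simp: A_def insert_commute)
  qed
qed

section \<open>Quadratic forms\<close>

definition qform :: "nat \<Rightarrow> (nat set \<Rightarrow> nat set \<Rightarrow> real) \<Rightarrow> (nat set \<Rightarrow> real) \<Rightarrow> real" where
  "qform n M x = (\<Sum>S\<in>pairs n. \<Sum>T\<in>pairs n. x S * M S T * x T)"

text \<open>A vector indexed by pairs, read as a symmetric matrix with zero diagonal. Its row sums
  are the degrees, and its squared norm is twice that of the vector.\<close>

definition pair_fun :: "(nat set \<Rightarrow> real) \<Rightarrow> nat \<Rightarrow> nat \<Rightarrow> real" where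
  "pair_fun x k l = (if k = l then 0 else x {k, l})"

lemma pair_fun_diag: "pair_fun x k k = 0"
  by (simp add: pair_fun_def)

lemma pair_fun_sym: "pair_fun x k l = pair_fun x l k"
  by (simp add: pair_fun_def insert_commute)

lemma pairE:
  assumes "S \<in> pairs n"
  obtains k l where "S = {k, l}" "k \<noteq> l" "k \<in> {1..n}" "l \<in> {1..n}"
  using assms by (auto simp: pairs_def card_2_iff)

lemma sum_squares_pairs: "(\<Sum>S\<in>pairs n. (x S)\<^sup>2) = (hs_norm n (pair_fun x))\<^sup>2 / 2"
  unfolding sum_sq_eq_hs[symmetric] sum_pairs pair_fun_def
  by (intro arg_cong2[where f = "(/)"] sum.cong refl) auto

lemma sum_pairs_containing:
  assumes h: "h \<in> {1..n}"
  shows "(\<Sum>S\<in>pairs n. if h \<in> S then x S else 0) = (\<Sum>l\<in>{1..n}. pair_fun x h l)"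
proof -
  have "(\<Sum>S\<in>pairs n. if h \<in> S then x S else 0) = (\<Sum>k\<in>{1..n}. \<Sum>l\<in>{1..n}.
     (if k = h then pair_fun x h l else 0) + (if l = h then pair_fun x h k else 0)) / 2"
    unfolding sum_pairs
    by (intro arg_cong2[where f = "(/)"] sum.cong refl) (auto simp: pair_fun_def insert_commute)
  also have "\<dots> = ((\<Sum>k\<in>{1..n}. if k = h then (\<Sum>l\<in>{1..n}. pair_fun x h l) else 0) + (\<Sum>k\<in>{1..n}. pair_fun x h k)) / 2"
  proof -
    have "(\<Sum>l\<in>{1..n}. if k = h then pair_fun x h l else 0) = (if k = h then (\<Sum>l\<in>{1..n}. pair_fun x h l) else 0)" for k
      by simp
    moreover have "(\<Sum>l\<in>{1..n}. if l = h then pair_fun x h k else 0) = pair_fun x h k" for k using h by simp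
    ultimately show ?thesis by (simp only: sum.distrib)
  qed
  also have "\<dots> = (\<Sum>l\<in>{1..n}. pair_fun x h l)" using h by simp
  finally show ?thesis .
qed

text \<open>The entries depend on the size of the intersection alone. An affine function matches the
  sizes 0 and 1, and a multiple of the identity adjusts the size 2.\<close>

lemma EH22_linear:
  assumes "S \<in> pairs n" "T \<in> pairs n"
  shows "EH22 n \<alpha> S T = (\<alpha> 4 / 16 - (\<alpha> 2)\<^sup>2) + (\<alpha> 3 / 2 - \<alpha> 4 / 16) * real (card (S \<inter> T))
     + (\<alpha> 2 - \<alpha> 3 + \<alpha> 4 / 16) * (if S = T then 1 else 0)"
proof -
  obtain k l where S: "S = {k, l}" "k \<noteq> l" "k \<in> {1..n}" "l \<in> {1..n}" using assms(1) by (rule pairE)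
  obtain p q where T: "T = {p, q}" "p \<noteq> q" "p \<in> {1..n}" "q \<in> {1..n}" using assms(2) by (rule pairE)
  have meet: ?thesis if "S = {h, i}" "T = {h, j}" "distinct [h, i, j]" "{h, i, j} \<subseteq> {1..n}" for h i j
  proof -
    have "S \<inter> T = {h}" "S \<noteq> T" using that by (auto simp: doubleton_eq_iff)
    then have 1: "card (S \<inter> T) = 1" "(if S = T then 1 else 0 :: real) = 0" by auto
    have "EH22 n \<alpha> S T = \<alpha> 3 / 2 - (\<alpha> 2)\<^sup>2" using that EH22_meet by simp
    then show ?thesis unfolding 1 by simp
  qed
  consider "distinct [k, l, p, q]" | "S = T" | "k = p" "l \<noteq> q" | "k = q" "l \<noteq> p"
    | "l = p" "k \<noteq> q" | "l = q" "k \<noteq> p"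
    using S T by auto
  then show ?thesis
  proof cases
    case 1
    then have "S \<inter> T = {}" "S \<noteq> T" using S T by auto
    then show ?thesis using EH22_disjoint[of k l p q n \<alpha>] S T 1 by simp
  next
    case 2
    then have "card (S \<inter> T) = 2" using assms(1) by (simp add: pairs_def)
    then show ?thesis using 2 EH22_diag[OF assms(1), of \<alpha>] by simp
  next
    case 3
    then show ?thesis using S T by (intro meet[of k l q]) auto
  next
    case 4
    then show ?thesis using S T by (intro meet[of k l p]) auto
  next
    case 5
    then show ?thesis using S T by (intro meet[of l k q]) auto
  next
    case 6
    then show ?thesis using S T by (intro meet[of l k p]) auto
  qed
qed

text \<open>The size of the intersection is the sum over \<open>h\<close> of the products of
  membership indicators, so its form is the sum of the squared degrees.\<close>

lemma qform_EH22:
  "qform n (EH22 n \<alpha>) x = (\<alpha> 4 / 16 - (\<alpha> 2)\<^sup>2) * (\<Sum>S\<in>pairs n. x S)\<^sup>2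
     + (\<alpha> 3 / 2 - \<alpha> 4 / 16) * (L2_set (\<lambda>k. \<Sum>l\<in>{1..n}. pair_fun x k l) {1..n})\<^sup>2
     + (\<alpha> 2 - \<alpha> 3 + \<alpha> 4 / 16) * ((hs_norm n (pair_fun x))\<^sup>2 / 2)"
proof -
  let ?P = "pairs n"
  have card: "(\<Sum>S\<in>?P. \<Sum>T\<in>?P. x S * real (card (S \<inter> T)) * x T)
     = (L2_set (\<lambda>k. \<Sum>l\<in>{1..n}. pair_fun x k l) {1..n})\<^sup>2"
  proof -
    have c: "real (card (S \<inter> T)) = (\<Sum>h\<in>{1..n}. (if h \<in> S then 1 else 0) * (if h \<in> T then 1 else 0))"
      if "S \<in> ?P" for S T
    proof -
      have "S \<inter> T = {h \<in> {1..n}. h \<in> S \<and> h \<in> T}" using that by (auto simp: pairs_def)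
      then have "real (card (S \<inter> T)) = (\<Sum>h\<in>{h \<in> {1..n}. h \<in> S \<and> h \<in> T}. 1)" by simp
      also have "\<dots> = (\<Sum>h\<in>{1..n}. if h \<in> S \<and> h \<in> T then 1 else 0)" by (rule sum.inter_filter) simp
      also have "\<dots> = (\<Sum>h\<in>{1..n}. (if h \<in> S then 1 else 0) * (if h \<in> T then 1 else 0))"
        by (intro sum.cong refl) auto
      finally show ?thesis .
    qed
    have "(\<Sum>S\<in>?P. \<Sum>T\<in>?P. x S * real (card (S \<inter> T)) * x T)
      = (\<Sum>S\<in>?P. \<Sum>T\<in>?P. \<Sum>h\<in>{1..n}. (if h \<in> S then x S else 0) * (if h \<in> T then x T else 0))"
    proof (rule sum.cong[OF refl], rule sum.cong[OF refl])
      fix S T assume S: "S \<in> ?P"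
      show "x S * real (card (S \<inter> T)) * x T = (\<Sum>h\<in>{1..n}. (if h \<in> S then x S else 0) * (if h \<in> T then x T else 0))"
        unfolding c[OF S] sum_distrib_left sum_distrib_right by (intro sum.cong refl) auto
    qed
    also have "\<dots> = (\<Sum>S\<in>?P. \<Sum>h\<in>{1..n}. \<Sum>T\<in>?P. (if h \<in> S then x S else 0) * (if h \<in> T then x T else 0))"
      by (intro sum.cong refl sum.swap)
    also have "\<dots> = (\<Sum>h\<in>{1..n}. \<Sum>S\<in>?P. \<Sum>T\<in>?P. (if h \<in> S then x S else 0) * (if h \<in> T then x T else 0))"
      by (rule sum.swap)
    also have "\<dots> = (\<Sum>h\<in>{1..n}. (\<Sum>S\<in>?P. if h \<in> S then x S else 0)\<^sup>2)"
      unfolding power2_eq_square sum_product ..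
    also have "\<dots> = (\<Sum>h\<in>{1..n}. (\<Sum>l\<in>{1..n}. pair_fun x h l)\<^sup>2)"
      by (intro sum.cong refl) (simp only: sum_pairs_containing)
    finally show ?thesis unfolding L2_set_power2 .
  qed
  have diag: "(\<Sum>S\<in>?P. \<Sum>T\<in>?P. x S * (if S = T then 1 else 0) * x T) = (hs_norm n (pair_fun x))\<^sup>2 / 2"
  proof -
    have "(\<Sum>S\<in>?P. \<Sum>T\<in>?P. x S * (if S = T then 1 else 0) * x T) = (\<Sum>S\<in>?P. \<Sum>T\<in>?P. if S = T then (x S)\<^sup>2 else 0)"
      by (intro sum.cong refl) (auto simp: power2_eq_square)
    also have "\<dots> = (\<Sum>S\<in>?P. (x S)\<^sup>2)" by (intro sum.cong refl) (simp add: finite_pairs)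
    finally show ?thesis unfolding sum_squares_pairs .
  qed
  have one: "(\<Sum>S\<in>?P. \<Sum>T\<in>?P. x S * x T) = (\<Sum>S\<in>?P. x S)\<^sup>2"
    unfolding power2_eq_square sum_product ..
  define e0 where "e0 = \<alpha> 4 / 16 - (\<alpha> 2)\<^sup>2"
  define e1 where "e1 = \<alpha> 3 / 2 - \<alpha> 4 / 16"
  define e2 where "e2 = \<alpha> 2 - \<alpha> 3 + \<alpha> 4 / 16"
  have "qform n (EH22 n \<alpha>) x = (\<Sum>S\<in>?P. \<Sum>T\<in>?P. e0 * (x S * x T) + e1 * (x S * real (card (S \<inter> T)) * x T)
      + e2 * (x S * (if S = T then 1 else 0) * x T))"
    unfolding qform_def
  proof (intro sum.cong refl)
    fix S T assume "S \<in> ?P" "T \<in> ?P"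
    then have E: "EH22 n \<alpha> S T = e0 + e1 * real (card (S \<inter> T)) + e2 * (if S = T then 1 else 0)"
      unfolding e0_def e1_def e2_def by (rule EH22_linear)
    show "x S * EH22 n \<alpha> S T * x T = e0 * (x S * x T) + e1 * (x S * real (card (S \<inter> T)) * x T)
      + e2 * (x S * (if S = T then 1 else 0) * x T)"
      unfolding E by (simp only: ring_distribs mult_ac)
  qed
  also have "\<dots> = e0 * (\<Sum>S\<in>?P. \<Sum>T\<in>?P. x S * x T) + e1 * (\<Sum>S\<in>?P. \<Sum>T\<in>?P. x S * real (card (S \<inter> T)) * x T)
      + e2 * (\<Sum>S\<in>?P. \<Sum>T\<in>?P. x S * (if S = T then 1 else 0) * x T)"
    by (simp only: sum.distrib sum_distrib_left)
  finally show ?thesis unfolding card diag one e0_def e1_def e2_def .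
qed

text \<open>The weight \<open>w\<close> treats \<open>Q\<close> and all conjugates by the
  \<open>D\<^sub>i\<close> at once. The denominator 64 is 16 from four edge indicators times 4
  orderings of the two pairs.\<close>

lemma qform_Q_weighted:
  fixes G :: "nat set set" and x w :: "nat set \<Rightarrow> real"
  defines "A \<equiv> adj_sign G" and "X \<equiv> pair_fun x"
  shows "qform n (Q_mat n \<alpha> G) (\<lambda>S. w S * x S) = \<alpha> 4 / 64 * dsum4 n (\<lambda>k l p q. X k l * X p q *
     (((1 + A k p) * (1 + A k q) * (1 + A l p) * (1 + A l q) - 1) * (w {k, l} * w {p, q})))"
proof -
  have "qform n (Q_mat n \<alpha> G) (\<lambda>S. w S * x S) = (\<Sum>S\<in>pairs n. \<Sum>T\<in>pairs n. if S \<inter> T = {} then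
      (w S * x S) * Q_mat n \<alpha> G S T * (w T * x T) else 0)"
    unfolding qform_def by (intro sum.cong refl) (simp add: Q_mat_def)
  also have "\<dots> = dsum4 n (\<lambda>k l p q. (w {k, l} * x {k, l}) * Q_mat n \<alpha> G {k, l} {p, q} * (w {p, q} * x {p, q})) / 4"
    by (rule sum_disjoint_pairs)
  also have "dsum4 n (\<lambda>k l p q. (w {k, l} * x {k, l}) * Q_mat n \<alpha> G {k, l} {p, q} * (w {p, q} * x {p, q}))
    = dsum4 n (\<lambda>k l p q. \<alpha> 4 / 16 * (X k l * X p q *
     (((1 + A k p) * (1 + A k q) * (1 + A l p) * (1 + A l q) - 1) * (w {k, l} * w {p, q}))))"
    unfolding dsum4_def
  proof (intro sum.cong refl if_cong)
    fix k l p q assume "k \<in> {1..n}" "l \<in> {1..n}" "p \<in> {1..n}" "q \<in> {1..n}" and d: "distinct [k, l, p, q]"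
    then have "{k, l, p, q} \<subseteq> {1..n}" by auto
    moreover have "X k l = x {k, l}" "X p q = x {p, q}" using d by (auto simp: X_def pair_fun_def)
    ultimately show "(w {k, l} * x {k, l}) * Q_mat n \<alpha> G {k, l} {p, q} * (w {p, q} * x {p, q})
      = \<alpha> 4 / 16 * (X k l * X p q *
     (((1 + A k p) * (1 + A k q) * (1 + A l p) * (1 + A l q) - 1) * (w {k, l} * w {p, q})))"
      unfolding A_def by (simp only: Q_mat_disjoint[OF _ d] mult_ac)
  qed
  finally show ?thesis unfolding dsum4_scale by simp
qed

text \<open>The four ways in which two ordered pairs can share an element contribute equally by
  symmetry of \<open>pair_fun\<close>, which cancels the factor 1/4 for orderings.\<close>

lemma qform_K:
  fixes G :: "nat set set" and x :: "nat set \<Rightarrow> real"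
  defines "A \<equiv> adj_sign G" and "X \<equiv> pair_fun x"
  shows "qform n (K_mat n \<alpha> G) x = \<alpha> 3 / 2 * (\<Sum>k\<in>{1..n}. \<Sum>l\<in>{1..n}. \<Sum>q\<in>{1..n}. X k l * X k q * A l q)"
proof -
  let ?N = "{1..n}"
  define Z where "Z = (\<Sum>k\<in>?N. \<Sum>l\<in>?N. \<Sum>q\<in>?N. X k l * X k q * A l q)"
  have Xs: "X k l = X l k" for k l unfolding X_def by (rule pair_fun_sym)
  have "qform n (K_mat n \<alpha> G) x = (\<Sum>k\<in>?N. \<Sum>l\<in>?N. \<Sum>p\<in>?N. \<Sum>q\<in>?N. \<alpha> 3 / 2 * (X k l * X p q *
     ((if k = p then A l q else 0) + (if k = q then A l p else 0)
     + (if l = p then A k q else 0) + (if l = q then A k p else 0)))) / 4"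
    unfolding qform_def sum_pairs2
  proof (intro arg_cong2[where f = "(/)"] sum.cong refl)
    fix k l p q assume m: "k \<in> ?N" "l \<in> ?N" "p \<in> ?N" "q \<in> ?N"
    show "(if k = l \<or> p = q then 0 else x {k, l} * K_mat n \<alpha> G {k, l} {p, q} * x {p, q}) =
       \<alpha> 3 / 2 * (X k l * X p q * ((if k = p then A l q else 0) + (if k = q then A l p else 0)
     + (if l = p then A k q else 0) + (if l = q then A k p else 0)))"
    proof (cases "k = l \<or> p = q")
      case True
      then show ?thesis by (auto simp: X_def pair_fun_def)
    next
      case False
      then have "{k, l, p, q} \<subseteq> ?N" "k \<noteq> l" "p \<noteq> q" using m by auto
      note K = K_mat_pairs[OF this, of \<alpha> G]
      have X: "X k l = x {k, l}" "X p q = x {p, q}" using False by (auto simp: X_def pair_fun_def)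
      show ?thesis using False unfolding K X A_def by (simp only: if_False mult_ac)
    qed
  qed
  also have "\<dots> = \<alpha> 3 / 8 * ((\<Sum>k\<in>?N. \<Sum>l\<in>?N. \<Sum>p\<in>?N. \<Sum>q\<in>?N. if k = p then X k l * X p q * A l q else 0)
     + (\<Sum>k\<in>?N. \<Sum>l\<in>?N. \<Sum>p\<in>?N. \<Sum>q\<in>?N. if k = q then X k l * X p q * A l p else 0)
     + (\<Sum>k\<in>?N. \<Sum>l\<in>?N. \<Sum>p\<in>?N. \<Sum>q\<in>?N. if l = p then X k l * X p q * A k q else 0)
     + (\<Sum>k\<in>?N. \<Sum>l\<in>?N. \<Sum>p\<in>?N. \<Sum>q\<in>?N. if l = q then X k l * X p q * A k p else 0))"
    unfolding sum.distrib[symmetric] sum_distrib_left sum_divide_distrib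
    by (intro sum.cong refl) (auto simp: algebra_simps)
  also have "(\<Sum>k\<in>?N. \<Sum>l\<in>?N. \<Sum>p\<in>?N. \<Sum>q\<in>?N. if k = p then X k l * X p q * A l q else 0) = Z"
    unfolding Z_def
  proof (rule sum.cong[OF refl], rule sum.cong[OF refl])
    fix k l assume "k \<in> ?N"
    have "(\<Sum>p\<in>?N. \<Sum>q\<in>?N. if k = p then X k l * X p q * A l q else 0)
       = (\<Sum>p\<in>?N. if k = p then (\<Sum>q\<in>?N. X k l * X p q * A l q) else 0)"
      by (intro sum.cong refl) simp
    then show "(\<Sum>p\<in>?N. \<Sum>q\<in>?N. if k = p then X k l * X p q * A l q else 0) = (\<Sum>q\<in>?N. X k l * X k q * A l q)"
      using \<open>k \<in> ?N\<close> by simp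
  qed
  also have "(\<Sum>k\<in>?N. \<Sum>l\<in>?N. \<Sum>p\<in>?N. \<Sum>q\<in>?N. if k = q then X k l * X p q * A l p else 0) = Z"
  proof -
    have "(\<Sum>q\<in>?N. if k = q then X k l * X p q * A l p else 0) = X k l * X k p * A l p" if "k \<in> ?N" for k l p
      using that Xs[of p k] by simp
    then show ?thesis unfolding Z_def by (intro sum.cong refl)
  qed
  also have "(\<Sum>k\<in>?N. \<Sum>l\<in>?N. \<Sum>p\<in>?N. \<Sum>q\<in>?N. if l = p then X k l * X p q * A k q else 0) = Z"
  proof -
    have "(\<Sum>k\<in>?N. \<Sum>l\<in>?N. \<Sum>p\<in>?N. \<Sum>q\<in>?N. if l = p then X k l * X p q * A k q else 0)
      = (\<Sum>k\<in>?N. \<Sum>l\<in>?N. \<Sum>q\<in>?N. X l k * X l q * A k q)"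
    proof (rule sum.cong[OF refl], rule sum.cong[OF refl])
      fix k l assume "l \<in> ?N"
      have "(\<Sum>p\<in>?N. \<Sum>q\<in>?N. if l = p then X k l * X p q * A k q else 0)
         = (\<Sum>p\<in>?N. if l = p then (\<Sum>q\<in>?N. X k l * X p q * A k q) else 0)"
        by (intro sum.cong refl) simp
      then show "(\<Sum>p\<in>?N. \<Sum>q\<in>?N. if l = p then X k l * X p q * A k q else 0) = (\<Sum>q\<in>?N. X l k * X l q * A k q)"
        using \<open>l \<in> ?N\<close> Xs[of k l] by simp
    qed
    also have "\<dots> = Z" unfolding Z_def by (rule sum.swap)
    finally show ?thesis .
  qed
  also have "(\<Sum>k\<in>?N. \<Sum>l\<in>?N. \<Sum>p\<in>?N. \<Sum>q\<in>?N. if l = q then X k l * X p q * A k p else 0) = Z"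
  proof -
    have "(\<Sum>k\<in>?N. \<Sum>l\<in>?N. \<Sum>p\<in>?N. \<Sum>q\<in>?N. if l = q then X k l * X p q * A k p else 0)
      = (\<Sum>k\<in>?N. \<Sum>l\<in>?N. \<Sum>p\<in>?N. X l k * X l p * A k p)"
    proof -
      have "(\<Sum>q\<in>?N. if l = q then X k l * X p q * A k p else 0) = X l k * X l p * A k p" if "l \<in> ?N" for k l p
        using that Xs[of p l] Xs[of k l] by simp
      then show ?thesis by (intro sum.cong refl)
    qed
    also have "\<dots> = Z" unfolding Z_def by (rule sum.swap)
    finally show ?thesis .
  qed
  finally show ?thesis unfolding Z_def by simp
qed

section \<open>The projection onto \<open>W_space\<close> and the Gram matrix of its
  generators\<close>

lemma W_proj:
  fixes n :: nat and G :: "nat set set"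
  defines "P \<equiv> \<lambda>T. orth_proj_on (pairs n) (W_space n G) (\<lambda>C. if C = T then 1 else 0)"
  shows "P T \<in> W_space n G"
    and "v \<in> W_space n G \<Longrightarrow> T \<in> pairs n \<Longrightarrow> inner_on (pairs n) (P T) v = v T"
proof -
  have off: "a_vec n G i S = 0" if "S \<notin> pairs n" for i S using that by (simp add: a_vec_def)
  show "P T \<in> W_space n G"
    unfolding P_def W_space_def by (rule orth_proj_on(1)) (simp_all add: finite_pairs off)
  show "inner_on (pairs n) (P T) v = v T" if v: "v \<in> W_space n G" and T: "T \<in> pairs n"
  proof -
    have "inner_on (pairs n) (\<lambda>C. (if C = T then 1 else 0) - P T C) v = 0"
      unfolding P_def W_space_def
      by (rule orth_proj_on(2)) (use v in \<open>simp_all add: finite_pairs off W_space_def\<close>)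
    then have "inner_on (pairs n) (P T) v = inner_on (pairs n) (\<lambda>C. if C = T then 1 else 0) v"
      by (simp add: inner_on_diff)
    also have "\<dots> = (\<Sum>C\<in>pairs n. if C = T then v C else 0)"
      unfolding inner_on_def by (intro sum.cong) auto
    also have "\<dots> = v T" using T by (simp add: finite_pairs)
    finally show ?thesis .
  qed
qed

lemma Pi_W_conv: "Pi_W n G S T = orth_proj_on (pairs n) (W_space n G) (\<lambda>C. if C = T then 1 else 0) S"
  unfolding Pi_W_def proj_mat_on_def ..

lemma inner_on_commute: "inner_on I u v = inner_on I v u"
  unfolding inner_on_def by (simp add: mult.commute)

text \<open>Column \<open>T\<close> of the projection is the reproducing kernel of
  \<open>W_space\<close> at \<open>T\<close>, and a kernel value is an inner product of two
  columns.\<close>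

lemma Pi_W_sym:
  assumes "S \<in> pairs n" "T \<in> pairs n"
  shows "Pi_W n G S T = Pi_W n G T S"
proof -
  define P where "P T = orth_proj_on (pairs n) (W_space n G) (\<lambda>C. if C = T then 1 else 0)" for T
  have PW: "P T \<in> W_space n G" for T unfolding P_def by (rule W_proj(1))
  have "P T S = inner_on (pairs n) (P S) (P T)"
    using W_proj(2)[OF PW assms(1)] by (simp only: P_def)
  also have "\<dots> = inner_on (pairs n) (P T) (P S)" by (rule inner_on_commute)
  also have "\<dots> = P S T" using W_proj(2)[OF PW assms(2)] by (simp only: P_def)
  finally show ?thesis unfolding Pi_W_conv P_def .
qed

text \<open>The numbers \<open>c\<close> are coordinates of the projected vector in the generators,
  which may be linearly dependent. The three expressions are its squared length, its pairing with
  the correlations, and its inner product with \<open>x\<close>.\<close>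

lemma qform_Pi_W:
  obtains c where "qform n (Pi_W n G) x = (\<Sum>S\<in>pairs n. (\<Sum>i\<in>{1..n}. c i * a_vec n G i S)\<^sup>2)"
    "qform n (Pi_W n G) x = (\<Sum>i\<in>{1..n}. c i * (\<Sum>S\<in>pairs n. a_vec n G i S * x S))"
    "qform n (Pi_W n G) x = (\<Sum>S\<in>pairs n. x S * (\<Sum>i\<in>{1..n}. c i * a_vec n G i S))"
proof -
  let ?P = "pairs n"
  define P where "P T = orth_proj_on ?P (W_space n G) (\<lambda>C. if C = T then 1 else 0)" for T
  have PW: "P T \<in> W_space n G" for T unfolding P_def by (rule W_proj(1))
  have "\<forall>T. \<exists>c. P T = (\<lambda>S. \<Sum>i\<in>{1..n}. c i * a_vec n G i S)"
  proof
    fix T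
    show "\<exists>c. P T = (\<lambda>S. \<Sum>i\<in>{1..n}. c i * a_vec n G i S)"
      using PW[of T] unfolding W_space_def span_family_def by auto
  qed
  from choice[OF this] obtain cc where cc: "\<And>T. P T = (\<lambda>S. \<Sum>i\<in>{1..n}. cc T i * a_vec n G i S)" by auto
  define c where "c i = (\<Sum>T\<in>?P. x T * cc T i)" for i
  define w where "w S = (\<Sum>i\<in>{1..n}. c i * a_vec n G i S)" for S
  have w: "w S = (\<Sum>T\<in>?P. x T * P T S)" for S
  proof -
    have "w S = (\<Sum>i\<in>{1..n}. \<Sum>T\<in>?P. x T * (cc T i * a_vec n G i S))"
      unfolding w_def c_def sum_distrib_right by (simp only: mult.assoc)
    also have "\<dots> = (\<Sum>T\<in>?P. \<Sum>i\<in>{1..n}. x T * (cc T i * a_vec n G i S))" by (rule sum.swap)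
    also have "\<dots> = (\<Sum>T\<in>?P. x T * P T S)" unfolding cc sum_distrib_left ..
    finally show ?thesis .
  qed
  have wW: "w \<in> W_space n G"
    unfolding w_def[abs_def] W_space_def by (rule span_familyI)
  have 1: "qform n (Pi_W n G) x = (\<Sum>S\<in>?P. x S * w S)"
  proof -
    have "qform n (Pi_W n G) x = (\<Sum>S\<in>?P. \<Sum>T\<in>?P. x S * (x T * P T S))"
      unfolding qform_def Pi_W_conv P_def by (intro sum.cong refl) (simp only: mult_ac)
    then show ?thesis unfolding w sum_distrib_left .
  qed
  have "(\<Sum>S\<in>?P. (w S)\<^sup>2) = inner_on ?P w w" by (simp add: inner_on_def power2_eq_square)
  also have "\<dots> = (\<Sum>S\<in>?P. \<Sum>T\<in>?P. x T * (P T S * w S))"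
    unfolding inner_on_def by (subst w, simp only: sum_distrib_right mult.assoc)
  also have "\<dots> = (\<Sum>T\<in>?P. \<Sum>S\<in>?P. x T * (P T S * w S))" by (rule sum.swap)
  also have "\<dots> = (\<Sum>T\<in>?P. x T * inner_on ?P (P T) w)"
    unfolding inner_on_def sum_distrib_left ..
  also have "\<dots> = (\<Sum>T\<in>?P. x T * w T)"
    using W_proj(2)[OF wW] by (intro sum.cong refl) (simp add: P_def)
  finally have 2: "qform n (Pi_W n G) x = (\<Sum>S\<in>?P. (w S)\<^sup>2)" using 1 by simp
  have "(\<Sum>S\<in>?P. x S * w S) = (\<Sum>S\<in>?P. \<Sum>i\<in>{1..n}. c i * (a_vec n G i S * x S))"
    unfolding w_def sum_distrib_left by (intro sum.cong refl) (simp only: mult_ac)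
  also have "\<dots> = (\<Sum>i\<in>{1..n}. \<Sum>S\<in>?P. c i * (a_vec n G i S * x S))" by (rule sum.swap)
  also have "\<dots> = (\<Sum>i\<in>{1..n}. c i * (\<Sum>S\<in>?P. a_vec n G i S * x S))" by (simp only: sum_distrib_left)
  finally have 3: "qform n (Pi_W n G) x = (\<Sum>i\<in>{1..n}. c i * (\<Sum>S\<in>?P. a_vec n G i S * x S))" using 1 by simp
  show ?thesis by (rule that[of c]) (use 1 2 3 in \<open>simp_all only: w_def\<close>)
qed

lemma qform_Pi_W_nonneg: "0 \<le> qform n (Pi_W n G) x"
proof -
  obtain c where "qform n (Pi_W n G) x = (\<Sum>S\<in>pairs n. (\<Sum>i\<in>{1..n}. c i * a_vec n G i S)\<^sup>2)"
    by (rule qform_Pi_W[of n G x])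
  then show ?thesis by (simp add: sum_nonneg)
qed

lemma le_of_square_le_mult:
  fixes a b :: real
  assumes "a\<^sup>2 \<le> b * a" "0 \<le> b"
  shows "a \<le> b"
proof (cases "a \<le> 0")
  case True
  then show ?thesis using assms by simp
next
  case False
  then show ?thesis using assms by (intro mult_right_le_imp_le[of a a b]) (auto simp: power2_eq_square)
qed

lemma qform_Pi_W_le: "qform n (Pi_W n G) x \<le> (\<Sum>S\<in>pairs n. (x S)\<^sup>2)"
proof -
  obtain c where c: "qform n (Pi_W n G) x = (\<Sum>S\<in>pairs n. (\<Sum>i\<in>{1..n}. c i * a_vec n G i S)\<^sup>2)"
    "qform n (Pi_W n G) x = (\<Sum>S\<in>pairs n. x S * (\<Sum>i\<in>{1..n}. c i * a_vec n G i S))"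
    by (rule qform_Pi_W[of n G x])
  have "(qform n (Pi_W n G) x)\<^sup>2 \<le> (\<Sum>S\<in>pairs n. (x S)\<^sup>2) * qform n (Pi_W n G) x"
    using Cauchy_Schwarz_ineq_sum[of x "\<lambda>S. \<Sum>i\<in>{1..n}. c i * a_vec n G i S" "pairs n"]
    unfolding c(2)[symmetric] c(1)[symmetric] .
  then show ?thesis by (rule le_of_square_le_mult) (simp add: sum_nonneg)
qed

text \<open>A lower bound \<open>g\<close> for the Gram matrix controls the coordinates by the
  length of the projected vector. Cauchy-Schwarz against the correlations then bounds the squared
  form by the form itself, and one factor cancels.\<close>

lemma qform_Pi_W_le_gram:
  assumes gram: "\<And>c. g * (\<Sum>i\<in>{1..n}. (c i)\<^sup>2) \<le> (\<Sum>S\<in>pairs n. (\<Sum>i\<in>{1..n}. c i * a_vec n G i S)\<^sup>2)"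
    and g: "g > 0"
  shows "qform n (Pi_W n G) x \<le> (\<Sum>i\<in>{1..n}. (\<Sum>S\<in>pairs n. a_vec n G i S * x S)\<^sup>2) / g"
proof -
  let ?b = "\<Sum>i\<in>{1..n}. (\<Sum>S\<in>pairs n. a_vec n G i S * x S)\<^sup>2" and ?q = "qform n (Pi_W n G) x"
  obtain c where c: "?q = (\<Sum>S\<in>pairs n. (\<Sum>i\<in>{1..n}. c i * a_vec n G i S)\<^sup>2)"
    "?q = (\<Sum>i\<in>{1..n}. c i * (\<Sum>S\<in>pairs n. a_vec n G i S * x S))"
    by (rule qform_Pi_W[of n G x])
  have b0: "0 \<le> ?b" by (simp add: sum_nonneg)
  have "?q\<^sup>2 \<le> (\<Sum>i\<in>{1..n}. (c i)\<^sup>2) * ?b"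
    using Cauchy_Schwarz_ineq_sum[of c "\<lambda>i. \<Sum>S\<in>pairs n. a_vec n G i S * x S" "{1..n}"]
    unfolding c(2)[symmetric] .
  also have "\<dots> \<le> (?q / g) * ?b"
    using gram[of c] g b0 unfolding c(1)[symmetric]
    by (intro mult_right_mono) (simp_all add: field_simps)
  finally have "?q\<^sup>2 \<le> (?b / g) * ?q" by (simp add: mult.commute)
  then show ?thesis by (rule le_of_square_le_mult) (use b0 g in simp)
qed

text \<open>A diagonal entry of the Gram matrix counts the pairs avoiding \<open>i\<close>, that is
  (n-1)(n-2)/2. The rest is half of the 4-cycle template, whose norm is only of order n^(3/2) up to
  logarithms.\<close>

lemma gram_lower:
  assumes good: "good K n G"
  shows "((real n - 1) * (real n - 2) / 2 - K * ln (real n) ^ 8 * sqrt (real n ^ 3) / 2) * (\<Sum>i\<in>{1..n}. (c i)\<^sup>2)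
    \<le> (\<Sum>S\<in>pairs n. (\<Sum>i\<in>{1..n}. c i * a_vec n G i S)\<^sup>2)"
proof -
  let ?N = "{1..n}"
  define A where "A = adj_sign G"
  have As: "A k l = A l k" for k l unfolding A_def by (rule adj_sign_sym)
  have A0: "A k k = 0" for k unfolding A_def by (rule adj_sign_diag)
  have A1: "k \<noteq> l \<Longrightarrow> A k l * A k l = 1" for k l unfolding A_def adj_sign_def by simp
  define F where "F i j k l = c i * c j * (A i k * A i l * A j k * A j l)" for i j k l
  have "(\<Sum>S\<in>pairs n. (\<Sum>i\<in>?N. c i * a_vec n G i S)\<^sup>2)
    = (\<Sum>k\<in>?N. \<Sum>l\<in>?N. if k = l then 0 else (\<Sum>i\<in>?N. c i * (A i k * A i l))\<^sup>2) / 2"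
    unfolding sum_pairs
    by (intro arg_cong2[where f = "(/)"] sum.cong refl if_cong arg_cong[where f = "\<lambda>z. z\<^sup>2"])
       (simp add: a_vec_pair A_def)
  also have "(\<Sum>k\<in>?N. \<Sum>l\<in>?N. if k = l then 0 else (\<Sum>i\<in>?N. c i * (A i k * A i l))\<^sup>2)
     = (\<Sum>k\<in>?N. \<Sum>l\<in>?N. \<Sum>i\<in>?N. \<Sum>j\<in>?N. if k = l then 0 else F i j k l)"
  proof (rule sum.cong[OF refl], rule sum.cong[OF refl])
    fix k l
    show "(if k = l then 0 else (\<Sum>i\<in>?N. c i * (A i k * A i l))\<^sup>2) = (\<Sum>i\<in>?N. \<Sum>j\<in>?N. if k = l then 0 else F i j k l)"
      unfolding power2_eq_square sum_product F_def by (auto intro!: sum.cong simp: mult_ac)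
  qed
  also have "\<dots> = (\<Sum>k\<in>?N. \<Sum>i\<in>?N. \<Sum>l\<in>?N. \<Sum>j\<in>?N. if k = l then 0 else F i j k l)"
    by (intro sum.cong refl sum.swap)
  also have "\<dots> = (\<Sum>i\<in>?N. \<Sum>k\<in>?N. \<Sum>l\<in>?N. \<Sum>j\<in>?N. if k = l then 0 else F i j k l)"
    by (rule sum.swap)
  also have "\<dots> = (\<Sum>i\<in>?N. \<Sum>k\<in>?N. \<Sum>j\<in>?N. \<Sum>l\<in>?N. if k = l then 0 else F i j k l)"
    by (intro sum.cong refl sum.swap)
  also have "\<dots> = (\<Sum>i\<in>?N. \<Sum>j\<in>?N. \<Sum>k\<in>?N. \<Sum>l\<in>?N. if k = l then 0 else F i j k l)"
    by (intro sum.cong refl sum.swap)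
  \<comment> \<open>For \<open>i \<noteq> j\<close> a coincidence of \<open>i\<close> or
    \<open>j\<close> with \<open>k\<close> or \<open>l\<close> produces a diagonal sign, which is
    zero.\<close>
  also have "\<dots> = (\<Sum>i\<in>?N. \<Sum>j\<in>?N. \<Sum>k\<in>?N. \<Sum>l\<in>?N.
      (if distinct [i, j, k, l] then F i j k l else 0) + (if i = j then (if k = l then 0 else F i i k l) else 0))"
    by (intro sum.cong refl) (auto simp: F_def A0)
  also have "\<dots> = dsum4 n F + (\<Sum>i\<in>?N. \<Sum>j\<in>?N. \<Sum>k\<in>?N. \<Sum>l\<in>?N. if i = j then (if k = l then 0 else F i i k l) else 0)"
    unfolding dsum4_def by (simp only: sum.distrib)
  also have "(\<Sum>i\<in>?N. \<Sum>j\<in>?N. \<Sum>k\<in>?N. \<Sum>l\<in>?N. if i = j then (if k = l then 0 else F i i k l) else 0)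
     = (real n - 1) * (real n - 2) * (\<Sum>i\<in>?N. (c i)\<^sup>2)"
  proof -
    have "(\<Sum>j\<in>?N. \<Sum>k\<in>?N. \<Sum>l\<in>?N. if i = j then (if k = l then 0 else F i i k l) else 0)
       = (real n - 1) * (real n - 2) * (c i)\<^sup>2" if i: "i \<in> ?N" for i
    proof -
      have "(\<Sum>j\<in>?N. \<Sum>k\<in>?N. \<Sum>l\<in>?N. if i = j then (if k = l then 0 else F i i k l) else 0)
        = (\<Sum>j\<in>?N. if i = j then (\<Sum>k\<in>?N. \<Sum>l\<in>?N. if k = l then 0 else F i i k l) else 0)"
        by (intro sum.cong refl) simp
      also have "\<dots> = (\<Sum>k\<in>?N. \<Sum>l\<in>?N. if k = l then 0 else F i i k l)" using i by simp
      also have "\<dots> = (\<Sum>k\<in>?N. \<Sum>l\<in>?N. (c i)\<^sup>2 * (if k \<noteq> i \<and> l \<noteq> i \<and> k \<noteq> l then 1 else 0))"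
      proof (intro sum.cong refl)
        fix k l
        show "(if k = l then 0 else F i i k l) = (c i)\<^sup>2 * (if k \<noteq> i \<and> l \<noteq> i \<and> k \<noteq> l then 1 else 0)"
          using A1[of i k] A1[of i l] by (auto simp: F_def A0 power2_eq_square mult_ac)
      qed
      also have "\<dots> = (c i)\<^sup>2 * (\<Sum>k\<in>?N. \<Sum>l\<in>?N. if k \<noteq> i \<and> l \<noteq> i \<and> k \<noteq> l then 1 else 0)"
        by (simp only: sum_distrib_left)
      also have "(\<Sum>k\<in>?N. \<Sum>l\<in>?N. if k \<noteq> i \<and> l \<noteq> i \<and> k \<noteq> l then 1 else 0 :: real)
         = (\<Sum>k\<in>?N. (real n - 2) - (if k = i then real n - 2 else 0))"
      proof (intro sum.cong refl)
        fix k assume k: "k \<in> ?N"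
        show "(\<Sum>l\<in>?N. if k \<noteq> i \<and> l \<noteq> i \<and> k \<noteq> l then 1 else 0 :: real) = (real n - 2) - (if k = i then real n - 2 else 0)"
        proof (cases "k = i")
          case True
          then show ?thesis by simp
        next
          case False
          have "(\<Sum>l\<in>?N. if k \<noteq> i \<and> l \<noteq> i \<and> k \<noteq> l then 1 else 0 :: real)
             = (\<Sum>l\<in>?N. 1 - (if l = i then 1 else 0) - (if l = k then 1 else 0))"
            using False by (intro sum.cong refl) auto
          also have "\<dots> = real n - 2" using i k by (simp add: sum_subtractf)
          finally show ?thesis using False by simp
        qed
      qed
      also have "\<dots> = (real n - 1) * (real n - 2)"
      proof -
        have "(\<Sum>k\<in>?N. (real n - 2) - (if k = i then real n - 2 else 0)) = real n * (real n - 2) - (real n - 2)"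
          using i by (simp add: sum_subtractf)
        then show ?thesis by (simp add: left_diff_distrib)
      qed
      finally show ?thesis by (simp only: mult_ac)
    qed
    then show ?thesis unfolding sum_distrib_left by (intro sum.cong refl)
  qed
  finally have eq: "(\<Sum>S\<in>pairs n. (\<Sum>i\<in>?N. c i * a_vec n G i S)\<^sup>2)
     = (dsum4 n F + (real n - 1) * (real n - 2) * (\<Sum>i\<in>?N. (c i)\<^sup>2)) / 2" .
  have "\<bar>dsum4 n F\<bar> \<le> K * ln (real n) ^ 8 * sqrt (real n ^ 3) * L2_set c ?N * L2_set c ?N"
    unfolding F_def A_def by (rule good_gram[OF good])
  also have "\<dots> = K * ln (real n) ^ 8 * sqrt (real n ^ 3) * (\<Sum>i\<in>?N. (c i)\<^sup>2)"
    unfolding L2_set_power2[symmetric] by (simp only: power2_eq_square mult.assoc)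
  finally have "- (K * ln (real n) ^ 8 * sqrt (real n ^ 3) * (\<Sum>i\<in>?N. (c i)\<^sup>2)) \<le> dsum4 n F" by linarith
  then show ?thesis unfolding eq by (simp add: field_simps)
qed

section \<open>The quadratic form of the corrected matrix and bounds for its random parts\<close>

lemma H22_decomp: "H22 \<alpha> G S T = EH22 n \<alpha> S T + Q_mat n \<alpha> G S T + K_mat n \<alpha> G S T"
  by (simp add: K_mat_def)

lemma diag_conj:
  assumes "finite I" "S \<in> I" "T \<in> I"
  shows "mat_mult_on I (mat_mult_on I (diag_mat v) M) (diag_mat v) S T = v S * M S T * v T"
proof -
  have 1: "mat_mult_on I (diag_mat v) M S C = v S * M S C" for C
  proof -
    have "mat_mult_on I (diag_mat v) M S C = (\<Sum>D\<in>I. if S = D then v S * M S C else 0)"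
      unfolding mat_mult_on_def diag_mat_def by (intro sum.cong refl) auto
    then show ?thesis using assms by simp
  qed
  have "mat_mult_on I (mat_mult_on I (diag_mat v) M) (diag_mat v) S T = (\<Sum>C\<in>I. if C = T then v S * M S T * v T else 0)"
    unfolding mat_mult_on_def[of I "mat_mult_on I (diag_mat v) M"] 1 diag_mat_def by (intro sum.cong refl) auto
  then show ?thesis using assms by simp
qed

text \<open>Subtracting \<open>K_mat\<close> before conjugating leaves only the expectation,
  \<open>Q_mat\<close> and a multiple of the all-ones matrix between the factors
  \<open>D\<^sub>i\<close>.\<close>

lemma H22'_entry:
  assumes "S \<in> pairs n" "T \<in> pairs n"
  shows "H22' n \<alpha> \<beta> G S T = EH22 n \<alpha> S T + Q_mat n \<alpha> G S T + K_mat n \<alpha> G S T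
    + \<beta> * (\<Sum>i\<in>{1..n}. a_vec n G i S * (EH22 n \<alpha> S T + Q_mat n \<alpha> G S T + (\<alpha> 2)\<^sup>2 / 16) * a_vec n G i T)"
  unfolding H22'_def diag_conj[OF finite_pairs assms] H22_decomp[of \<alpha> G S T n] by (simp add: add.assoc)

lemma qform_add: "qform n (\<lambda>S T. M S T + L S T) x = qform n M x + qform n L x"
  unfolding qform_def sum.distrib[symmetric] by (intro sum.cong refl) (simp add: algebra_simps)

lemma qform_scale: "qform n (\<lambda>S T. s * M S T) x = s * qform n M x"
  unfolding qform_def sum_distrib_left by (intro sum.cong refl) (simp add: mult_ac)

lemma qform_diff: "qform n (\<lambda>S T. M S T - L S T) x = qform n M x - qform n L x"
  unfolding qform_def sum_subtractf[symmetric] by (intro sum.cong refl) (simp add: algebra_simps)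

lemma qform_H22':
  "qform n (H22' n \<alpha> \<beta> G) x = qform n (EH22 n \<alpha>) x + qform n (Q_mat n \<alpha> G) x + qform n (K_mat n \<alpha> G) x
    + \<beta> * ((\<Sum>i\<in>{1..n}. qform n (EH22 n \<alpha>) (\<lambda>S. a_vec n G i S * x S))
      + (\<Sum>i\<in>{1..n}. qform n (Q_mat n \<alpha> G) (\<lambda>S. a_vec n G i S * x S))
      + (\<alpha> 2)\<^sup>2 / 16 * (\<Sum>i\<in>{1..n}. (\<Sum>S\<in>pairs n. a_vec n G i S * x S)\<^sup>2))"
proof -
  let ?P = "pairs n" and ?N = "{1..n}"
  let ?M = "\<lambda>S T. EH22 n \<alpha> S T + Q_mat n \<alpha> G S T + (\<alpha> 2)\<^sup>2 / 16"
  have "qform n (H22' n \<alpha> \<beta> G) x = qform n (\<lambda>S T. (EH22 n \<alpha> S T + Q_mat n \<alpha> G S T + K_mat n \<alpha> G S T)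
    + \<beta> * (\<Sum>i\<in>?N. a_vec n G i S * ?M S T * a_vec n G i T)) x"
    unfolding qform_def by (intro sum.cong refl) (simp add: H22'_entry)
  also have "\<dots> = qform n (EH22 n \<alpha>) x + qform n (Q_mat n \<alpha> G) x + qform n (K_mat n \<alpha> G) x
    + \<beta> * qform n (\<lambda>S T. \<Sum>i\<in>?N. a_vec n G i S * ?M S T * a_vec n G i T) x"
    by (simp only: qform_add qform_scale)
  also have "qform n (\<lambda>S T. \<Sum>i\<in>?N. a_vec n G i S * ?M S T * a_vec n G i T) x
    = (\<Sum>i\<in>?N. qform n ?M (\<lambda>S. a_vec n G i S * x S))"
  proof -
    have "qform n (\<lambda>S T. \<Sum>i\<in>?N. a_vec n G i S * ?M S T * a_vec n G i T) x
      = (\<Sum>S\<in>?P. \<Sum>T\<in>?P. \<Sum>i\<in>?N. (a_vec n G i S * x S) * ?M S T * (a_vec n G i T * x T))"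
      unfolding qform_def sum_distrib_left sum_distrib_right by (intro sum.cong refl) (simp only: mult_ac)
    also have "\<dots> = (\<Sum>S\<in>?P. \<Sum>i\<in>?N. \<Sum>T\<in>?P. (a_vec n G i S * x S) * ?M S T * (a_vec n G i T * x T))"
      by (intro sum.cong refl sum.swap)
    also have "\<dots> = (\<Sum>i\<in>?N. \<Sum>S\<in>?P. \<Sum>T\<in>?P. (a_vec n G i S * x S) * ?M S T * (a_vec n G i T * x T))"
      by (rule sum.swap)
    finally show ?thesis unfolding qform_def .
  qed
  also have "\<dots> = (\<Sum>i\<in>?N. qform n (EH22 n \<alpha>) (\<lambda>S. a_vec n G i S * x S)
     + qform n (Q_mat n \<alpha> G) (\<lambda>S. a_vec n G i S * x S) + (\<alpha> 2)\<^sup>2 / 16 * (\<Sum>S\<in>?P. a_vec n G i S * x S)\<^sup>2)"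
  proof (intro sum.cong refl)
    fix i
    have "qform n (\<lambda>S T. (\<alpha> 2)\<^sup>2 / 16) y = (\<alpha> 2)\<^sup>2 / 16 * (\<Sum>S\<in>?P. y S)\<^sup>2" for y
    proof -
      have sq: "(\<Sum>S\<in>?P. y S)\<^sup>2 = (\<Sum>S\<in>?P. \<Sum>T\<in>?P. y S * y T)"
        unfolding power2_eq_square sum_product ..
      show ?thesis unfolding qform_def sq sum_distrib_left by (intro sum.cong refl) (simp only: mult_ac)
    qed
    then show "qform n ?M (\<lambda>S. a_vec n G i S * x S) = qform n (EH22 n \<alpha>) (\<lambda>S. a_vec n G i S * x S)
     + qform n (Q_mat n \<alpha> G) (\<lambda>S. a_vec n G i S * x S) + (\<alpha> 2)\<^sup>2 / 16 * (\<Sum>S\<in>?P. a_vec n G i S * x S)\<^sup>2"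
      by (simp only: qform_add)
  qed
  finally show ?thesis by (simp only: sum.distrib sum_distrib_left)
qed

text \<open>For fixed \<open>k\<close> the inner sum is the form of the sign matrix at row
  \<open>k\<close> of \<open>pair_fun x\<close>.\<close>

lemma qform_K_bound:
  assumes good: "good K n G" and a: "0 \<le> \<alpha> 3"
  shows "\<bar>qform n (K_mat n \<alpha> G) x\<bar> \<le> \<alpha> 3 / 2 * (K * ln (real n) * sqrt (real n)) * (hs_norm n (pair_fun x))\<^sup>2"
proof -
  let ?N = "{1..n}" and ?B = "K * ln (real n) * sqrt (real n)"
  define X where "X = pair_fun x"
  have "\<bar>\<Sum>k\<in>?N. \<Sum>l\<in>?N. \<Sum>q\<in>?N. X k l * X k q * adj_sign G l q\<bar>
    \<le> (\<Sum>k\<in>?N. \<bar>\<Sum>l\<in>?N. \<Sum>q\<in>?N. X k l * X k q * adj_sign G l q\<bar>)" by (rule sum_abs)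
  also have "\<dots> \<le> (\<Sum>k\<in>?N. ?B * (\<Sum>l\<in>?N. (X k l)\<^sup>2))"
  proof (rule sum_mono)
    fix k
    show "\<bar>\<Sum>l\<in>?N. \<Sum>q\<in>?N. X k l * X k q * adj_sign G l q\<bar> \<le> ?B * (\<Sum>l\<in>?N. (X k l)\<^sup>2)"
      using good_edge[OF good, of "X k" "X k"]
      unfolding L2_set_power2[symmetric] by (simp only: power2_eq_square mult.assoc)
  qed
  also have "\<dots> = ?B * (hs_norm n X)\<^sup>2" unfolding sum_sq_eq_hs[symmetric] sum_distrib_left ..
  finally have "\<alpha> 3 / 2 * \<bar>\<Sum>k\<in>?N. \<Sum>l\<in>?N. \<Sum>q\<in>?N. X k l * X k q * adj_sign G l q\<bar>
     \<le> \<alpha> 3 / 2 * (?B * (hs_norm n X)\<^sup>2)"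
    using a by (intro mult_left_mono) auto
  then show ?thesis unfolding qform_K X_def using a by (simp add: abs_mult mult.assoc)
qed

text \<open>Summing over \<open>i\<close> turns the diagonal factors into the weight
  \<open>t\<close>. Terms with \<open>i\<close> among the other indices vanish, so every class
  becomes a five-vertex template; the class sizes add up to 15.\<close>

lemma qform_DQ_bound:
  assumes good: "good K n G" and a: "0 \<le> \<alpha> 4"
  shows "\<bar>\<Sum>i\<in>{1..n}. qform n (Q_mat n \<alpha> G) (\<lambda>S. a_vec n G i S * x S)\<bar>
    \<le> \<alpha> 4 / 64 * (15 * (K * ln (real n) ^ 8 * sqrt (real n ^ 3)) * (hs_norm n (pair_fun x))\<^sup>2)"
proof -
  let ?N = "{1..n}" and ?B = "K * ln (real n) ^ 8 * sqrt (real n ^ 3)"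
  define A where "A = adj_sign G"
  define X where "X = pair_fun x"
  define R where "R k l p q = (1 + A k p) * (1 + A k q) * (1 + A l p) * (1 + A l q) - 1" for k l p q
  define t where "t k l p q = (\<Sum>i\<in>?N. A k i * A l i * A p i * A q i)" for k l p q
  have As: "A k l = A l k" for k l unfolding A_def by (rule adj_sign_sym)
  have A0: "A k k = 0" for k unfolding A_def by (rule adj_sign_diag)
  have Xs: "X k l = X l k" for k l unfolding X_def by (rule pair_fun_sym)
  define T where "T P = dsum4 n (\<lambda>k l p q. X k l * X p q * (P k l p q * t k l p q))" for P
  have 1: "(\<Sum>i\<in>?N. qform n (Q_mat n \<alpha> G) (\<lambda>S. a_vec n G i S * x S)) = \<alpha> 4 / 64 * T R"
  proof -
    have "(\<Sum>i\<in>?N. qform n (Q_mat n \<alpha> G) (\<lambda>S. a_vec n G i S * x S))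
      = \<alpha> 4 / 64 * (\<Sum>i\<in>?N. dsum4 n (\<lambda>k l p q. X k l * X p q * (R k l p q * (a_vec n G i {k, l} * a_vec n G i {p, q}))))"
      unfolding qform_Q_weighted A_def[symmetric] X_def[symmetric] R_def sum_distrib_left ..
    also have "(\<Sum>i\<in>?N. dsum4 n (\<lambda>k l p q. X k l * X p q * (R k l p q * (a_vec n G i {k, l} * a_vec n G i {p, q})))) = T R"
    proof -
      let ?f = "\<lambda>i k l p q. if distinct [k, l, p, q] then X k l * X p q * (R k l p q * (a_vec n G i {k, l} * a_vec n G i {p, q})) else 0"
      have "(\<Sum>i\<in>?N. \<Sum>k\<in>?N. \<Sum>l\<in>?N. \<Sum>p\<in>?N. \<Sum>q\<in>?N. ?f i k l p q) = (\<Sum>k\<in>?N. \<Sum>i\<in>?N. \<Sum>l\<in>?N. \<Sum>p\<in>?N. \<Sum>q\<in>?N. ?f i k l p q)"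
        by (rule sum.swap)
      also have "\<dots> = (\<Sum>k\<in>?N. \<Sum>l\<in>?N. \<Sum>i\<in>?N. \<Sum>p\<in>?N. \<Sum>q\<in>?N. ?f i k l p q)"
        by (intro sum.cong refl sum.swap)
      also have "\<dots> = (\<Sum>k\<in>?N. \<Sum>l\<in>?N. \<Sum>p\<in>?N. \<Sum>i\<in>?N. \<Sum>q\<in>?N. ?f i k l p q)"
        by (intro sum.cong refl sum.swap)
      also have "\<dots> = (\<Sum>k\<in>?N. \<Sum>l\<in>?N. \<Sum>p\<in>?N. \<Sum>q\<in>?N. \<Sum>i\<in>?N. ?f i k l p q)"
        by (intro sum.cong refl sum.swap)
      also have "\<dots> = T R" unfolding T_def dsum4_def
      proof (rule sum.cong[OF refl], rule sum.cong[OF refl], rule sum.cong[OF refl], rule sum.cong[OF refl])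
        fix k l p q assume m: "k \<in> ?N" "l \<in> ?N" "p \<in> ?N" "q \<in> ?N"
        show "(\<Sum>i\<in>?N. ?f i k l p q) = (if distinct [k, l, p, q] then X k l * X p q * (R k l p q * t k l p q) else 0)"
        proof (cases "distinct [k, l, p, q]")
          case False
          then show ?thesis by (simp only: if_False sum.neutral_const)
        next
          case True
          have "(\<Sum>i\<in>?N. ?f i k l p q) = (\<Sum>i\<in>?N. X k l * X p q * (R k l p q * (A k i * A l i * A p i * A q i)))"
            using True m a_vec_pair[of k n l G] a_vec_pair[of p n q G]
            by (intro sum.cong refl) (simp add: As A_def[symmetric])
          then show ?thesis using True unfolding t_def sum_distrib_left by simp
        qed
      qed
      finally show ?thesis unfolding dsum4_def .
    qed
    finally show ?thesis .
  qed
  have 2: "T R = 4 * T (\<lambda>k l p q. A k p) + 4 * T (\<lambda>k l p q. A k p * A k q) + 2 * T (\<lambda>k l p q. A k p * A l q)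
     + 4 * T (\<lambda>k l p q. A k p * A k q * A l q) + T (\<lambda>k l p q. A k p * A k q * A l p * A l q)"
    unfolding T_def R_def
  proof (rule expand_cycles[OF Xs As])
    show "t k l p q = t l k p q" "t k l p q = t k l q p" "t k l p q = t p q k l" for k l p q
      unfolding t_def by (simp_all only: mult_ac)
  qed
  have 3: "T P = dsum5 n (\<lambda>k l p q i. X k l * X p q * (P k l p q * (A k i * A l i * A p i * A q i)))" for P
    unfolding T_def dsum5_conv
  proof (rule dsum4_cong)
    fix k l p q
    have tt: "t k l p q = (\<Sum>i\<in>?N. if i \<notin> {k, l, p, q} then A k i * A l i * A p i * A q i else 0)"
      unfolding t_def by (intro sum.cong refl) (auto simp: A0)
    show "X k l * X p q * (P k l p q * t k l p q) = (\<Sum>i\<in>?N. if i \<notin> {k, l, p, q}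
       then X k l * X p q * (P k l p q * (A k i * A l i * A p i * A q i)) else 0)"
      unfolding tt sum_distrib_left by (intro sum.cong refl) auto
  qed
  let ?h = "hs_norm n X"
  have b: "\<bar>T (\<lambda>k l p q. A k p)\<bar> \<le> ?B * ?h * ?h" "\<bar>T (\<lambda>k l p q. A k p * A k q)\<bar> \<le> ?B * ?h * ?h"
    "\<bar>T (\<lambda>k l p q. A k p * A l q)\<bar> \<le> ?B * ?h * ?h" "\<bar>T (\<lambda>k l p q. A k p * A k q * A l q)\<bar> \<le> ?B * ?h * ?h"
    "\<bar>T (\<lambda>k l p q. A k p * A k q * A l p * A l q)\<bar> \<le> ?B * ?h * ?h"
    unfolding 3 unfolding A_def
    by (rule good5_a[OF good] good5_ab[OF good] good5_ad[OF good] good5_abd[OF good] good5_abcd[OF good])+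
  have "\<bar>T R\<bar> \<le> 15 * (?B * ?h * ?h)" unfolding 2 using b by linarith
  then have "\<alpha> 4 / 64 * \<bar>T R\<bar> \<le> \<alpha> 4 / 64 * (15 * (?B * ?h * ?h))" using a by (intro mult_left_mono) auto
  then show ?thesis unfolding 1 using a by (simp add: abs_mult X_def power2_eq_square mult.assoc)
qed

text \<open>The constant 27 collects the multiples of h^2: 4 * 3 from the single edges, where one
  part is the share of D h under the arithmetic-geometric mean, 4 * 2 from the paths, and 2 + 4 + 1
  from the templates with a separator of size two.\<close>

lemma qform_Q_bound:
  fixes G :: "nat set set" and x :: "nat set \<Rightarrow> real" and n :: nat
  assumes good: "good K n G" and a: "0 \<le> \<alpha> 4" and n: "n \<ge> 4" and K: "1 \<le> K"
  defines "D \<equiv> L2_set (\<lambda>k. \<Sum>l\<in>{1..n}. pair_fun x k l) {1..n}"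
    and "h \<equiv> hs_norm n (pair_fun x)"
    and "b \<equiv> L2_set (\<lambda>i. \<Sum>S\<in>pairs n. a_vec n G i S * x S) {1..n}"
  shows "\<bar>qform n (Q_mat n \<alpha> G) x\<bar> \<le> \<alpha> 4 / 64 * (8 * (K * ln (real n) * sqrt (real n)) * D\<^sup>2 + 8 * (D * b)
     + 27 * (K * ln (real n) ^ 8 * real n) * h\<^sup>2)"
proof -
  let ?N = "{1..n}"
  define A where "A = adj_sign G"
  define X where "X = pair_fun x"
  define d where "d = (\<lambda>k. \<Sum>l\<in>?N. X k l)"
  define B1 where "B1 = K * ln (real n) * sqrt (real n)"
  define B2 where "B2 = K * ln (real n) ^ 8 * real n"
  have dD: "D = L2_set d ?N" unfolding D_def d_def X_def ..
  have hX: "h = hs_norm n X" unfolding h_def X_def ..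
  have As: "A k l = A l k" for k l unfolding A_def by (rule adj_sign_sym)
  have A0: "A k k = 0" for k unfolding A_def by (rule adj_sign_diag)
  have A1: "\<bar>A k l\<bar> \<le> 1" for k l unfolding A_def by (rule adj_sign_le_1)
  have Xs: "X k l = X l k" for k l unfolding X_def by (rule pair_fun_sym)
  have X0: "X k k = 0" for k unfolding X_def by (rule pair_fun_diag)
  have ln1: "1 \<le> ln (real n)" using n by (rule ln_ge_1)
  have sq1: "1 \<le> sqrt (real n)" using n by simp
  have sqn: "sqrt (real n) \<le> real n" using n sqrt_le_D by (simp add: real_le_lsqrt power2_eq_square)
  have KL: "1 \<le> K * ln (real n)" using K ln1 mult_mono[of 1 K 1 "ln (real n)"] by simp
  have B1s: "sqrt (real n) \<le> B1" unfolding B1_def using KL sq1 mult_right_mono[OF KL, of "sqrt (real n)"] by simp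
  have B10: "0 \<le> B1" using B1s sq1 by linarith
  have "ln (real n) ^ 1 \<le> ln (real n) ^ 8" using ln1 by (intro power_increasing) auto
  then have "K * ln (real n) \<le> K * ln (real n) ^ 8" using K by (intro mult_left_mono) auto
  then have B12: "B1 \<le> B2" unfolding B1_def B2_def using sqn K ln1 by (intro mult_mono) auto
  define T where "T P = dsum4 n (\<lambda>k l p q. X k l * X p q * P k l p q)" for P
  have 1: "qform n (Q_mat n \<alpha> G) x = \<alpha> 4 / 64 * T (\<lambda>k l p q. (1 + A k p) * (1 + A k q) * (1 + A l p) * (1 + A l q) - 1)"
    using qform_Q_weighted[of n \<alpha> G "\<lambda>_. 1" x] unfolding T_def A_def X_def by simp
  have 2: "T (\<lambda>k l p q. (1 + A k p) * (1 + A k q) * (1 + A l p) * (1 + A l q) - 1)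
     = 4 * T (\<lambda>k l p q. A k p) + 4 * T (\<lambda>k l p q. A k p * A k q) + 2 * T (\<lambda>k l p q. A k p * A l q)
     + 4 * T (\<lambda>k l p q. A k p * A k q * A l q) + T (\<lambda>k l p q. A k p * A k q * A l p * A l q)"
    using expand_cycles[of X A "\<lambda>k l p q. 1" n, OF Xs As] unfolding T_def by simp
  have nrm: "\<bar>\<Sum>k\<in>?N. \<Sum>l\<in>?N. u k * v l * A k l\<bar> \<le> B1 * L2_set u ?N * L2_set v ?N" for u v
    unfolding A_def B1_def by (rule good_edge[OF good])
  have ta: "\<bar>T (\<lambda>k l p q. A k p)\<bar> \<le> B1 * D\<^sup>2 + 2 * sqrt (real n) * D * h + h\<^sup>2 + B1 * h\<^sup>2"
    unfolding T_def dD hX d_def by (rule edge_sum_bound[OF X0 Xs A0 A1 nrm])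
  have "\<bar>T (\<lambda>k l p q. A k p * A k q) - (\<Sum>k\<in>?N. d k * (\<Sum>p\<in>?N. \<Sum>q\<in>?N. X p q * (A k p * A k q)))\<bar> \<le> 2 * B1 * h\<^sup>2"
    unfolding T_def hX d_def by (rule path_sum_bound[OF X0 Xs A0 A1 nrm B10])
  moreover have "(\<Sum>k\<in>?N. d k * (\<Sum>p\<in>?N. \<Sum>q\<in>?N. X p q * (A k p * A k q)))
     = 2 * (\<Sum>k\<in>?N. d k * (\<Sum>S\<in>pairs n. a_vec n G k S * x S))"
  proof -
    have bk: "(\<Sum>p\<in>?N. \<Sum>q\<in>?N. X p q * (A k p * A k q)) = 2 * (\<Sum>S\<in>pairs n. a_vec n G k S * x S)" for k
    proof -
      have "(\<Sum>p\<in>?N. \<Sum>q\<in>?N. X p q * (A k p * A k q)) = (\<Sum>p\<in>?N. \<Sum>q\<in>?N. if p = q then 0 else a_vec n G k {p, q} * x {p, q})"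
        by (intro sum.cong refl) (simp add: X_def pair_fun_def A_def a_vec_pair)
      then show ?thesis unfolding sum_pairs by simp
    qed
    have "(\<Sum>k\<in>?N. d k * (2 * z k)) = 2 * (\<Sum>k\<in>?N. d k * z k)" for z :: "nat \<Rightarrow> real"
      by (simp add: sum_distrib_left mult.left_commute)
    then show ?thesis unfolding bk .
  qed
  moreover have "\<bar>\<Sum>k\<in>?N. d k * (\<Sum>S\<in>pairs n. a_vec n G k S * x S)\<bar> \<le> D * b"
  proof -
    have "\<bar>\<Sum>k\<in>?N. d k * (\<Sum>S\<in>pairs n. a_vec n G k S * x S)\<bar>
       \<le> (\<Sum>k\<in>?N. \<bar>d k\<bar> * \<bar>\<Sum>S\<in>pairs n. a_vec n G k S * x S\<bar>)"
      by (rule order_trans[OF sum_abs]) (simp add: abs_mult)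
    also have "\<dots> \<le> D * b" unfolding dD b_def by (rule L2_set_mult_ineq)
    finally show ?thesis .
  qed
  ultimately have tab: "\<bar>T (\<lambda>k l p q. A k p * A k q)\<bar> \<le> 2 * (D * b) + 2 * B1 * h\<^sup>2" by linarith
  have hh: "B2 * h * h = B2 * h\<^sup>2" by (simp add: power2_eq_square)
  have tad: "\<bar>T (\<lambda>k l p q. A k p * A l q)\<bar> \<le> B2 * h\<^sup>2"
    unfolding T_def hh[symmetric] unfolding B2_def hX A_def by (rule good4_ad[OF good])
  have tabd: "\<bar>T (\<lambda>k l p q. A k p * A k q * A l q)\<bar> \<le> B2 * h\<^sup>2"
    unfolding T_def hh[symmetric] unfolding B2_def hX A_def by (rule good4_abd[OF good])
  have tabcd: "\<bar>T (\<lambda>k l p q. A k p * A k q * A l p * A l q)\<bar> \<le> B2 * h\<^sup>2"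
    unfolding T_def hh[symmetric] unfolding B2_def hX A_def by (rule good4_abcd[OF good])
  have amgm: "2 * sqrt (real n) * D * h \<le> B1 * D\<^sup>2 + B1 * h\<^sup>2"
  proof -
    have "0 \<le> sqrt (real n) * (D - h)\<^sup>2" by simp
    then have "2 * sqrt (real n) * D * h \<le> sqrt (real n) * (D\<^sup>2 + h\<^sup>2)" by (simp add: power2_eq_square algebra_simps)
    also have "\<dots> \<le> B1 * (D\<^sup>2 + h\<^sup>2)" using B1s by (intro mult_right_mono) auto
    finally show ?thesis by (simp add: algebra_simps)
  qed
  have u1: "B1 * h\<^sup>2 \<le> B2 * h\<^sup>2" using B12 by (intro mult_right_mono) auto
  have "1 \<le> B2" using B12 B1s sq1 by linarith
  then have u2: "h\<^sup>2 \<le> B2 * h\<^sup>2" using mult_right_mono[of 1 B2 "h\<^sup>2"] by simp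
  have "\<bar>T (\<lambda>k l p q. (1 + A k p) * (1 + A k q) * (1 + A l p) * (1 + A l q) - 1)\<bar>
     \<le> 8 * (B1 * D\<^sup>2) + 8 * (D * b) + 27 * (B2 * h\<^sup>2)"
    unfolding 2 using ta tab tad tabd tabcd amgm u1 u2 by linarith
  then have "\<alpha> 4 / 64 * \<bar>T (\<lambda>k l p q. (1 + A k p) * (1 + A k q) * (1 + A l p) * (1 + A l q) - 1)\<bar>
     \<le> \<alpha> 4 / 64 * (8 * (B1 * D\<^sup>2) + 8 * (D * b) + 27 * (B2 * h\<^sup>2))"
    using a by (intro mult_left_mono) auto
  then show ?thesis unfolding 1 B1_def B2_def using a by (simp add: abs_mult mult.assoc)
qed

section \<open>The deterministic inequality\<close>

lemma edge_ind_sym: "edge_ind G i j = edge_ind G j i"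
  by (simp add: edge_ind_def insert_commute)

lemma H22_sym: "H22 \<alpha> G S T = H22 \<alpha> G T S"
proof -
  have "(\<Prod>i\<in>S - T. \<Prod>j\<in>T - S. edge_ind G i j) = (\<Prod>j\<in>T - S. \<Prod>i\<in>S - T. edge_ind G i j)"
    by (rule prod.swap)
  also have "\<dots> = (\<Prod>j\<in>T - S. \<Prod>i\<in>S - T. edge_ind G j i)"
    by (intro prod.cong refl edge_ind_sym)
  finally show ?thesis unfolding H22_def N_mat_def rank1_mat_def by (simp add: Un_commute mult.commute)
qed

lemma EH22_sym: "EH22 n \<alpha> S T = EH22 n \<alpha> T S"
  unfolding EH22_def by (subst H22_sym) rule

lemma Q_mat_sym: "Q_mat n \<alpha> G S T = Q_mat n \<alpha> G T S"
  unfolding Q_mat_def using H22_sym[of \<alpha> G S T] EH22_sym[of n \<alpha> S T] by (simp add: Int_commute)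

lemma K_mat_sym: "K_mat n \<alpha> G S T = K_mat n \<alpha> G T S"
  unfolding K_mat_def using H22_sym[of \<alpha> G S T] EH22_sym[of n \<alpha> S T] Q_mat_sym[of n \<alpha> G S T] by simp

lemma H22'_sym:
  assumes "S \<in> pairs n" "T \<in> pairs n"
  shows "H22' n \<alpha> \<beta> G S T = H22' n \<alpha> \<beta> G T S"
  unfolding H22'_entry[OF assms] H22'_entry[OF assms(2,1)]
    EH22_sym[of n \<alpha> S T] Q_mat_sym[of n \<alpha> G S T] K_mat_sym[of n \<alpha> G S T]
  by (simp only: mult_ac)

lemma good_mono: "good K n G \<Longrightarrow> K \<le> K' \<Longrightarrow> n \<ge> 4 \<Longrightarrow> good K' n G"
  unfolding good_def by (auto intro: ibound_mono)

text \<open>By assumption the random part costs at most n^2/8, and \<open>n \<ge> 12\<close> ensures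
  that (n-1)(n-2)/2 is at least 3 n^2/8.\<close>

lemma gram_quarter:
  assumes good: "good K n G" and n: "n \<ge> 12" and K: "K * ln (real n) ^ 8 \<le> sqrt (real n) / 4"
  shows "(real n)\<^sup>2 / 4 * (\<Sum>i\<in>{1..n}. (c i)\<^sup>2) \<le> (\<Sum>S\<in>pairs n. (\<Sum>i\<in>{1..n}. c i * a_vec n G i S)\<^sup>2)"
proof -
  have s3: "sqrt (real n ^ 3) = real n * sqrt (real n)"
    by (simp add: power3_eq_cube real_sqrt_mult)
  have "K * ln (real n) ^ 8 * sqrt (real n ^ 3) \<le> sqrt (real n) / 4 * (real n * sqrt (real n))"
    unfolding s3 using K by (intro mult_right_mono) auto
  also have "\<dots> = (real n)\<^sup>2 / 4" by (simp add: power2_eq_square)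
  finally have 1: "K * ln (real n) ^ 8 * sqrt (real n ^ 3) \<le> (real n)\<^sup>2 / 4" .
  have "12 * real n \<le> real n * real n" using n by (intro mult_right_mono) auto
  then have "(real n)\<^sup>2 / 4 \<le> (real n - 1) * (real n - 2) / 2 - K * ln (real n) ^ 8 * sqrt (real n ^ 3) / 2"
    using 1 by (simp add: power2_eq_square algebra_simps)
  then have "(real n)\<^sup>2 / 4 * (\<Sum>i\<in>{1..n}. (c i)\<^sup>2)
    \<le> ((real n - 1) * (real n - 2) / 2 - K * ln (real n) ^ 8 * sqrt (real n ^ 3) / 2) * (\<Sum>i\<in>{1..n}. (c i)\<^sup>2)"
    by (intro mult_right_mono) (auto simp: sum_nonneg)
  also have "\<dots> \<le> (\<Sum>S\<in>pairs n. (\<Sum>i\<in>{1..n}. c i * a_vec n G i S)\<^sup>2)" by (rule gram_lower[OF good])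
  finally show ?thesis .
qed

text \<open>All error terms are absorbed by the three nonnegative quantities \<open>D\<^sup>2\<close> (degrees), \<open>b\<^sup>2\<close>
  (correlation with the \<open>a\<^sub>i\<close>) and \<open>h\<^sup>2\<close> (length); the cross term \<open>D b\<close>, which comes from two template
  edges meeting in a vertex, is what the correction with the \<open>D\<^sub>i\<close> is made for.\<close>

lemma loewner_deterministic:
  assumes good: "good K n G" and n: "n \<ge> 12" and K: "1 \<le> K" and \<beta>: "0 < \<beta>"
    and a: "0 \<le> \<alpha> 2" "0 \<le> \<alpha> 3" "0 \<le> \<alpha> 4"
    and h1: "(\<alpha> 2)\<^sup>2 \<le> \<alpha> 4 / 32" and h2: "\<alpha> 4 \<le> 4 * \<alpha> 3" and h3: "2 * \<alpha> 3 \<le> \<alpha> 2"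
    and h4: "\<alpha> 4 / (4 * \<beta>) + \<alpha> 4 / 8 * (K * ln (real n) * sqrt (real n)) \<le> 7 / 32 * \<alpha> 3"
    and h5: "27 / 64 * \<alpha> 4 * (K * ln (real n) ^ 8 * real n) + \<alpha> 3 / 2 * (K * ln (real n) * sqrt (real n))
       + 15 / 64 * \<beta> * \<alpha> 4 * (K * ln (real n) ^ 8 * sqrt (real n ^ 3)) + \<beta> * (\<alpha> 2 + real n * \<alpha> 3) / 32 \<le> 7 / 32 * \<alpha> 2"
    and h6: "K * ln (real n) ^ 8 \<le> sqrt (real n) / 4"
  shows "loewner_le_on (pairs n) (\<lambda>A B. 1/8 * EH22 n \<alpha> A B + \<beta> * lambda0 n \<alpha> / 16 * Pi_W n G A B) (H22' n \<alpha> \<beta> G)"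
  unfolding loewner_le_on_def psd_on_def
proof (intro conjI ballI allI)
  fix S T assume ST: "S \<in> pairs n" "T \<in> pairs n"
  show "H22' n \<alpha> \<beta> G S T - (1/8 * EH22 n \<alpha> S T + \<beta> * lambda0 n \<alpha> / 16 * Pi_W n G S T)
      = H22' n \<alpha> \<beta> G T S - (1/8 * EH22 n \<alpha> T S + \<beta> * lambda0 n \<alpha> / 16 * Pi_W n G T S)"
    using H22'_sym[OF ST, of \<alpha> \<beta> G] EH22_sym[of n \<alpha> S T] Pi_W_sym[OF ST, of G] by simp
next
  fix x :: "nat set \<Rightarrow> real"
  let ?N = "{1..n}"
  define D where "D = L2_set (\<lambda>k. \<Sum>l\<in>?N. pair_fun x k l) ?N"
  define h where "h = hs_norm n (pair_fun x)"
  define b where "b = L2_set (\<lambda>i. \<Sum>S\<in>pairs n. a_vec n G i S * x S) ?N"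
  define p where "p = qform n (Pi_W n G) x"
  define L1 where "L1 = K * ln (real n) * sqrt (real n)"
  define L2 where "L2 = K * ln (real n) ^ 8 * real n"
  define L3 where "L3 = K * ln (real n) ^ 8 * sqrt (real n ^ 3)"
  define EE where "EE = qform n (EH22 n \<alpha>) x"
  define ED where "ED = (\<Sum>i\<in>?N. qform n (EH22 n \<alpha>) (\<lambda>S. a_vec n G i S * x S))"
  define QQ where "QQ = qform n (Q_mat n \<alpha> G) x"
  define QD where "QD = (\<Sum>i\<in>?N. qform n (Q_mat n \<alpha> G) (\<lambda>S. a_vec n G i S * x S))"
  define KK where "KK = qform n (K_mat n \<alpha> G) x"
  have bb: "(\<Sum>i\<in>?N. (\<Sum>S\<in>pairs n. a_vec n G i S * x S)\<^sup>2) = b\<^sup>2" unfolding b_def L2_set_power2 ..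
  have e0: "\<alpha> 4 / 32 \<le> \<alpha> 4 / 16 - (\<alpha> 2)\<^sup>2" using h1 by linarith
  have e1: "\<alpha> 3 / 4 \<le> \<alpha> 3 / 2 - \<alpha> 4 / 16" using h2 by linarith
  have e2: "\<alpha> 2 / 2 \<le> \<alpha> 2 - \<alpha> 3 + \<alpha> 4 / 16" using h3 a by linarith
  have e00: "0 \<le> \<alpha> 4 / 16 - (\<alpha> 2)\<^sup>2" using e0 a by linarith
  have e10: "0 \<le> \<alpha> 3 / 2 - \<alpha> 4 / 16" using e1 a by linarith
  have e20: "0 \<le> \<alpha> 2 - \<alpha> 3 + \<alpha> 4 / 16" using e2 a by linarith
  have EE: "\<alpha> 3 / 4 * D\<^sup>2 + \<alpha> 2 / 4 * h\<^sup>2 \<le> EE"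
  proof -
    have "0 \<le> (\<alpha> 4 / 16 - (\<alpha> 2)\<^sup>2) * (\<Sum>S\<in>pairs n. x S)\<^sup>2" using e00 by simp
    moreover have "\<alpha> 3 / 4 * D\<^sup>2 \<le> (\<alpha> 3 / 2 - \<alpha> 4 / 16) * D\<^sup>2" using e1 by (intro mult_right_mono) auto
    moreover have "\<alpha> 2 / 2 * (h\<^sup>2 / 2) \<le> (\<alpha> 2 - \<alpha> 3 + \<alpha> 4 / 16) * (h\<^sup>2 / 2)" using e2 by (intro mult_right_mono) auto
    ultimately show ?thesis unfolding EE_def qform_EH22 D_def[symmetric] h_def[symmetric] by linarith
  qed
  have ED: "\<alpha> 4 / 32 * b\<^sup>2 \<le> ED"
  proof -
    have "\<alpha> 4 / 32 * b\<^sup>2 \<le> (\<alpha> 4 / 16 - (\<alpha> 2)\<^sup>2) * b\<^sup>2" using e0 by (intro mult_right_mono) auto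
    also have "\<dots> = (\<Sum>i\<in>?N. (\<alpha> 4 / 16 - (\<alpha> 2)\<^sup>2) * (\<Sum>S\<in>pairs n. a_vec n G i S * x S)\<^sup>2)"
      unfolding bb[symmetric] by (rule sum_distrib_left)
    also have "\<dots> \<le> ED"
      unfolding ED_def
    proof (rule sum_mono)
      fix i
      show "(\<alpha> 4 / 16 - (\<alpha> 2)\<^sup>2) * (\<Sum>S\<in>pairs n. a_vec n G i S * x S)\<^sup>2 \<le> qform n (EH22 n \<alpha>) (\<lambda>S. a_vec n G i S * x S)"
        unfolding qform_EH22
        unfolding add.assoc le_add_same_cancel1
        by (intro add_nonneg_nonneg mult_nonneg_nonneg e10 e20) auto
    qed
    finally show ?thesis .
  qed
  have QQ: "\<bar>QQ\<bar> \<le> \<alpha> 4 / 64 * (8 * L1 * D\<^sup>2 + 8 * (D * b) + 27 * L2 * h\<^sup>2)"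
    unfolding QQ_def L1_def L2_def D_def b_def h_def by (rule qform_Q_bound[where \<alpha> = \<alpha>, OF good a(3) _ K]) (use n in simp)
  have QD: "\<bar>QD\<bar> \<le> \<alpha> 4 / 64 * (15 * L3 * h\<^sup>2)"
    unfolding QD_def L3_def h_def by (rule qform_DQ_bound[where \<alpha> = \<alpha>, OF good a(3)])
  have KK: "\<bar>KK\<bar> \<le> \<alpha> 3 / 2 * L1 * h\<^sup>2"
    unfolding KK_def L1_def h_def by (rule qform_K_bound[where \<alpha> = \<alpha>, OF good a(2)])
  have n0: "0 < real n" using n by simp
  have p0: "0 \<le> p" unfolding p_def by (rule qform_Pi_W_nonneg)
  have p1: "p \<le> h\<^sup>2 / 2" unfolding p_def h_def sum_squares_pairs[symmetric] by (rule qform_Pi_W_le)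
  have "p \<le> (\<Sum>i\<in>?N. (\<Sum>S\<in>pairs n. a_vec n G i S * x S)\<^sup>2) / ((real n)\<^sup>2 / 4)"
    unfolding p_def by (rule qform_Pi_W_le_gram[OF gram_quarter[OF good n h6]]) (use n0 in simp)
  then have p2: "(real n)\<^sup>2 * p \<le> 4 * b\<^sup>2" unfolding bb using n0 by (simp add: field_simps)
  have lam: "lambda0 n \<alpha> \<le> \<alpha> 2 + real n * \<alpha> 3 + (real n)\<^sup>2 / 32 * \<alpha> 4"
  proof -
    have "(real n - 2) * \<alpha> 3 \<le> real n * \<alpha> 3" using a by (intro mult_right_mono) auto
    moreover have "(real n - 2) * (real n - 3) / 32 * \<alpha> 4 \<le> (real n)\<^sup>2 / 32 * \<alpha> 4"
      using a n by (intro mult_right_mono) (auto simp: power2_eq_square algebra_simps)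
    moreover have "0 \<le> real n * (real n - 1) / 2 * (\<alpha> 2)\<^sup>2" using n by simp
    ultimately show ?thesis unfolding lambda0_def by linarith
  qed
  \<comment> \<open>The projection is estimated in two ways: its share of order n^2 by the Gram
    bound, which yields b^2, the remaining share by the length of \<open>x\<close>.\<close>
  have "lambda0 n \<alpha> * p \<le> (\<alpha> 2 + real n * \<alpha> 3) * (h\<^sup>2 / 2) + \<alpha> 4 / 8 * b\<^sup>2"
  proof -
    have "lambda0 n \<alpha> * p \<le> (\<alpha> 2 + real n * \<alpha> 3 + (real n)\<^sup>2 / 32 * \<alpha> 4) * p"
      using lam p0 by (intro mult_right_mono)
    also have "\<dots> = (\<alpha> 2 + real n * \<alpha> 3) * p + \<alpha> 4 / 32 * ((real n)\<^sup>2 * p)" by (simp add: algebra_simps)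
    also have "\<dots> \<le> (\<alpha> 2 + real n * \<alpha> 3) * (h\<^sup>2 / 2) + \<alpha> 4 / 32 * (4 * b\<^sup>2)"
      using p1 p2 a by (intro add_mono mult_left_mono) auto
    finally show ?thesis by (simp add: mult.commute)
  qed
  then have P: "\<beta> * (lambda0 n \<alpha> * p) \<le> \<beta> * ((\<alpha> 2 + real n * \<alpha> 3) * (h\<^sup>2 / 2) + \<alpha> 4 / 8 * b\<^sup>2)"
    using \<beta> by (intro mult_left_mono) auto
  \<comment> \<open>In units of \<beta> \<open>\<alpha> 4\<close> b^2 the conjugated expectation
    supplies 1/32. This step spends 1/64 of it and the projection 1/128.\<close>
  have amgm: "\<alpha> 4 / 8 * (D * b) \<le> \<beta> * (\<alpha> 4 / 64 * b\<^sup>2) + \<alpha> 4 / (4 * \<beta>) * D\<^sup>2"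
  proof -
    have "0 \<le> \<alpha> 4 * \<beta> / 64 * (b - 4 * D / \<beta>)\<^sup>2" using a \<beta> by simp
    also have "\<dots> = \<beta> * (\<alpha> 4 / 64 * b\<^sup>2) + \<alpha> 4 / (4 * \<beta>) * D\<^sup>2 - \<alpha> 4 / 8 * (D * b)"
      using \<beta> by (simp add: power2_eq_square field_simps)
    finally show ?thesis by linarith
  qed
  have D4: "(\<alpha> 4 / (4 * \<beta>) + \<alpha> 4 / 8 * L1) * D\<^sup>2 \<le> 7 / 32 * \<alpha> 3 * D\<^sup>2"
    unfolding L1_def by (rule mult_right_mono[OF h4]) simp
  have H5: "(27 / 64 * \<alpha> 4 * L2 + \<alpha> 3 / 2 * L1 + 15 / 64 * \<beta> * \<alpha> 4 * L3 + \<beta> * (\<alpha> 2 + real n * \<alpha> 3) / 32) * h\<^sup>2 \<le> 7 / 32 * \<alpha> 2 * h\<^sup>2"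
    unfolding L1_def L2_def L3_def by (rule mult_right_mono[OF h5]) simp
  have ED': "\<beta> * (\<alpha> 4 / 32 * b\<^sup>2) \<le> \<beta> * ED" using ED \<beta> by (intro mult_left_mono) auto
  have QD': "- (\<beta> * (\<alpha> 4 / 64 * (15 * L3 * h\<^sup>2))) \<le> \<beta> * QD"
  proof -
    have "\<beta> * (- (\<alpha> 4 / 64 * (15 * L3 * h\<^sup>2))) \<le> \<beta> * QD" using QD \<beta> by (intro mult_left_mono) auto
    then show ?thesis by simp
  qed
  have J0: "0 \<le> \<beta> * ((\<alpha> 2)\<^sup>2 / 16 * b\<^sup>2)" using \<beta> by simp
  have B0: "0 \<le> \<beta> * (\<alpha> 4 * b\<^sup>2)" using \<beta> a by simp
  have "(\<Sum>A\<in>pairs n. \<Sum>B\<in>pairs n. x A * (H22' n \<alpha> \<beta> G A B - (1/8 * EH22 n \<alpha> A B + \<beta> * lambda0 n \<alpha> / 16 * Pi_W n G A B)) * x B)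
    = qform n (\<lambda>A B. H22' n \<alpha> \<beta> G A B - (1/8 * EH22 n \<alpha> A B + \<beta> * lambda0 n \<alpha> / 16 * Pi_W n G A B)) x"
    unfolding qform_def ..
  also have "\<dots> = qform n (H22' n \<alpha> \<beta> G) x - (1/8 * EE + \<beta> * lambda0 n \<alpha> / 16 * p)"
    unfolding EE_def p_def by (simp only: qform_diff qform_add qform_scale)
  also have "qform n (H22' n \<alpha> \<beta> G) x = EE + QQ + KK + \<beta> * (ED + QD + (\<alpha> 2)\<^sup>2 / 16 * b\<^sup>2)"
    unfolding qform_H22' bb EE_def QQ_def KK_def ED_def QD_def ..
  finally have F: "(\<Sum>A\<in>pairs n. \<Sum>B\<in>pairs n. x A * (H22' n \<alpha> \<beta> G A B - (1/8 * EH22 n \<alpha> A B + \<beta> * lambda0 n \<alpha> / 16 * Pi_W n G A B)) * x B)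
    = 7/8 * EE + QQ + KK + \<beta> * ED + \<beta> * QD + \<beta> * ((\<alpha> 2)\<^sup>2 / 16 * b\<^sup>2) - 1/16 * (\<beta> * (lambda0 n \<alpha> * p))"
    by (simp add: algebra_simps)
  have QQ': "- (\<alpha> 4 / 8 * L1 * D\<^sup>2 + \<alpha> 4 / 8 * (D * b) + 27 / 64 * \<alpha> 4 * L2 * h\<^sup>2) \<le> QQ"
  proof -
    have "\<alpha> 4 / 64 * (8 * L1 * D\<^sup>2 + 8 * (D * b) + 27 * L2 * h\<^sup>2)
      = \<alpha> 4 / 8 * L1 * D\<^sup>2 + \<alpha> 4 / 8 * (D * b) + 27 / 64 * \<alpha> 4 * L2 * h\<^sup>2" by (simp add: field_simps)
    then show ?thesis using QQ by linarith
  qed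
  have D4': "\<alpha> 4 / (4 * \<beta>) * D\<^sup>2 + \<alpha> 4 / 8 * L1 * D\<^sup>2 \<le> 7 / 32 * \<alpha> 3 * D\<^sup>2"
    using D4 by (simp only: distrib_right)
  have H5': "27 / 64 * \<alpha> 4 * L2 * h\<^sup>2 + \<alpha> 3 / 2 * L1 * h\<^sup>2 + 15 / 64 * (\<beta> * (\<alpha> 4 * (L3 * h\<^sup>2)))
     + 1 / 32 * (\<beta> * ((\<alpha> 2 + real n * \<alpha> 3) * h\<^sup>2)) \<le> 7 / 32 * \<alpha> 2 * h\<^sup>2"
    using H5 by (simp add: distrib_right mult.assoc)
  have P': "1/16 * (\<beta> * (lambda0 n \<alpha> * p)) \<le> 1 / 32 * (\<beta> * ((\<alpha> 2 + real n * \<alpha> 3) * h\<^sup>2)) + 1 / 128 * (\<beta> * (\<alpha> 4 * b\<^sup>2))"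
    using P by (simp add: algebra_simps)
  have QD'': "- (15 / 64 * (\<beta> * (\<alpha> 4 * (L3 * h\<^sup>2)))) \<le> \<beta> * QD" using QD' by (simp add: mult_ac)
  have ED'': "1 / 32 * (\<beta> * (\<alpha> 4 * b\<^sup>2)) \<le> \<beta> * ED" using ED' by (simp add: mult_ac)
  have amgm': "\<alpha> 4 / 8 * (D * b) \<le> 1 / 64 * (\<beta> * (\<alpha> 4 * b\<^sup>2)) + \<alpha> 4 / (4 * \<beta>) * D\<^sup>2" using amgm by (simp add: mult_ac)
  \<comment> \<open>Subtracting 1/8 of the expectation leaves 7/8, and both coefficients in
    \<open>EE\<close> are quarters; this is the origin of 7/32 in \<open>h4\<close> and
    \<open>h5\<close>.\<close>
  have EE': "7 / 32 * \<alpha> 3 * D\<^sup>2 + 7 / 32 * \<alpha> 2 * h\<^sup>2 \<le> 7 / 8 * EE"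
    using EE by (simp add: field_simps)
  show "0 \<le> (\<Sum>A\<in>pairs n. \<Sum>B\<in>pairs n. x A * (H22' n \<alpha> \<beta> G A B - (1/8 * EH22 n \<alpha> A B + \<beta> * lambda0 n \<alpha> / 16 * Pi_W n G A B)) * x B)"
    unfolding F using EE' QQ' KK QD'' ED'' J0 P' D4' H5' amgm' B0 by linarith
qed

text \<open>With L = ln n and r = sqrt n, each step from \<open>\<alpha> 2\<close> to
  \<open>\<alpha> 3\<close> to \<open>\<alpha> 4\<close> gains a factor \<rho>/r times a power of L,
  with exponents 8 and 12. The powers of r then cancel or help in every condition, and the powers of
  L are beaten by \<rho>. The two delicate conditions keep a spare factor 1/L, which the lower bound
  on ln n makes small against the constants and \<open>K\<close>.\<close>

lemma parameters:
  fixes n :: nat and \<rho> \<beta> \<gamma> K :: real and \<alpha> :: "nat \<Rightarrow> real"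
  assumes n: "n \<ge> 12" and K: "1 \<le> K" and l: "200 + 10 * K \<le> ln (real n)"
    and \<beta>: "\<beta> = 1 / (100 * sqrt (real n) * ln (real n))" and \<gamma>: "\<gamma> = ln (real n) ^ 4"
    and \<rho>: "0 \<le> \<rho>" "\<rho> < 1 / ln (real n) ^ 20"
    and a2: "\<alpha> 2 = \<gamma> * \<rho>\<^sup>2 / real n"
    and a3: "\<alpha> 3 = \<gamma> ^ 3 * \<rho> ^ 3 / real n powr (3/2)"
    and a4: "\<alpha> 4 = \<gamma> ^ 6 * \<rho> ^ 4 / (real n)\<^sup>2"
  shows "0 < \<beta>" "0 \<le> \<alpha> 2" "0 \<le> \<alpha> 3" "0 \<le> \<alpha> 4"
    "(\<alpha> 2)\<^sup>2 \<le> \<alpha> 4 / 32" "\<alpha> 4 \<le> 4 * \<alpha> 3" "2 * \<alpha> 3 \<le> \<alpha> 2"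
    "\<alpha> 4 / (4 * \<beta>) + \<alpha> 4 / 8 * (K * ln (real n) * sqrt (real n)) \<le> 7 / 32 * \<alpha> 3"
    "27 / 64 * \<alpha> 4 * (K * ln (real n) ^ 8 * real n) + \<alpha> 3 / 2 * (K * ln (real n) * sqrt (real n))
       + 15 / 64 * \<beta> * \<alpha> 4 * (K * ln (real n) ^ 8 * sqrt (real n ^ 3)) + \<beta> * (\<alpha> 2 + real n * \<alpha> 3) / 32 \<le> 7 / 32 * \<alpha> 2"
proof -
  define L where "L = ln (real n)"
  define r where "r = sqrt (real n)"
  have n0: "0 < real n" using n by simp
  have r2: "real n = r\<^sup>2" unfolding r_def using n0 by simp
  have r0: "0 < r" unfolding r_def using n0 by simp
  have r3: "3 \<le> r" unfolding r_def using n by (intro real_le_rsqrt) simp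
  have L0: "200 \<le> L" and LK: "200 + 10 * K \<le> L" using l K unfolding L_def by auto
  have Lp: "0 < L" using L0 by simp
  have L1: "1 \<le> L" using L0 by simp
  have s3: "sqrt (real n ^ 3) = r ^ 3" unfolding r2 using r0 by (simp add: power_mult[symmetric] real_sqrt_unique)
  have p32: "real n powr (3/2) = r ^ 3"
  proof -
    have "real n powr (3/2) = (real n powr (1/2)) powr 3" by (simp add: powr_powr)
    also have "\<dots> = r ^ 3" unfolding r_def powr_half_sqrt[OF less_imp_le[OF n0]]
      using r0 by (simp add: r_def powr_numeral)
    finally show ?thesis .
  qed
  have \<beta>': "\<beta> = 1 / (100 * r * L)" unfolding \<beta> r_def L_def ..
  have g: "\<gamma> = L ^ 4" unfolding \<gamma> L_def ..
  have a2': "\<alpha> 2 = L ^ 4 * \<rho>\<^sup>2 / r\<^sup>2" unfolding a2 g r2 ..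
  have a3': "\<alpha> 3 = \<alpha> 2 * (L ^ 8 * \<rho>) / r"
    unfolding a3 g p32 a2' using r0
    by (simp add: field_simps power2_eq_square power3_eq_cube power_mult[symmetric] flip: power_add)
  have a4': "\<alpha> 4 = \<alpha> 3 * (L ^ 12 * \<rho>) / r"
    unfolding a4 g a3' a2' r2 using r0
    by (simp add: field_simps power2_eq_square eval_nat_numeral)
  have a42: "\<alpha> 4 = \<alpha> 2 * (L ^ 20 * \<rho>\<^sup>2) / r\<^sup>2"
    unfolding a4' a3' by (simp add: power2_eq_square flip: power_add)
  have \<rho>20: "L ^ 20 * \<rho> \<le> 1" using \<rho> Lp unfolding L_def[symmetric] by (simp add: field_simps)
  \<comment> \<open>An exponent of at most 19 leaves one power of L to spare below the exponent 20
    in the bound on \<rho>.\<close>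
  have pj: "L * (L ^ j * \<rho>) \<le> 1" if "j \<le> 19" for j
  proof -
    have "L ^ Suc j * \<rho> \<le> L ^ 20 * \<rho>" using that L1 \<rho> by (intro mult_right_mono power_increasing) auto
    then show ?thesis using \<rho>20 by (simp add: mult.assoc)
  qed
  have pjL: "L ^ j * \<rho> \<le> 1 / L" if "j \<le> 19" for j using pj[OF that] Lp by (simp add: field_simps)
  have pj0: "0 \<le> L ^ j * \<rho>" for j using Lp \<rho> by simp
  have iL: "1 / L \<le> 1 / 200" using L0 Lp by (simp add: field_simps)
  have KL: "K / L \<le> 1 / 10" using LK Lp K by (simp add: field_simps)
  show b0: "0 < \<beta>" unfolding \<beta>' using r0 Lp by simp
  show A2: "0 \<le> \<alpha> 2" unfolding a2' using Lp by simp
  show A3: "0 \<le> \<alpha> 3" unfolding a3' using A2 pj0 r0 by simp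
  show A4: "0 \<le> \<alpha> 4" unfolding a4' using A3 pj0 r0 by simp
  show "(\<alpha> 2)\<^sup>2 \<le> \<alpha> 4 / 32"
  proof -
    have "32 \<le> L ^ 1" using L0 by simp
    also have "\<dots> \<le> L ^ 16" using L1 by (intro power_increasing) auto
    finally have L16: "32 \<le> L ^ 16" .
    have "\<alpha> 4 = (\<alpha> 2)\<^sup>2 * L ^ 16" unfolding a42 a2' using r0 Lp
      by (simp add: field_simps eval_nat_numeral)
    moreover have "(\<alpha> 2)\<^sup>2 * 32 \<le> (\<alpha> 2)\<^sup>2 * L ^ 16" using L16 by (intro mult_left_mono) auto
    ultimately show ?thesis by simp
  qed
  have div_r: "y / r \<le> z" if "y \<le> z" "0 \<le> z" for y z
  proof -
    have "z * 1 \<le> z * r" using that r3 by (intro mult_left_mono) auto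
    then show ?thesis using that r0 by (simp add: field_simps)
  qed
  show "\<alpha> 4 \<le> 4 * \<alpha> 3"
  proof -
    have "L ^ 12 * \<rho> / r \<le> 4" by (rule div_r) (use pjL[of 12] iL in auto)
    then have "\<alpha> 3 * (L ^ 12 * \<rho> / r) \<le> \<alpha> 3 * 4" using A3 by (intro mult_left_mono)
    then have "\<alpha> 3 * (L ^ 12 * \<rho>) / r \<le> 4 * \<alpha> 3" by (simp only: times_divide_eq_right mult.commute)
    then show ?thesis by (simp only: a4')
  qed
  show "2 * \<alpha> 3 \<le> \<alpha> 2"
  proof -
    have "L ^ 8 * \<rho> / r \<le> 1 / 2" by (rule div_r) (use pjL[of 8] iL in auto)
    then have "\<alpha> 2 * (L ^ 8 * \<rho> / r) \<le> \<alpha> 2 * (1 / 2)" using A2 by (intro mult_left_mono)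
    then have "\<alpha> 2 * (L ^ 8 * \<rho>) / r \<le> \<alpha> 2 / 2" by simp
    then have "\<alpha> 3 \<le> \<alpha> 2 / 2" by (simp only: a3')
    then show ?thesis by simp
  qed
  show "\<alpha> 4 / (4 * \<beta>) + \<alpha> 4 / 8 * (K * ln (real n) * sqrt (real n)) \<le> 7 / 32 * \<alpha> 3"
  proof -
    have "\<alpha> 4 / (4 * \<beta>) + \<alpha> 4 / 8 * (K * L * r) = \<alpha> 3 * ((25 + K / 8) * (L ^ 13 * \<rho>))"
    proof -
      have "y * M / r / (4 * (1 / (100 * r * L))) + y * M / r / 8 * (K * L * r) = y * ((25 + K / 8) * (L * M))" for y M
        using r0 Lp by (simp add: field_simps)
      moreover have "L ^ 13 * \<rho> = L * (L ^ 12 * \<rho>)" using power_Suc[of L 12] by simp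
      ultimately show ?thesis unfolding \<beta>' a4' by (simp only:)
    qed
    also have "\<dots> \<le> \<alpha> 3 * ((25 + K / 8) * (1 / L))"
      using A3 K pjL[of 13] by (intro mult_left_mono) auto
    also have "\<dots> \<le> \<alpha> 3 * (7 / 32)"
    proof (intro mult_left_mono A3)
      have eq: "(25 + K / 8) * (1 / L) = 25 * (1 / L) + (K / L) / 8" by (simp add: add_divide_distrib mult.commute)
      have "25 * (1 / L) + (K / L) / 8 \<le> 25 * (1 / 200) + (1 / 10) / 8"
        using iL KL by (intro add_mono mult_left_mono divide_right_mono) auto
      then show "(25 + K / 8) * (1 / L) \<le> 7 / 32" unfolding eq by simp
    qed
    finally show ?thesis unfolding L_def r_def by simp
  qed
  \<comment> \<open>The exponent 28 is 8 from the norm bound plus 20 from the ratio of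
    \<open>\<alpha> 4\<close> to \<open>\<alpha> 2\<close>; the square of \<rho> allows it to be
    split as 14 + 14.\<close>
  have sqb: "L ^ 28 * \<rho>\<^sup>2 \<le> 1 / L"
  proof -
    have "L ^ 28 * \<rho>\<^sup>2 = (L ^ 14 * \<rho>) * (L ^ 14 * \<rho>)" by (simp add: power2_eq_square flip: power_add)
    also have "\<dots> \<le> (1 / L) * 1"
    proof (rule mult_mono)
      show "L ^ 14 * \<rho> \<le> 1 / L" by (rule pjL) simp
      then show "L ^ 14 * \<rho> \<le> 1" using iL by linarith
    qed (use pj0[of 14] Lp in simp_all)
    finally show ?thesis by simp
  qed
  have sqb': "L ^ 27 * \<rho>\<^sup>2 \<le> 1 / L"
  proof -
    have "L ^ 27 * \<rho>\<^sup>2 \<le> L ^ 28 * \<rho>\<^sup>2" using L1 by (intro mult_right_mono power_increasing) auto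
    then show ?thesis using sqb by linarith
  qed
  have t1: "27 / 64 * \<alpha> 4 * (K * L ^ 8 * real n) \<le> \<alpha> 2 * (27 / 64 * (K / L))"
  proof -
    have "27 / 64 * \<alpha> 4 * (K * L ^ 8 * real n) = \<alpha> 2 * (27 / 64 * (K * (L ^ 28 * \<rho>\<^sup>2)))"
    proof -
      have "27 / 64 * (y * M / r\<^sup>2) * (K * z * r\<^sup>2) = y * (27 / 64 * (K * (z * M)))" for y M z
        using r0 by (simp add: field_simps)
      moreover have "L ^ 28 * \<rho>\<^sup>2 = L ^ 8 * (L ^ 20 * \<rho>\<^sup>2)" using power_add[of L 8 20] by simp
      ultimately show ?thesis unfolding a42 r2 by (simp only:)
    qed
    also have "\<dots> \<le> \<alpha> 2 * (27 / 64 * (K * (1 / L)))"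
      using A2 K sqb by (intro mult_left_mono) auto
    finally show ?thesis by simp
  qed
  have t2: "\<alpha> 3 / 2 * (K * L * r) \<le> \<alpha> 2 * (1 / 2 * (K / L))"
  proof -
    have "\<alpha> 3 / 2 * (K * L * r) = \<alpha> 2 * (1 / 2 * (K * (L ^ 9 * \<rho>)))"
    proof -
      have "y * M / r / 2 * (K * L * r) = y * (1 / 2 * (K * (L * M)))" for y M
        using r0 by (simp add: field_simps)
      moreover have "L ^ 9 * \<rho> = L * (L ^ 8 * \<rho>)" using power_Suc[of L 8] by simp
      ultimately show ?thesis unfolding a3' by (simp only:)
    qed
    also have "\<dots> \<le> \<alpha> 2 * (1 / 2 * (K * (1 / L)))"
      using A2 K pjL[of 9] by (intro mult_left_mono) auto
    finally show ?thesis by simp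
  qed
  have t3: "15 / 64 * \<beta> * \<alpha> 4 * (K * L ^ 8 * r ^ 3) \<le> \<alpha> 2 * (15 / 6400 * (K / L))"
  proof -
    have "15 / 64 * \<beta> * \<alpha> 4 * (K * L ^ 8 * r ^ 3) = \<alpha> 2 * (15 / 6400 * (K * (L ^ 27 * \<rho>\<^sup>2)))"
    proof -
      have "15 / 64 * (1 / (100 * r * L)) * (y * M / r\<^sup>2) * (K * (L * z) * r ^ 3) = y * (15 / 6400 * (K * (z * M)))" for y M z
        using r0 Lp by (simp add: field_simps power2_eq_square power3_eq_cube)
      moreover have "L ^ 27 * \<rho>\<^sup>2 = L ^ 7 * (L ^ 20 * \<rho>\<^sup>2)" using power_add[of L 7 20] by simp
      moreover have "L ^ 8 = L * L ^ 7" using power_Suc[of L 7] by simp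
      ultimately show ?thesis unfolding a42 \<beta>' by (simp only:)
    qed
    also have "\<dots> \<le> \<alpha> 2 * (15 / 6400 * (K * (1 / L)))"
      using A2 K sqb' by (intro mult_left_mono) auto
    finally show ?thesis by simp
  qed
  have t4: "\<beta> * (\<alpha> 2 + real n * \<alpha> 3) / 32 \<le> \<alpha> 2 * (1 / 1600)"
  proof -
    have "\<beta> * (\<alpha> 2 + real n * \<alpha> 3) / 32 = \<alpha> 2 * ((1 / L / r + L ^ 8 * \<rho> / L) / 3200)"
    proof -
      have "1 / (100 * r * L) * (y + r\<^sup>2 * (y * M / r)) / 32 = y * ((1 / L / r + M / L) / 3200)" for y M
        using r0 Lp by (simp add: field_simps power2_eq_square)
      then show ?thesis unfolding a3' \<beta>' r2 .
    qed
    also have "\<dots> \<le> \<alpha> 2 * ((1 + 1) / 3200)"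
    proof (intro mult_left_mono A2 divide_right_mono add_mono)
      show "1 / L / r \<le> 1" by (rule div_r) (use iL in auto)
      have "L ^ 8 * \<rho> \<le> 1" using pjL[of 8] iL by simp
      then show "L ^ 8 * \<rho> / L \<le> 1" using L1 by (simp add: field_simps)
    qed auto
    finally show ?thesis by simp
  qed
  have "27 / 64 * \<alpha> 4 * (K * L ^ 8 * real n) + \<alpha> 3 / 2 * (K * L * r)
       + 15 / 64 * \<beta> * \<alpha> 4 * (K * L ^ 8 * r ^ 3) + \<beta> * (\<alpha> 2 + real n * \<alpha> 3) / 32
     \<le> \<alpha> 2 * (27 / 64 * (K / L)) + \<alpha> 2 * (1 / 2 * (K / L)) + \<alpha> 2 * (15 / 6400 * (K / L)) + \<alpha> 2 * (1 / 1600)"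
    using t1 t2 t3 t4 by linarith
  also have "\<dots> = \<alpha> 2 * ((27 / 64 + 1 / 2 + 15 / 6400) * (K / L) + 1 / 1600)" by (simp add: algebra_simps)
  also have "\<dots> \<le> \<alpha> 2 * (7 / 32)" using KL by (intro mult_left_mono A2) simp
  finally show "27 / 64 * \<alpha> 4 * (K * ln (real n) ^ 8 * real n) + \<alpha> 3 / 2 * (K * ln (real n) * sqrt (real n))
       + 15 / 64 * \<beta> * \<alpha> 4 * (K * ln (real n) ^ 8 * sqrt (real n ^ 3)) + \<beta> * (\<alpha> 2 + real n * \<alpha> 3) / 32 \<le> 7 / 32 * \<alpha> 2"
    unfolding s3 L_def[symmetric] r_def[symmetric] by simp
qed

theorem theorem3p1:
  "\<exists>C>0. \<forall>n::nat. \<forall>(\<rho>::real) (\<alpha>::nat \<Rightarrow> real) (\<beta>::real) (\<gamma>::real).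
     n \<ge> 2 \<longrightarrow>
     \<beta> = 1 / (100 * sqrt (real n) * ln (real n)) \<longrightarrow>
     \<gamma> = ln (real n) ^ 4 \<longrightarrow>
     0 \<le> \<rho> \<longrightarrow> \<rho> < 1 / ln (real n) ^ 20 \<longrightarrow>
     \<alpha> 0 = 1 \<longrightarrow>
     \<alpha> 1 = \<rho> / real n powr (1/2) \<longrightarrow>
     \<alpha> 2 = \<gamma> * \<rho>\<^sup>2 / real n \<longrightarrow>
     \<alpha> 3 = \<gamma> ^ 3 * \<rho> ^ 3 / real n powr (3/2) \<longrightarrow>
     \<alpha> 4 = \<gamma> ^ 6 * \<rho> ^ 4 / (real n)\<^sup>2 \<longrightarrow>
     measure_pmf.prob (gnp n (1/2))
       {G. loewner_le_on (pairs n)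
             (\<lambda>A B. 1/8 * EH22 n \<alpha> A B + \<beta> * lambda0 n \<alpha> / 16 * Pi_W n G A B)
             (H22' n \<alpha> \<beta> G)}
       \<ge> 1 - C / real n ^ 4"
proof -
  obtain K0 where K0: "K0 > 0" "\<And>n. n \<ge> 5 \<Longrightarrow> measure_pmf.prob (gnp n (1/2)) {G. \<not> good K0 n G} \<le> 10 / real n ^ 4"
    using good_prob by blast
  define K where "K = max K0 1"
  have K1: "1 \<le> K" by (simp add: K_def)
  have "((\<lambda>n::nat. ln (real n) ^ 8 / sqrt (real n)) \<longlongrightarrow> 0) at_top" by real_asymp
  then have "eventually (\<lambda>n::nat. ln (real n) ^ 8 / sqrt (real n) < 1 / (4 * K)) at_top"
    using K1 by (intro order_tendstoD(2)) auto
  moreover have "filterlim (\<lambda>n::nat. ln (real n)) at_top at_top" by real_asymp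
  then have "eventually (\<lambda>n::nat. 200 + 10 * K \<le> ln (real n)) at_top" by (auto simp: filterlim_at_top)
  ultimately have "eventually (\<lambda>n::nat. ln (real n) ^ 8 / sqrt (real n) < 1 / (4 * K) \<and> 200 + 10 * K \<le> ln (real n)) at_top"
    by (rule eventually_conj)
  then obtain n1 where n1: "\<And>n. n \<ge> n1 \<Longrightarrow> ln (real n) ^ 8 / sqrt (real n) < 1 / (4 * K) \<and> 200 + 10 * K \<le> ln (real n)"
    by (auto simp: eventually_at_top_linorder)
  define n0 where "n0 = max n1 12"
  \<comment> \<open>The value 10 is the union bound for large n; the fourth power of
    \<open>n0\<close> makes the claimed lower bound nonpositive for small n.\<close>
  define C where "C = max 10 (real n0 ^ 4)"
  have C0: "C > 0" by (simp add: C_def)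
  show ?thesis
  proof (intro exI[of _ C] conjI C0 allI impI)
    fix n :: nat and \<rho> \<beta> \<gamma> :: real and \<alpha> :: "nat \<Rightarrow> real"
    assume asm: "n \<ge> 2" "\<beta> = 1 / (100 * sqrt (real n) * ln (real n))" "\<gamma> = ln (real n) ^ 4"
      "0 \<le> \<rho>" "\<rho> < 1 / ln (real n) ^ 20" "\<alpha> 2 = \<gamma> * \<rho>\<^sup>2 / real n"
      "\<alpha> 3 = \<gamma> ^ 3 * \<rho> ^ 3 / real n powr (3/2)" "\<alpha> 4 = \<gamma> ^ 6 * \<rho> ^ 4 / (real n)\<^sup>2"
    let ?L = "{G. loewner_le_on (pairs n) (\<lambda>A B. 1/8 * EH22 n \<alpha> A B + \<beta> * lambda0 n \<alpha> / 16 * Pi_W n G A B)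
             (H22' n \<alpha> \<beta> G)}"
    show "1 - C / real n ^ 4 \<le> measure_pmf.prob (gnp n (1/2)) ?L"
    proof (cases "n \<ge> n0")
      case False
      then have "real n ^ 4 \<le> real n0 ^ 4" by (intro power_mono) auto
      also have "\<dots> \<le> C" by (simp add: C_def)
      finally have "1 \<le> C / real n ^ 4" using asm(1) by simp
      then show ?thesis using measure_nonneg[of "gnp n (1/2)" ?L] by linarith
    next
      case True
      then have n: "n \<ge> 12" "n \<ge> n1" by (auto simp: n0_def)
      have l: "200 + 10 * K \<le> ln (real n)" using n1[OF n(2)] by simp
      have h6: "K * ln (real n) ^ 8 \<le> sqrt (real n) / 4" using n1[OF n(2)] n K1 by (simp add: field_simps)
      \<comment> \<open>The event \<open>good\<close> does not involve \<rho> or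
        \<open>\<alpha>\<close>, so one constant serves all admissible parameters.\<close>
      have "{G. good K0 n G} \<subseteq> ?L"
      proof
        fix G assume "G \<in> {G. good K0 n G}"
        then have "good K0 n G" by simp
        then have good: "good K n G" by (rule good_mono) (use n in \<open>simp_all add: K_def\<close>)
        note par = parameters[OF n(1) K1 l asm(2-8)]
        show "G \<in> ?L"
          using loewner_deterministic[where \<alpha> = \<alpha>, OF good n(1) K1 par h6] by simp
      qed
      then have "measure_pmf.prob (gnp n (1/2)) {G. good K0 n G} \<le> measure_pmf.prob (gnp n (1/2)) ?L"
        by (intro measure_pmf.finite_measure_mono) auto
      moreover have "measure_pmf.prob (gnp n (1/2)) {G. good K0 n G} = 1 - measure_pmf.prob (gnp n (1/2)) {G. \<not> good K0 n G}"
      proof -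
        have "{G. good K0 n G} = space (measure_pmf (gnp n (1/2))) - {G. \<not> good K0 n G}" by auto
        then show ?thesis by (simp only: measure_pmf.prob_compl[of "{G. \<not> good K0 n G}"] sets_measure_pmf UNIV_I Pow_UNIV)
      qed
      moreover have "measure_pmf.prob (gnp n (1/2)) {G. \<not> good K0 n G} \<le> 10 / real n ^ 4"
        using n by (intro K0(2)) simp
      moreover have "10 / real n ^ 4 \<le> C / real n ^ 4" by (intro divide_right_mono) (auto simp: C_def)
      ultimately show ?thesis by linarith
    qed
  qed
qed

end
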